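(* Let $\lambda=(\lambda_1,\dots,\lambda_m)$ be a partition of $N=\sum_{i=1}^m\lambda_i$, with $\lambda_1\ge\dots\ge\lambda_m\ge1$. (1) The orbit Dirichlet series $\mathsf{d}_{T_\lambda}(s)$ has abscissa of convergence $N$. If $m=1$ or $\lambda=(1,1)$, then it may be continued meromorphically to the whole complex plane; otherwise it has meromorphic continuation to $\{s\in\mathbb{C}\mid \operatorname{Re}(s)>N-2\}$. In any case, the continued function is holomorphic on the line $\{s\in\mathbb{C}\mid\operatorname{Re}(s)=N\}$ except for a simple pole at $s=N$. (2) There exists a constant $K_\lambda\in\mathbb{R}_{>0}$ such that $$\sum_{\nu\le n}\mathsf{O}_{T_\lambda}(\nu)\sim K_\lambda n^{N}\quad\text{as } n\to\infty.$$
   Context: For a map $T:X\to X$, a closed orbit of length $n\in\mathbb{N}=\{1,2,\dots\}$ is a set $\{x,T(x),T^2(x),\dots,T^n(x)=x\}$ of cardinality $n$. Let $\mathsf{O}_T(n)$ be the number of closed orbits of length $n$, assumed finite for all $n$. The orbit Dirichlet series of $T$ is $\mathsf{d}_T(s)=\sum_{n=1}^\infty \mathsf{O}_T(n)n^{-s}$. For $r\in\mathbb{N}$, $T_r$ denotes a map such that $\mathsf{O}_{T_r}(n)=a_n(\mathbb{Z}^r)$ for all $n\in\mathbb{N}$, where $a_n(\mathbb{Z}^r)$ is the number of subgroups of index $n$ in $\mathbb{Z}^r$; equivalently $\mathsf{d}_{T_r}(s)=\prod_{i=0}^{r-1}\zeta(s-i)$, with $\zeta$ the Riemann zeta function. For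 a partition $\lambda=(\lambda_1,\dots,\lambda_m)$, $T_\lambda=T_{\lambda_1}\times\dots\times T_{\lambda_m}$ is the Cartesian product map (acting coordinatewise). $f(n)\sim g(n)$ means $\lim_{n\to\infty}f(n)/g(n)=1$. *)

theory Defs
  imports
    "HOL-Complex_Analysis.Complex_Analysis"
    "HOL-Algebra.Product_Groups"
    "HOL-Library.Landau_Symbols"
begin

definition closed_orbits :: "'a set \<Rightarrow> ('a \<Rightarrow> 'a) \<Rightarrow> nat \<Rightarrow> 'a set set" where
  "closed_orbits X T n =
     {P. \<exists>x\<in>X. P = {(T ^^ k) x | k. k \<le> n} \<and> (T ^^ n) x = x \<and> card P = n}"

definition orbit_count :: "'a set \<Rightarrow> ('a \<Rightarrow> 'a) \<Rightarrow> nat \<Rightarrow> nat" where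
  "orbit_count X T n = card (closed_orbits X T n)"

definition dirichlet_series :: "(nat \<Rightarrow> complex) \<Rightarrow> complex \<Rightarrow> complex" where
  "dirichlet_series a s = (\<Sum>n. a (Suc n) * of_nat (Suc n) powr (-s))"

definition abscissa_of_convergence :: "(nat \<Rightarrow> complex) \<Rightarrow> ereal" where
  "abscissa_of_convergence a =
     (INF s\<in>{s. summable (\<lambda>n. a (Suc n) * of_nat (Suc n) powr (-s))}. ereal (Re s))"

definition orbit_dirichlet_series :: "'a set \<Rightarrow> ('a \<Rightarrow> 'a) \<Rightarrow> complex \<Rightarrow> complex" where
  "orbit_dirichlet_series X T = dirichlet_series (\<lambda>n. of_nat (orbit_count X T n))"

definition Z_power :: "nat \<Rightarrow> (nat \<Rightarrow> int) monoid" where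
  "Z_power r = product_group {..<r} (\<lambda>_. integer_group)"

(* The index is the cardinality of the set of cosets.  Since card is 0 on infinite sets,
   this is the number of subgroups of index n only for n >= 1. *)
definition index_subgroup_count :: "('b, 'c) monoid_scheme \<Rightarrow> nat \<Rightarrow> nat" where
  "index_subgroup_count G n = card {H. subgroup H G \<and> card (rcosets\<^bsub>G\<^esub> H) = n}"

(* For a family of systems (X r, T r), the product over the parts of a partition: points are
   functions on the positions i < length lam, the i-th coordinate lying in X (lam ! i). *)
definition partition_space :: "(nat \<Rightarrow> 'a set) \<Rightarrow> nat list \<Rightarrow> (nat \<Rightarrow> 'a) set" where
  "partition_space X lam = (\<Pi>\<^sub>E i\<in>{..<length lam}. X (lam ! i))"

definition partition_map :: "(nat \<Rightarrow> 'a \<Rightarrow> 'a) \<Rightarrow> nat list \<Rightarrow> (nat \<Rightarrow> 'a) \<Rightarrow> nat \<Rightarrow> 'a" where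
  "partition_map T lam x = (\<lambda>i\<in>{..<length lam}. T (lam ! i) (x i))"

end

theory Submission
  imports Defs "HOL-Real_Asymp.Real_Asymp"
begin

text \<open>
  A point of a product system is fixed by the \<open>n\<close>-th iterate exactly if all
  its coordinates are, so numbers of fixed points multiply, and they determine the orbit counts by
  \<open>\<Sum>d | n. d O(d) = F(n)\<close> (\<open>orbit_count_partition_convolution\<close>). For a map with \<open>a\<^sub>n(\<int>\<^sup>r)\<close> orbits of length
  \<open>n\<close>, the number of fixed points is \<open>\<Sum>d | n. d a\<^sub>d(\<int>\<^sup>r) = a\<^sub>n(\<int>\<^sup>r\<^sup>+\<^sup>1)\<close>: a subgroup of
  \<open>\<int>\<^sup>r \<times> \<int>\<close> is given by its projection to \<open>\<int>\<close>, its intersection with \<open>\<int>\<^sup>r\<close> and a coset of the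
  latter (\<open>index_subgroups_timesZ\<close>). So \<open>F(n)\<close> is the product of the numbers \<open>a\<^sub>n(\<int>\<^sup>r\<^sup>+\<^sup>1)\<close> over the parts
  \<open>r\<close> of the partition, and the orbit series is \<open>\<Phi>(s + 1) / \<zeta>(s + 1)\<close> with \<open>\<Phi>(u) = \<Sum> F(n) n\<^sup>-\<^sup>u\<close>.

  The first pole and the growth come from the divisor structure of \<open>F\<close>. One has \<open>F(n) = n\<^sup>N \<Sum>e | n. H(e)\<close> with \<open>H \<ge> 0\<close> and
  \<open>\<Sum> H(e) e\<^sup>-\<^sup>\<sigma>\<close> finite for all \<open>\<sigma> > 0\<close> (\<open>fixed_point_count_weight\<close>). Hence \<open>\<Phi>(u)\<close> is \<open>\<zeta>(u - N)\<close> times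
  a series that converges absolutely for \<open>Re u > N\<close> and is positive at \<open>u = N + 1\<close>. Likewise \<open>O\<close> is
  the convolution of \<open>n\<^sup>N\<^sup>-\<^sup>1\<close> with a sequence \<open>\<beta>\<close> for which \<open>\<Sum> \<beta>(e) e\<^sup>-\<^sup>N\<close> converges absolutely to a
  positive number (\<open>orbit_weights\<close>), and dominated convergence gives the asymptotics of the summatory
  function (\<open>summatory_asymptotics\<close>). This growth rules out convergence to
  the left of \<open>N\<close> (\<open>divergence_left_of_growth\<close>).

  The continuation beyond \<open>N - 1\<close> uses the Euler product of \<open>\<Phi>\<close>. Let \<open>m\<close> be the number of parts,
  \<open>w = s - N + 2\<close> and \<open>X = p\<^sup>-\<^sup>w\<close>. The local factors are rational functions of \<open>X\<close> of the form
  \<open>(1 + (m - 1) X + O(p\<^sup>-\<^sup>1\<^sup>-\<^sup>\<delta>)) / ((1 - p X) (1 - X))\<close>, uniformly on \<open>Re w \<ge> \<delta>\<close>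
  (\<open>local_numerator_bound\<close>). By a device of Estermann, multiplication by finitely many factors
  \<open>1 \<plusminus> X\<^sup>k\<close>, whose Euler products are given by \<open>\<zeta>(k w)\<close> and \<open>\<zeta>(2 k w)\<close>, turns \<open>1 + (m - 1) X\<close> into
  \<open>1 + O(X\<^sup>K\<^sup>+\<^sup>1)\<close> (\<open>cyclo_factor_exists\<close>), and then the product converges for \<open>Re w > \<delta>\<close>
  (\<open>fixed_point_count_continuation\<close>). The results for \<open>\<delta> \<rightarrow> 0\<close> are glued (\<open>meromorphic_glue\<close>). For \<open>m = 1\<close> and for
  the partition \<open>(1, 1)\<close> the Euler product is a quotient of products of translates and dilates of
  \<open>\<zeta>\<close>, which gives the continuation to the whole plane. The continuation of \<open>\<zeta>\<close> itself comes from
  expanding \<open>(n + 1)\<^sup>1\<^sup>-\<^sup>s - n\<^sup>1\<^sup>-\<^sup>s\<close> by the binomial series and summing over \<open>n\<close> (\<open>zeta_recursion\<close>).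
\<close>

section \<open>Subgroups of free abelian groups\<close>

text \<open>The numbers of subgroups of index \<open>n\<close> of \<open>\<int>\<^sup>r\<close>, given by the recursion that expresses
\<open>\<zeta>(s) \<zeta>(s - 1) \<cdots> \<zeta>(s - r)\<close> as \<open>\<zeta>(s)\<close> times the shift of the previous product.\<close>
fun subgroup_number :: "nat \<Rightarrow> nat \<Rightarrow> nat" where
  "subgroup_number 0 n = (if n = 1 then 1 else 0)"
| "subgroup_number (Suc r) n = (\<Sum>d | d dvd n. d * subgroup_number r d)"

definition index_subgroups :: "('b, 'c) monoid_scheme \<Rightarrow> nat \<Rightarrow> 'b set set" where
  "index_subgroups G n = {H. subgroup H G \<and> card (rcosets\<^bsub>G\<^esub> H) = n}"

lemma bij_betw_images_same_kernel:
  assumes "\<And>a b. a \<in> A \<Longrightarrow> b \<in> A \<Longrightarrow> f a = f b \<longleftrightarrow> g a = g b"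
  shows "\<exists>h. bij_betw h (f ` A) (g ` A)"
proof -
  define h where "h = (\<lambda>y. g (SOME a. a \<in> A \<and> f a = y))"
  have h: "h (f a) = g a" if "a \<in> A" for a
  proof -
    have "(SOME b. b \<in> A \<and> f b = f a) \<in> A \<and> f (SOME b. b \<in> A \<and> f b = f a) = f a"
      by (rule someI[of _ a]) (use that in auto)
    thus ?thesis unfolding h_def using assms that by blast
  qed
  have "inj_on h (f ` A)"
    by (rule inj_onI) (use h assms in force)
  moreover have "h ` f ` A = g ` A"
    using h by force
  ultimately show ?thesis by (auto simp: bij_betw_def)
qed

lemma card_images_same_kernel:
  assumes "\<And>a b. a \<in> A \<Longrightarrow> b \<in> A \<Longrightarrow> f a = f b \<longleftrightarrow> g a = g b"
  shows "card (f ` A) = card (g ` A)"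
  using bij_betw_images_same_kernel[of A f g] assms bij_betw_same_card by metis

lemma (in group) rcoset_eq_iff:
  assumes "subgroup H G" "a \<in> carrier G" "b \<in> carrier G"
  shows "H #> a = H #> b \<longleftrightarrow> a \<otimes> inv b \<in> H"
proof -
  interpret subgroup H G by fact
  have "a \<in> H #> b \<longleftrightarrow> a \<otimes> inv b \<in> H"
    by (rule rcos_module) (use assms is_group in auto)
  moreover have "a \<in> H #> a"
    using assms rcos_self by blast
  moreover have "H #> a = H #> b" if "a \<in> H #> b"
    using repr_independence[OF that assms(3) assms(1)] by simp
  ultimately show ?thesis by blast
qed

text \<open>The way every index below is computed: exhibit an invariant \<open>\<psi>\<close> whose fibres are the cosets, and
count its values.\<close>
lemma (in group) card_rcosets_eq_card_image:
  assumes "subgroup H G"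
    and "\<And>a b. a \<in> carrier G \<Longrightarrow> b \<in> carrier G \<Longrightarrow> \<psi> a = \<psi> b \<longleftrightarrow> a \<otimes> inv b \<in> H"
  shows "card (rcosets H) = card (\<psi> ` carrier G)"
proof -
  have "rcosets H = (\<lambda>a. H #> a) ` carrier G"
    by (auto simp: RCOSETS_def)
  thus ?thesis
    using card_images_same_kernel[of "carrier G" "\<lambda>a. H #> a" \<psi>] assms rcoset_eq_iff by simp
qed

lemma index_subgroups_iso:
  assumes G: "group G" and K: "group K" and \<phi>: "\<phi> \<in> iso G K"
  shows "bij_betw ((`) \<phi>) (index_subgroups G n) (index_subgroups K n)"
proof -
  interpret G: group G by fact
  interpret K: group K by fact
  interpret \<phi>: group_hom G K \<phi>
    using \<phi> by unfold_locales (auto simp: iso_def)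
  define \<theta> where "\<theta> = inv_into (carrier G) \<phi>"
  have bij: "bij_betw \<phi> (carrier G) (carrier K)"
    using \<phi> by (auto simp: iso_def)
  have \<theta>: "\<theta> \<in> iso K G"
    unfolding \<theta>_def using G.iso_set_sym[OF \<phi>] .
  interpret \<theta>: group_hom K G \<theta>
    using \<theta> by unfold_locales (auto simp: iso_def)
  have \<theta>\<phi>: "\<theta> (\<phi> x) = x" if "x \<in> carrier G" for x
    using bij that by (simp add: \<theta>_def bij_betw_def)
  have \<phi>\<theta>: "\<phi> (\<theta> y) = y" if "y \<in> carrier K" for y
    using bij that by (simp add: \<theta>_def bij_betw_def f_inv_into_f)
  have card: "card (rcosets\<^bsub>K\<^esub> (\<phi> ` H)) = card (rcosets\<^bsub>G\<^esub> H)" if H: "subgroup H G" for H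
  proof -
    have "card (rcosets\<^bsub>K\<^esub> (\<phi> ` H)) = card ((\<lambda>y. H #>\<^bsub>G\<^esub> \<theta> y) ` carrier K)"
    proof (rule K.card_rcosets_eq_card_image)
      show "subgroup (\<phi> ` H) K"
        using H by (rule \<phi>.subgroup_img_is_subgroup)
      fix a b assume ab: "a \<in> carrier K" "b \<in> carrier K"
      have "H #>\<^bsub>G\<^esub> \<theta> a = H #>\<^bsub>G\<^esub> \<theta> b \<longleftrightarrow> \<theta> a \<otimes>\<^bsub>G\<^esub> inv\<^bsub>G\<^esub> (\<theta> b) \<in> H"
        using G.rcoset_eq_iff[OF H] ab by simp
      also have "\<theta> a \<otimes>\<^bsub>G\<^esub> inv\<^bsub>G\<^esub> (\<theta> b) = \<theta> (a \<otimes>\<^bsub>K\<^esub> inv\<^bsub>K\<^esub> b)"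
        using ab by simp
      also have "\<dots> \<in> H \<longleftrightarrow> a \<otimes>\<^bsub>K\<^esub> inv\<^bsub>K\<^esub> b \<in> \<phi> ` H"
      proof -
        have "a \<otimes>\<^bsub>K\<^esub> inv\<^bsub>K\<^esub> b \<in> carrier K" using ab by simp
        thus ?thesis
          using \<phi>\<theta> \<theta>\<phi> subgroup.subset[OF H] by (smt (verit) image_iff subsetD)
      qed
      finally show "H #>\<^bsub>G\<^esub> \<theta> a = H #>\<^bsub>G\<^esub> \<theta> b \<longleftrightarrow> a \<otimes>\<^bsub>K\<^esub> inv\<^bsub>K\<^esub> b \<in> \<phi> ` H" .
    qed
    also have "(\<lambda>y. H #>\<^bsub>G\<^esub> \<theta> y) ` carrier K = (\<lambda>x. H #>\<^bsub>G\<^esub> x) ` (\<theta> ` carrier K)"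
      by (simp add: image_image)
    also have "\<theta> ` carrier K = carrier G"
      using \<theta> by (auto simp: iso_def bij_betw_def)
    also have "(\<lambda>x. H #>\<^bsub>G\<^esub> x) ` carrier G = rcosets\<^bsub>G\<^esub> H"
      by (auto simp: RCOSETS_def)
    finally show ?thesis .
  qed
  have \<theta>\<phi>_img: "\<theta> ` \<phi> ` H = H" if "subgroup H G" for H
  proof -
    have "(\<lambda>x. \<theta> (\<phi> x)) ` H = (\<lambda>x. x) ` H"
      using \<theta>\<phi> subgroup.subset[OF that] by (intro image_cong) auto
    thus ?thesis by (simp only: image_image image_ident)
  qed
  have \<phi>\<theta>_img: "\<phi> ` \<theta> ` H = H" if "subgroup H K" for H
  proof -
    have "(\<lambda>x. \<phi> (\<theta> x)) ` H = (\<lambda>x. x) ` H"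
      using \<phi>\<theta> subgroup.subset[OF that] by (intro image_cong) auto
    thus ?thesis by (simp only: image_image image_ident)
  qed
  show ?thesis
  proof (rule bij_betw_byWitness[where f' = "(`) \<theta>"])
    show "\<forall>a\<in>index_subgroups G n. \<theta> ` \<phi> ` a = a"
      using \<theta>\<phi>_img by (auto simp: index_subgroups_def)
    show "\<forall>a'\<in>index_subgroups K n. \<phi> ` \<theta> ` a' = a'"
      using \<phi>\<theta>_img by (auto simp: index_subgroups_def)
    show "(`) \<phi> ` index_subgroups G n \<subseteq> index_subgroups K n"
      using card \<phi>.subgroup_img_is_subgroup by (auto simp: index_subgroups_def)
    show "(`) \<theta> ` index_subgroups K n \<subseteq> index_subgroups G n"
    proof safe
      fix H assume H: "H \<in> index_subgroups K n"
      hence "subgroup (\<theta> ` H) G"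
        using \<theta>.subgroup_img_is_subgroup by (auto simp: index_subgroups_def)
      thus "\<theta> ` H \<in> index_subgroups G n"
        using card[of "\<theta> ` H"] \<phi>\<theta>_img[of H] H by (auto simp: index_subgroups_def)
    qed
  qed
qed

text \<open>A subgroup \<open>S\<close> of \<open>G \<times> \<int>\<close> of finite index is an extension of \<open>d \<int>\<close>, its projection to \<open>\<int>\<close>,
by its fibre \<open>H\<close> over \<open>0\<close>. It is determined by \<open>d\<close>, \<open>H\<close> and the coset of \<open>H\<close> formed by the fibre
over \<open>d\<close>; here \<open>g\<close> is a representative of that coset.\<close>
definition cyclic_extension ::
    "('b, 'c) monoid_scheme \<Rightarrow> 'b set \<Rightarrow> 'b \<Rightarrow> nat \<Rightarrow> ('b \<times> int) set" where
  "cyclic_extension G H g d =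
     {(x, z). x \<in> carrier G \<and> int d dvd z \<and> x \<otimes>\<^bsub>G\<^esub> inv\<^bsub>G\<^esub> (g [^]\<^bsub>G\<^esub> (z div int d)) \<in> H}"

definition fibre :: "('b \<times> int) set \<Rightarrow> int \<Rightarrow> 'b set" where
  "fibre S z = {x. (x, z) \<in> S}"

definition min_height :: "('b \<times> int) set \<Rightarrow> nat" where
  "min_height S = (LEAST d. d > 0 \<and> fibre S (int d) \<noteq> {})"

context comm_group
begin

abbreviation timesZ where "timesZ \<equiv> G \<times>\<times> integer_group"

lemma timesZ_group: "group timesZ"
  by (rule DirProd_group) (use is_group in auto)

lemma timesZ_simps:
  "carrier timesZ = carrier G \<times> UNIV"
  "(x, z) \<otimes>\<^bsub>timesZ\<^esub> (x', z') = (x \<otimes> x', z + z')"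
  "\<one>\<^bsub>timesZ\<^esub> = (\<one>, 0)"
  by (auto simp: DirProd_def integer_group_def)

lemma timesZ_inv: "x \<in> carrier G \<Longrightarrow> inv\<^bsub>timesZ\<^esub> (x, z) = (inv x, -z)"
  using inv_DirProd[OF is_group group_integer_group, of x z] by simp

lemma cyclic_extension_quotient:
  assumes H: "subgroup H G" and g: "g \<in> carrier G" and d: "d > 0"
    and x: "x \<in> carrier G" "x' \<in> carrier G" and dvd: "int d dvd z - z'"
  shows "(x \<otimes> inv x', z - z') \<in> cyclic_extension G H g d \<longleftrightarrow>
     (x \<otimes> inv (g [^] (z div int d))) \<otimes> inv (x' \<otimes> inv (g [^] (z' div int d))) \<in> H"
proof -
  have "z mod int d = z' mod int d"
    using dvd by (simp add: mod_eq_dvd_iff)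
  hence *: "(z - z') div int d = z div int d - z' div int d"
    using d by (smt (verit) add_diff_cancel_right' dvd div_mult_mod_eq dvd_div_mult_self
      left_diff_distrib mult_right_cancel of_nat_0_less_iff)
  let ?a = "g [^] (z div int d)" and ?b = "g [^] (z' div int d)"
  have ab: "?a \<in> carrier G" "?b \<in> carrier G"
    using g by auto
  have pow: "g [^] ((z - z') div int d) = ?a \<otimes> inv ?b"
    unfolding * using g by (rule int_pow_diff)
  have "x \<otimes> inv x' \<otimes> inv (?a \<otimes> inv ?b) = (x \<otimes> inv ?a) \<otimes> inv (x' \<otimes> inv ?b)"
    using x ab by (simp add: inv_mult m_ac)
  thus ?thesis
    using x dvd by (simp add: cyclic_extension_def pow)
qed

lemma subgroup_cyclic_extension:
  assumes H: "subgroup H G" and g: "g \<in> carrier G" and d: "d > 0"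
  shows "subgroup (cyclic_extension G H g d) timesZ"
proof -
  interpret H: subgroup H G by fact
  interpret K: group timesZ by (rule timesZ_group)
  let ?S = "cyclic_extension G H g d"
  show ?thesis
  proof (rule K.subgroupI)
    show "?S \<subseteq> carrier timesZ"
      by (auto simp: cyclic_extension_def)
    have "(\<one>, 0) \<in> ?S"
      by (simp add: cyclic_extension_def)
    thus "?S \<noteq> {}" by blast
    have quot: "(x \<otimes> inv x', z - z') \<in> ?S" if "(x, z) \<in> ?S" "(x', z') \<in> ?S" for x x' z z'
    proof -
      have x: "x \<in> carrier G" "x' \<in> carrier G" "int d dvd z - z'"
        using that by (auto simp: cyclic_extension_def)
      show ?thesis
        by (subst cyclic_extension_quotient[OF H g d x])
           (use that in \<open>auto simp: cyclic_extension_def intro!: H.m_closed H.m_inv_closed\<close>)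
    qed
    have inv': "(inv x, -z) \<in> ?S" if "(x, z) \<in> ?S" for x z
    proof -
      have "x \<in> carrier G" using that by (auto simp: cyclic_extension_def)
      thus ?thesis using quot[OF \<open>(\<one>, 0) \<in> ?S\<close> that] by simp
    qed
    show "inv\<^bsub>timesZ\<^esub> a \<in> ?S" if "a \<in> ?S" for a
    proof (cases a)
      case (Pair x z)
      moreover have "x \<in> carrier G" using that Pair by (auto simp: cyclic_extension_def)
      ultimately show ?thesis using inv' that by (simp add: timesZ_inv)
    qed
    show "a \<otimes>\<^bsub>timesZ\<^esub> b \<in> ?S" if "a \<in> ?S" "b \<in> ?S" for a b
    proof (cases a; cases b)
      fix x z x' z' assume ab: "a = (x, z)" "b = (x', z')"
      have "x' \<in> carrier G" using that ab by (auto simp: cyclic_extension_def)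
      thus ?thesis
        using quot[of x z "inv x'" "- z'"] inv'[of x' z'] that ab
        by (simp add: timesZ_simps)
    qed
  qed
qed

text \<open>Modulo \<open>S\<close>, each element of \<open>G \<times> \<int>\<close> can be moved by a multiple of \<open>(g, d)\<close> to a height in
\<open>{0..<d}\<close>, and then only its coset modulo \<open>H\<close> matters.\<close>
lemma card_rcosets_cyclic_extension:
  assumes H: "subgroup H G" and g: "g \<in> carrier G" and d: "d > 0"
  shows "card (rcosets\<^bsub>timesZ\<^esub> (cyclic_extension G H g d)) = d * card (rcosets H)"
proof -
  interpret K: group timesZ by (rule timesZ_group)
  let ?S = "cyclic_extension G H g d"
  define \<psi> where "\<psi> = (\<lambda>(x, z). (H #> (x \<otimes> inv (g [^] (z div int d))), z mod int d))"
  have "card (rcosets\<^bsub>timesZ\<^esub> ?S) = card (\<psi> ` carrier timesZ)"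
  proof (rule K.card_rcosets_eq_card_image)
    show "subgroup ?S timesZ"
      using assms by (rule subgroup_cyclic_extension)
    fix a b assume ab: "a \<in> carrier timesZ" "b \<in> carrier timesZ"
    obtain x z x' z' where xz: "a = (x, z)" "b = (x', z')"
      by (cases a; cases b)
    have x: "x \<in> carrier G" "x' \<in> carrier G"
      using ab xz by auto
    have gp: "g [^] k \<in> carrier G" for k :: int using g by simp
    have "a \<otimes>\<^bsub>timesZ\<^esub> inv\<^bsub>timesZ\<^esub> b = (x \<otimes> inv x', z - z')"
      using x xz by (simp add: timesZ_inv timesZ_simps)
    moreover have "\<psi> a = \<psi> b \<longleftrightarrow> (x \<otimes> inv x', z - z') \<in> ?S"
    proof (cases "int d dvd z - z'")
      case True
      hence "\<psi> a = \<psi> b \<longleftrightarrow> H #> (x \<otimes> inv (g [^] (z div int d))) = H #> (x' \<otimes> inv (g [^] (z' div int d)))"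
        by (simp add: \<psi>_def xz mod_eq_dvd_iff)
      also have "\<dots> \<longleftrightarrow> (x \<otimes> inv x', z - z') \<in> ?S"
        by (subst cyclic_extension_quotient[OF H g d x True], subst rcoset_eq_iff[OF H])
           (use x gp in auto)
      finally show ?thesis .
    next
      case False
      thus ?thesis
        by (auto simp: \<psi>_def xz mod_eq_dvd_iff cyclic_extension_def)
    qed
    ultimately show "\<psi> a = \<psi> b \<longleftrightarrow> a \<otimes>\<^bsub>timesZ\<^esub> inv\<^bsub>timesZ\<^esub> b \<in> ?S" by simp
  qed
  also have "\<psi> ` carrier timesZ = (rcosets H) \<times> {0..<int d}"
  proof (intro equalityI subsetI)
    fix y assume "y \<in> \<psi> ` carrier timesZ"
    thus "y \<in> (rcosets H) \<times> {0..<int d}"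
      using g d int_pow_closed[OF g] by (fastforce simp: \<psi>_def RCOSETS_def)
  next
    fix y assume "y \<in> (rcosets H) \<times> {0..<int d}"
    then obtain x z where "y = (H #> x, z)" "x \<in> carrier G" "0 \<le> z" "z < int d"
      by (auto simp: RCOSETS_def)
    hence "y = \<psi> (x, z)" "(x, z) \<in> carrier timesZ"
      by (auto simp: \<psi>_def)
    thus "y \<in> \<psi> ` carrier timesZ" by blast
  qed
  also have "card \<dots> = d * card (rcosets H)"
    by (simp add: card_cartesian_product)
  finally show ?thesis .
qed

lemma fibre_cyclic_extension:
  assumes H: "subgroup H G" and g: "g \<in> carrier G" and d: "d > 0"
  shows "fibre (cyclic_extension G H g d) 0 = H"
    and "fibre (cyclic_extension G H g d) (int d) = H #> g"
    and "min_height (cyclic_extension G H g d) = d"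
proof -
  interpret H: subgroup H G by fact
  show *: "fibre (cyclic_extension G H g d) 0 = H"
    by (auto simp: fibre_def cyclic_extension_def)
  have "x \<in> H #> g \<longleftrightarrow> x \<in> carrier G \<and> x \<otimes> inv g \<in> H" for x
    using H.rcos_module[OF is_group g, of x] H.elemrcos_carrier[OF is_group g] by blast
  thus **: "fibre (cyclic_extension G H g d) (int d) = H #> g"
    using d g by (auto simp: fibre_def cyclic_extension_def)
  have "g \<in> H #> g"
    using rcos_self[OF g H] .
  show "min_height (cyclic_extension G H g d) = d"
    unfolding min_height_def
  proof (rule Least_equality)
    show "0 < d \<and> fibre (cyclic_extension G H g d) (int d) \<noteq> {}"
      using ** \<open>g \<in> H #> g\<close> d by auto
    fix k assume "0 < k \<and> fibre (cyclic_extension G H g d) (int k) \<noteq> {}"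
    thus "d \<le> k"
      by (auto simp: fibre_def cyclic_extension_def dest: dvd_imp_le)
  qed
qed

lemma subgroup_timesZ_pow:
  assumes S: "subgroup S timesZ" and g: "(g, z) \<in> S"
  shows "(g [^] (k::int), z * k) \<in> S"
proof -
  interpret S: subgroup S timesZ by fact
  have gc: "g \<in> carrier G" using S.subset g by auto
  have n: "(g [^] n, z * int n) \<in> S" for n :: nat
  proof (induction n)
    case 0
    thus ?case using S.one_closed by (simp add: timesZ_simps)
  next
    case (Suc n)
    show ?case using S.m_closed[OF Suc g] by (simp add: timesZ_simps algebra_simps)
  qed
  show ?thesis
  proof (cases k rule: int_cases2)
    case (nonneg m)
    thus ?thesis using n[of m] by (simp only: int_pow_int)
  next
    case (nonpos m)
    have "inv\<^bsub>timesZ\<^esub> (g [^] m, z * int m) \<in> S"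
      using n by (rule S.m_inv_closed)
    hence "(inv (g [^] m), - (z * int m)) \<in> S"
      using gc by (simp only: timesZ_inv nat_pow_closed)
    thus ?thesis using nonpos gc by (simp only: int_pow_neg_int mult_minus_right)
  qed
qed

text \<open>Division with remainder by the least positive height: a nonzero remainder would be a smaller
positive height.\<close>
lemma subgroup_timesZ_eq_cyclic_extension:
  assumes S: "subgroup S timesZ" and ex: "\<exists>d>0. fibre S (int d) \<noteq> {}"
    and g: "g \<in> fibre S (int (min_height S))"
  shows "min_height S > 0" "subgroup (fibre S 0) G" "g \<in> carrier G"
        "fibre S (int (min_height S)) = fibre S 0 #> g"
        "cyclic_extension G (fibre S 0) g (min_height S) = S"
proof -
  interpret S: subgroup S timesZ by fact
  interpret K: group timesZ by (rule timesZ_group)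
  let ?d = "min_height S"
  show d: "?d > 0" 
    using LeastI_ex[OF ex] by (simp add: min_height_def)
  have least: "fibre S (int k) = {}" if "0 < k" "k < ?d" for k
    using not_less_Least[of k "\<lambda>d. d > 0 \<and> fibre S (int d) \<noteq> {}"] that
    by (auto simp: min_height_def)
  have Sc: "x \<in> carrier G" if "(x, z) \<in> S" for x z
    using S.subset that by auto
  show gc: "g \<in> carrier G" using g Sc by (auto simp: fibre_def)
  have Sm: "(x \<otimes> x', z + z') \<in> S" if "(x, z) \<in> S" "(x', z') \<in> S" for x x' z z'
    using S.m_closed[OF that] by (simp add: timesZ_simps)
  have Si: "(inv x, - z) \<in> S" if "(x, z) \<in> S" for x z
    using S.m_inv_closed[OF that] Sc[OF that] by (simp add: timesZ_inv)
  show H: "subgroup (fibre S 0) G"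
  proof (rule subgroupI)
    show "fibre S 0 \<subseteq> carrier G" using Sc by (auto simp: fibre_def)
    show "fibre S 0 \<noteq> {}" using S.one_closed by (auto simp: fibre_def timesZ_simps)
    show "inv a \<in> fibre S 0" if "a \<in> fibre S 0" for a
      using Si[of a 0] that by (simp add: fibre_def)
    show "a \<otimes> b \<in> fibre S 0" if "a \<in> fibre S 0" "b \<in> fibre S 0" for a b
      using Sm[of a 0 b 0] that by (simp add: fibre_def)
  qed
  have gp: "(g [^] k, int ?d * k) \<in> S" for k :: int
    by (rule subgroup_timesZ_pow[OF S]) (use g in \<open>auto simp: fibre_def\<close>)
  show eq: "cyclic_extension G (fibre S 0) g ?d = S"
  proof (intro equalityI subsetI)
    fix a assume "a \<in> cyclic_extension G (fibre S 0) g ?d"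
    then obtain x z where a: "a = (x, z)" "x \<in> carrier G" "int ?d dvd z"
      and *: "(x \<otimes> inv (g [^] (z div int ?d)), 0) \<in> S"
      by (auto simp: cyclic_extension_def fibre_def)
    have "(x \<otimes> inv (g [^] (z div int ?d)) \<otimes> g [^] (z div int ?d), 0 + int ?d * (z div int ?d)) \<in> S"
      using Sm[OF * gp] .
    thus "a \<in> S" using a gc by (simp add: m_assoc)
  next
    fix a assume aS: "a \<in> S"
    obtain x z where a: "a = (x, z)" by (cases a)
    let ?q = "z div int ?d"
    have xc: "x \<in> carrier G" using aS a Sc by auto
    have "(x \<otimes> inv (g [^] ?q), z + - (int ?d * ?q)) \<in> S"
      using Sm[OF _ Si[OF gp]] aS a by blast
    hence *: "(x \<otimes> inv (g [^] ?q), z mod int ?d) \<in> S"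
      by (simp add: minus_mult_div_eq_mod)
    have "z mod int ?d = 0"
    proof (rule ccontr)
      assume "z mod int ?d \<noteq> 0"
      moreover have "z mod int ?d \<ge> 0" "z mod int ?d < int ?d" using d by auto
      ultimately have "0 < nat (z mod int ?d)" "nat (z mod int ?d) < ?d" by linarith+
      from least[OF this] show False using * \<open>z mod int ?d \<ge> 0\<close> by (auto simp: fibre_def)
    qed
    thus "a \<in> cyclic_extension G (fibre S 0) g ?d"
      using * a xc by (auto simp: cyclic_extension_def fibre_def)
  qed
  show "fibre S (int ?d) = fibre S 0 #> g"
    using fibre_cyclic_extension(2)[OF H gc d] eq by simp
qed

text \<open>If \<open>S\<close> lay in \<open>G \<times> {0}\<close>, the translates by \<open>(\<one>, z)\<close> would be infinitely many cosets.\<close>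
lemma finite_index_imp_height:
  assumes S: "subgroup S timesZ" and fin: "finite (rcosets\<^bsub>timesZ\<^esub> S)"
  shows "\<exists>d>0. fibre S (int d) \<noteq> {}"
proof (rule ccontr)
  assume neg: "\<not> ?thesis"
  interpret K: group timesZ by (rule timesZ_group)
  interpret S: subgroup S timesZ by fact
  have "inj (\<lambda>z. S #>\<^bsub>timesZ\<^esub> (\<one>, z))"
  proof (rule injI, rule ccontr)
    fix z z' :: int
    assume "S #>\<^bsub>timesZ\<^esub> (\<one>, z) = S #>\<^bsub>timesZ\<^esub> (\<one>, z')" and ne: "z \<noteq> z'"
    hence 1: "(\<one>, z - z') \<in> S"
      using K.rcoset_eq_iff[OF S, of "(\<one>, z)" "(\<one>, z')"] by (simp add: timesZ_inv timesZ_simps)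
    hence 2: "(\<one>, z' - z) \<in> S"
      using S.m_inv_closed[OF 1] by (simp add: timesZ_inv)
    have "\<exists>k>0. (\<one>, int k) \<in> S"
      using 1 2 ne by (metis diff_gt_0_iff_gt linorder_neqE_linordered_idom pos_int_cases)
    then obtain k where "k > 0" "(\<one>, int k) \<in> S" by blast
    moreover from this have "fibre S (int k) \<noteq> {}" unfolding fibre_def by blast
    ultimately show False using neg by blast
  qed
  moreover have "range (\<lambda>z. S #>\<^bsub>timesZ\<^esub> (\<one>, z)) \<subseteq> rcosets\<^bsub>timesZ\<^esub> S"
    by (auto simp: RCOSETS_def)
  ultimately show False
    using fin finite_subset finite_imageD infinite_UNIV_int by metis
qed

text \<open>There are \<open>e\<close> cosets of a subgroup of index \<open>e\<close>, and the height \<open>d\<close> must satisfy \<open>d e = n\<close>; hence the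
weight \<open>e\<close> in the sum over the divisors of \<open>n\<close>.\<close>
theorem index_subgroups_timesZ:
  assumes n: "n > 0" and fin: "\<And>e. e > 0 \<Longrightarrow> finite (index_subgroups G e)"
  shows "finite (index_subgroups timesZ n)"
    and "card (index_subgroups timesZ n) = (\<Sum>e | e dvd n. e * card (index_subgroups G e))"
proof -
  interpret K: group timesZ by (rule timesZ_group)
  define B where "B = (SIGMA e:{e. e dvd n}. SIGMA H:index_subgroups G e. rcosets H)"
  \<comment> \<open>The representative chosen from C is immaterial: the fibre of the result over the height
    n div e is C again.\<close>
  define f where "f = (\<lambda>(e, H, C). cyclic_extension G H (SOME g. g \<in> C) (n div e))"
  define f' where "f' = (\<lambda>S :: ('a \<times> int) set. (n div min_height S, fibre S 0, fibre S (int (min_height S))))"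
  have B: "\<exists>g. g \<in> carrier G \<and> C = H #> g \<and> (SOME g. g \<in> C) = g \<and> subgroup H G \<and> n div e > 0 \<and>
              n div (n div e) = e \<and> (n div e) * card (rcosets H) = n"
    if "(e, H, C) \<in> B" for e H C
  proof -
    from that have H: "subgroup H G" "card (rcosets H) = e" "C \<in> rcosets H" "e dvd n"
      by (auto simp: B_def index_subgroups_def)
    then obtain g0 where g0: "g0 \<in> carrier G" "C = H #> g0" by (auto simp: RCOSETS_def)
    define g where "g = (SOME g. g \<in> C)"
    have gC: "g \<in> C"
      using g0 rcos_self[OF g0(1) H(1)] someI[of "\<lambda>g. g \<in> C"] by (auto simp: g_def)
    have "g \<in> carrier G"
      using gC g0 subgroup.elemrcos_carrier[OF H(1) is_group g0(1)] by blast
    moreover have "C = H #> g"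
      using repr_independence[of g H g0] gC g0 H by simp
    moreover have "(SOME g. g \<in> C) = g" by (simp add: g_def)
    moreover obtain k where k: "n = e * k" using H(4) by (rule dvdE)
    hence "e > 0" "k > 0" using n by auto
    ultimately show ?thesis
      using H(1,2) k by (intro exI[of _ g]) simp
  qed
  have I: "f' S \<in> B \<and> f (f' S) = S" if "S \<in> index_subgroups timesZ n" for S
  proof -
    from that have S: "subgroup S timesZ" and c: "card (rcosets\<^bsub>timesZ\<^esub> S) = n"
      by (auto simp: index_subgroups_def)
    have "finite (rcosets\<^bsub>timesZ\<^esub> S)" using c n card.infinite by fastforce
    from finite_index_imp_height[OF S this] have ex: "\<exists>d>0. fibre S (int d) \<noteq> {}" .
    define g where "g = (SOME g. g \<in> fibre S (int (min_height S)))"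
    have g: "g \<in> fibre S (int (min_height S))"
      using LeastI_ex[OF ex] some_in_eq[of "fibre S (int (min_height S))"] unfolding g_def min_height_def by blast
    note * = subgroup_timesZ_eq_cyclic_extension[OF S ex g]
    have idx: "min_height S * card (rcosets (fibre S 0)) = n"
      using card_rcosets_cyclic_extension[OF *(2,3,1)] *(5) c by simp
    have e: "n div min_height S = card (rcosets (fibre S 0))"
      unfolding idx[symmetric] using *(1) by simp
    have "card (rcosets (fibre S 0)) > 0"
      using idx n by (intro Nat.gr0I) simp
    hence e': "n div card (rcosets (fibre S 0)) = min_height S"
      unfolding idx[symmetric] by simp
    have "fibre S 0 \<in> index_subgroups G (card (rcosets (fibre S 0)))"
      using *(2) by (simp add: index_subgroups_def)
    moreover have "card (rcosets (fibre S 0)) dvd n"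
      unfolding idx[symmetric] by simp
    moreover have "fibre S (int (min_height S)) \<in> rcosets (fibre S 0)"
      unfolding *(4) using *(3) by (auto simp: RCOSETS_def)
    ultimately have "f' S \<in> B"
      unfolding f'_def B_def e by blast
    moreover have "f (f' S) = S"
      unfolding f_def f'_def using *(5) e e' by (simp add: g_def)
    ultimately show ?thesis by simp
  qed
  have bij: "bij_betw f B (index_subgroups timesZ n)"
  proof (rule bij_betw_byWitness[where f' = f'])
    show "\<forall>a\<in>B. f' (f a) = a"
    proof safe
      fix e H C assume a: "(e, H, C) \<in> B"
      from B[OF a] obtain g where g: "g \<in> carrier G" "C = H #> g" "(SOME g. g \<in> C) = g"
        "subgroup H G" "n div e > 0" "n div (n div e) = e" by blast
      show "f' (f (e, H, C)) = (e, H, C)"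
        using fibre_cyclic_extension[OF g(4,1,5)] g by (simp add: f_def f'_def)
    qed
    show "\<forall>a'\<in>index_subgroups timesZ n. f (f' a') = a'" using I by blast
    show "f ` B \<subseteq> index_subgroups timesZ n"
    proof safe
      fix e H C assume a: "(e, H, C) \<in> B"
      from B[OF a] obtain g where g: "g \<in> carrier G" "C = H #> g" "(SOME g. g \<in> C) = g"
        "subgroup H G" "n div e > 0" "n div (n div e) = e" "(n div e) * card (rcosets H) = n" by blast
      show "f (e, H, C) \<in> index_subgroups timesZ n"
        using subgroup_cyclic_extension[OF g(4,1,5)] card_rcosets_cyclic_extension[OF g(4,1,5)] g
        by (simp add: f_def index_subgroups_def)
    qed
    show "f' ` index_subgroups timesZ n \<subseteq> B" using I by blast
  qed
  have pos: "e > 0" if "e dvd n" for e using that n by (auto intro: Nat.gr0I)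
  have fin_rcosets: "finite (rcosets H)" if "H \<in> index_subgroups G e" "e dvd n" for H e
    using that(1) pos[OF that(2)] by (intro card_ge_0_finite) (simp add: index_subgroups_def)
  have finB: "finite (SIGMA H:index_subgroups G e. rcosets H)" if "e dvd n" for e
    using fin[OF pos[OF that]] fin_rcosets that by (intro finite_SigmaI)
  have "finite B"
    unfolding B_def by (rule finite_SigmaI) (use n finB in auto)
  thus "finite (index_subgroups timesZ n)"
    using bij bij_betw_finite by blast
  have "card (index_subgroups timesZ n) = card B"
    using bij_betw_same_card[OF bij] by simp
  also have "\<dots> = (\<Sum>e | e dvd n. card (SIGMA H:index_subgroups G e. rcosets H))"
    unfolding B_def using n finB by (subst card_SigmaI) auto
  also have "\<dots> = (\<Sum>e | e dvd n. e * card (index_subgroups G e))"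
  proof (rule sum.cong[OF refl])
    fix e assume "e \<in> {e. e dvd n}"
    hence e: "e dvd n" by simp
    have "card (SIGMA H:index_subgroups G e. rcosets H) = (\<Sum>H\<in>index_subgroups G e. card (rcosets H))"
      using fin[OF pos[OF e]] fin_rcosets e by (intro card_SigmaI ballI)
    also have "\<dots> = (\<Sum>H\<in>index_subgroups G e. e)"
      by (rule sum.cong) (auto simp: index_subgroups_def)
    finally show "card (SIGMA H:index_subgroups G e. rcosets H) = e * card (index_subgroups G e)"
      by simp
  qed
  finally show "card (index_subgroups timesZ n) = (\<Sum>e | e dvd n. e * card (index_subgroups G e))" .
qed

end

lemma Z_power_comm_group: "comm_group (Z_power r)"
proof (rule group.group_comm_groupI)
  show "group (Z_power r)" by (simp add: Z_power_def)
qed (auto simp: Z_power_def integer_group_def add.commute)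

lemma Z_power_Suc_iso:
  "(\<lambda>f. (restrict f {..<r}, f r)) \<in> iso (Z_power (Suc r)) (Z_power r \<times>\<times> integer_group)"
proof -
  have "bij_betw (\<lambda>f. (restrict f {..<r}, f r)) (\<Pi>\<^sub>E i\<in>{..<Suc r}. UNIV :: int set) ((\<Pi>\<^sub>E i\<in>{..<r}. UNIV) \<times> UNIV)"
    by (rule bij_betw_byWitness[where f' = "\<lambda>(f, z). f(r := z)"])
       (auto simp: PiE_def extensional_def fun_eq_iff restrict_def)
  thus ?thesis
    by (auto simp: iso_def hom_def Z_power_def integer_group_def DirProd_def restrict_def fun_eq_iff)
qed

theorem index_subgroups_Z_power:
  assumes "n > 0"
  shows "finite (index_subgroups (Z_power r) n) \<and> card (index_subgroups (Z_power r) n) = subgroup_number r n"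
  using assms
proof (induction r arbitrary: n)
  case 0
  interpret comm_group "Z_power 0" by (rule Z_power_comm_group)
  have c: "carrier (Z_power 0) = {\<one>\<^bsub>Z_power 0\<^esub>}"
    by (auto simp: Z_power_def)
  have "subgroup H (Z_power 0) \<longleftrightarrow> H = {\<one>\<^bsub>Z_power 0\<^esub>}" for H
    using c subgroup.subset[of H "Z_power 0"] subgroup.one_closed[of H "Z_power 0"] triv_subgroup by auto
  moreover have "card (rcosets\<^bsub>Z_power 0\<^esub> {\<one>\<^bsub>Z_power 0\<^esub>}) = 1"
    using c by (auto simp: RCOSETS_def)
  ultimately have "index_subgroups (Z_power 0) n = (if n = 1 then {{\<one>\<^bsub>Z_power 0\<^esub>}} else {})"
    by (auto simp: index_subgroups_def)
  thus ?case by simp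
next
  case (Suc r)
  interpret comm_group "Z_power r" by (rule Z_power_comm_group)
  interpret S: comm_group "Z_power (Suc r)" by (rule Z_power_comm_group)
  have bij: "bij_betw ((`) (\<lambda>f. (restrict f {..<r}, f r))) (index_subgroups (Z_power (Suc r)) n)
          (index_subgroups timesZ n)"
    by (rule index_subgroups_iso[OF S.is_group timesZ_group Z_power_Suc_iso])
  have fin: "finite (index_subgroups (Z_power r) e)" if "e > 0" for e using Suc.IH that by blast
  have "(\<Sum>e | e dvd n. e * card (index_subgroups (Z_power r) e)) = (\<Sum>e | e dvd n. e * subgroup_number r e)"
  proof (rule sum.cong)
    fix e assume "e \<in> {e. e dvd n}"
    hence "e > 0" using Suc.prems by (auto intro!: Nat.gr0I)
    thus "e * card (index_subgroups (Z_power r) e) = e * subgroup_number r e"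
      using Suc.IH by metis
  qed simp
  hence "card (index_subgroups timesZ n) = subgroup_number (Suc r) n"
    using index_subgroups_timesZ(2)[OF Suc.prems fin] by simp
  moreover have "finite (index_subgroups timesZ n)"
    by (rule index_subgroups_timesZ(1)[OF Suc.prems fin])
  ultimately show ?case
    unfolding bij_betw_same_card[OF bij] bij_betw_finite[OF bij] by (rule conjI[rotated])
qed

corollary index_subgroup_count_Z_power:
  assumes "n > 0"
  shows "index_subgroup_count (Z_power r) n = subgroup_number r n"
  using index_subgroups_Z_power[OF assms, THEN conjunct2]
  unfolding index_subgroup_count_def index_subgroups_def .

section \<open>Periodic points and closed orbits\<close>

definition orbit_of :: "('a \<Rightarrow> 'a) \<Rightarrow> 'a \<Rightarrow> 'a set" where
  "orbit_of T x = range (\<lambda>k. (T ^^ k) x)"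

definition periodic_points :: "'a set \<Rightarrow> ('a \<Rightarrow> 'a) \<Rightarrow> nat \<Rightarrow> 'a set" where
  "periodic_points X T n = {x \<in> X. (T ^^ n) x = x}"

lemma self_in_orbit: "x \<in> orbit_of T x"
  unfolding orbit_of_def by (rule image_eqI[of _ _ 0]) auto

lemma orbit_of_eq_lessThan:
  assumes "n > 0" "(T ^^ n) x = x"
  shows "orbit_of T x = (\<lambda>k. (T ^^ k) x) ` {..<n}"
proof -
  have "(T ^^ k) x = (T ^^ (k mod n)) x" for k
    using funpow_mod_eq[OF assms(2), of k] by simp
  moreover have "k mod n \<in> {..<n}" for k using assms by simp
  ultimately show ?thesis unfolding orbit_of_def by blast
qed

lemma orbit_of_eq_atMost:
  assumes "n > 0" "(T ^^ n) x = x"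
  shows "orbit_of T x = {(T ^^ k) x |k. k \<le> n}"
  using orbit_of_eq_lessThan[OF assms] by (force simp: orbit_of_def)

lemma periodic_on_orbit:
  assumes "(T ^^ n) x = x" "y \<in> orbit_of T x"
  shows "(T ^^ n) y = y"
proof -
  obtain k where "y = (T ^^ k) x" using assms(2) by (auto simp: orbit_of_def)
  thus ?thesis using assms(1) by (metis add.commute comp_apply funpow_add)
qed

lemma orbit_of_eq_if_mem:
  assumes "n > 0" "(T ^^ n) x = x" "y \<in> orbit_of T x"
  shows "orbit_of T y = orbit_of T x"
proof
  obtain k where k: "k < n" "y = (T ^^ k) x"
    using assms(3) orbit_of_eq_lessThan[OF assms(1,2)] by auto
  show "orbit_of T y \<subseteq> orbit_of T x"
  proof
    fix z assume "z \<in> orbit_of T y"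
    then obtain l where "z = (T ^^ l) y" by (auto simp: orbit_of_def)
    hence "z = (T ^^ (l + k)) x" using k by (simp add: funpow_add)
    thus "z \<in> orbit_of T x" by (auto simp: orbit_of_def)
  qed
  have x: "(T ^^ (n - k)) y = x"
    using k assms(2) by (metis comp_apply funpow_add le_add_diff_inverse2 less_imp_le_nat)
  show "orbit_of T x \<subseteq> orbit_of T y"
  proof
    fix z assume "z \<in> orbit_of T x"
    then obtain l where "z = (T ^^ l) x" by (auto simp: orbit_of_def)
    hence "z = (T ^^ (l + (n - k))) y" using x by (simp add: funpow_add)
    thus "z \<in> orbit_of T y" by (auto simp: orbit_of_def)
  qed
qed

lemma card_orbit_is_least_period:
  assumes "n > 0" "(T ^^ n) x = x"
  shows "card (orbit_of T x) dvd n" "(T ^^ card (orbit_of T x)) x = x" "card (orbit_of T x) > 0"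
proof -
  define p where "p = (LEAST p. p > 0 \<and> (T ^^ p) x = x)"
  have p: "p > 0" "(T ^^ p) x = x"
    using LeastI[of "\<lambda>p. p > 0 \<and> (T ^^ p) x = x" n] assms by (auto simp: p_def)
  have least: "p \<le> q" if "q > 0" "(T ^^ q) x = x" for q
    unfolding p_def by (rule Least_le) (use that in auto)
  have no: False if "i < j" "j < p" "(T ^^ i) x = (T ^^ j) x" for i j
  proof -
    have "(T ^^ (p - j + i)) x = (T ^^ (p - j)) ((T ^^ j) x)"
      by (simp only: funpow_add comp_apply that)
    also have "\<dots> = (T ^^ (p - j + j)) x" by (simp only: funpow_add comp_apply)
    also have "\<dots> = x" using that p by simp
    finally show False using least[of "p - j + i"] that by simp
  qed
  have "inj_on (\<lambda>k. (T ^^ k) x) {..<p}"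
  proof (rule inj_onI)
    fix i j assume "i \<in> {..<p}" "j \<in> {..<p}" "(T ^^ i) x = (T ^^ j) x"
    thus "i = j" using no[of i j] no[of j i] by (cases i j rule: linorder_cases) auto
  qed
  hence c: "card (orbit_of T x) = p"
    using orbit_of_eq_lessThan[OF p] by (simp add: card_image)
  show "(T ^^ card (orbit_of T x)) x = x" "card (orbit_of T x) > 0"
    using p c by auto
  have "(T ^^ (n mod p)) x = x"
    using funpow_mod_eq[OF p(2), of n] assms by simp
  hence "n mod p = 0" using least[of "n mod p"] p by (metis gr0I mod_less_divisor not_le)
  thus "card (orbit_of T x) dvd n" using c by auto
qed

lemma closed_orbits_eq_orbits:
  assumes "n > 0"
  shows "closed_orbits X T n = {orbit_of T x |x. x \<in> X \<and> (T ^^ n) x = x \<and> card (orbit_of T x) = n}"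
proof -
  have "(\<exists>x\<in>X. P = {(T ^^ k) x |k. k \<le> n} \<and> (T ^^ n) x = x \<and> card P = n) \<longleftrightarrow>
        (\<exists>x. P = orbit_of T x \<and> x \<in> X \<and> (T ^^ n) x = x \<and> card (orbit_of T x) = n)" for P
    using orbit_of_eq_atMost[OF assms, of T] by (metis (no_types, lifting))
  thus ?thesis unfolding closed_orbits_def by blast
qed

lemma orbit_subset:
  assumes "T \<in> X \<rightarrow> X" "x \<in> X" shows "orbit_of T x \<subseteq> X"
proof -
  have "(T ^^ k) x \<in> X" for k using assms by (induction k) auto
  thus ?thesis by (auto simp: orbit_of_def)
qed

text \<open>The length of the orbit of a point fixed by \<open>T\<^sup>n\<close> is its least period and hence divides \<open>n\<close>.\<close>
lemma periodic_points_eq_Union: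
  assumes T: "T \<in> X \<rightarrow> X" and n: "n > 0"
  shows "periodic_points X T n = \<Union> (\<Union>d\<in>{d. d dvd n}. closed_orbits X T d)"
proof (intro equalityI subsetI)
  fix x assume x: "x \<in> periodic_points X T n"
  hence x': "x \<in> X" "(T ^^ n) x = x" by (auto simp: periodic_points_def)
  note c = card_orbit_is_least_period[OF n x'(2)]
  have "orbit_of T x \<in> closed_orbits X T (card (orbit_of T x))"
    unfolding closed_orbits_eq_orbits[OF c(3)] using c x' by blast
  thus "x \<in> \<Union> (\<Union>d\<in>{d. d dvd n}. closed_orbits X T d)"
    using c(1) self_in_orbit[of x T] by blast
next
  fix y assume "y \<in> \<Union> (\<Union>d\<in>{d. d dvd n}. closed_orbits X T d)"
  then obtain d P where d: "d dvd n" "P \<in> closed_orbits X T d" "y \<in> P" by blast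
  have d0: "d > 0" using d(1) n by (auto intro: Nat.gr0I)
  obtain x where x: "P = orbit_of T x" "x \<in> X" "(T ^^ d) x = x"
    using d(2) unfolding closed_orbits_eq_orbits[OF d0] by blast
  have "(T ^^ d) y = y" using periodic_on_orbit[OF x(3)] d x by simp
  hence "(T ^^ n) y = y"
    using funpow_mod_eq[of d T y n] d(1) by (simp add: dvd_eq_mod_eq_0)
  thus "y \<in> periodic_points X T n"
    using orbit_subset[OF T x(2)] d x by (auto simp: periodic_points_def)
qed

lemma closed_orbits_cases:
  assumes "P \<in> closed_orbits X T d" "d > 0"
  obtains x where "P = orbit_of T x" "x \<in> X" "(T ^^ d) x = x" "card P = d"
proof -
  obtain x where "P = orbit_of T x" "x \<in> X" "(T ^^ d) x = x" "card (orbit_of T x) = d"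
    using assms(1) unfolding closed_orbits_eq_orbits[OF assms(2)] by blast
  thus ?thesis using that by simp
qed

lemma card_closed_orbit: "P \<in> closed_orbits X T d \<Longrightarrow> card P = d"
  unfolding closed_orbits_def by blast

lemma closed_orbits_disjoint:
  assumes "P \<in> closed_orbits X T d" "d > 0" "Q \<in> closed_orbits X T e" "e > 0" "P \<noteq> Q"
  shows "P \<inter> Q = {}"
proof (rule ccontr)
  assume "P \<inter> Q \<noteq> {}"
  then obtain y where y: "y \<in> P" "y \<in> Q" by blast
  obtain x where x: "P = orbit_of T x" "(T ^^ d) x = x"
    using assms(1,2) by (rule closed_orbits_cases)
  obtain x' where x': "Q = orbit_of T x'" "(T ^^ e) x' = x'"
    using assms(3,4) by (rule closed_orbits_cases)
  have "P = orbit_of T y" "Q = orbit_of T y"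
    using orbit_of_eq_if_mem[OF assms(2) x(2), of y] orbit_of_eq_if_mem[OF assms(4) x'(2), of y] y x x' by auto
  thus False using assms by simp
qed

text \<open>Each closed orbit of length \<open>d\<close> dividing \<open>n\<close> contributes its \<open>d\<close> points. This turns orbit counts,
which behave badly under products of maps, into fixed point counts, which multiply.\<close>
lemma card_periodic_points:
  assumes T: "T \<in> X \<rightarrow> X" and n: "n > 0"
    and fin: "\<And>d. d > 0 \<Longrightarrow> finite (closed_orbits X T d)"
  shows "finite (periodic_points X T n)"
    and "card (periodic_points X T n) = (\<Sum>d | d dvd n. d * orbit_count X T d)"
proof -
  have pos: "d > 0" if "d dvd n" for d using that n by (auto intro: Nat.gr0I)
  define C where "C = (\<Union>d\<in>{d. d dvd n}. closed_orbits X T d)"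
  have C: "\<exists>d. d dvd n \<and> d > 0 \<and> P \<in> closed_orbits X T d \<and> card P = d" if "P \<in> C" for P
    using that pos card_closed_orbit unfolding C_def by blast
  have finC: "finite C" unfolding C_def using fin pos n by auto
  have finP: "finite P" if "P \<in> C" for P
    using C[OF that] card_ge_0_finite[of P] by metis
  show "finite (periodic_points X T n)"
    unfolding periodic_points_eq_Union[OF T n] using finC finP by (simp flip: C_def)
  have "card (periodic_points X T n) = card (\<Union> C)"
    unfolding periodic_points_eq_Union[OF T n] by (simp flip: C_def)
  also have "\<dots> = (\<Sum>P\<in>C. card P)"
  proof (rule card_Union_disjoint)
    show "pairwise disjnt C"
    proof (rule pairwiseI)
      fix P Q assume PQ: "P \<in> C" "Q \<in> C" "P \<noteq> Q"
      from C[OF PQ(1)] C[OF PQ(2)] obtain d e where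
        "d > 0" "P \<in> closed_orbits X T d" "e > 0" "Q \<in> closed_orbits X T e" by blast
      thus "disjnt P Q" using closed_orbits_disjoint PQ(3) unfolding disjnt_def by metis
    qed
  qed (use finP in auto)
  also have "\<dots> = (\<Sum>d | d dvd n. \<Sum>P\<in>closed_orbits X T d. card P)"
    unfolding C_def
  proof (rule sum.UNION_disjoint)
    show "\<forall>i\<in>{d. d dvd n}. \<forall>j\<in>{d. d dvd n}. i \<noteq> j \<longrightarrow> closed_orbits X T i \<inter> closed_orbits X T j = {}"
      using card_closed_orbit by blast
  qed (use n fin pos in auto)
  also have "\<dots> = (\<Sum>d | d dvd n. d * orbit_count X T d)"
    using card_closed_orbit[of _ X T] by (intro sum.cong) (auto simp: orbit_count_def mult.commute)
  finally show "card (periodic_points X T n) = (\<Sum>d | d dvd n. d * orbit_count X T d)" .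
qed

lemma finite_closed_orbits_if_finite_periodic:
  assumes T: "T \<in> X \<rightarrow> X" and n: "n > 0" and "finite (periodic_points X T n)"
  shows "finite (closed_orbits X T n)"
proof -
  have "closed_orbits X T n \<subseteq> Pow (periodic_points X T n)"
    unfolding periodic_points_eq_Union[OF T n] by (intro subsetI PowI UnionI UN_I[of n]) auto
  thus ?thesis by (rule finite_subset) (simp add: assms(3))
qed

lemma partition_map_maps:
  assumes "\<And>r. r \<in> set lam \<Longrightarrow> T r \<in> X r \<rightarrow> X r"
  shows "partition_map T lam \<in> partition_space X lam \<rightarrow> partition_space X lam"
  using assms by (fastforce simp: partition_space_def partition_map_def PiE_def Pi_def)

lemma partition_map_funpow:
  assumes "x \<in> partition_space X lam" and "\<And>r. r \<in> set lam \<Longrightarrow> T r \<in> X r \<rightarrow> X r"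
  shows "(partition_map T lam ^^ n) x = (\<lambda>i\<in>{..<length lam}. (T (lam ! i) ^^ n) (x i))"
proof (induction n)
  case 0
  thus ?case using assms(1) by (auto simp: partition_space_def PiE_def extensional_restrict)
next
  case (Suc n)
  thus ?case by (auto simp: partition_map_def fun_eq_iff)
qed

lemma periodic_points_partition:
  assumes "\<And>r. r \<in> set lam \<Longrightarrow> T r \<in> X r \<rightarrow> X r"
  shows "periodic_points (partition_space X lam) (partition_map T lam) n =
           (\<Pi>\<^sub>E i\<in>{..<length lam}. periodic_points (X (lam ! i)) (T (lam ! i)) n)"
proof -
  have "(x \<in> partition_space X lam \<and> (\<lambda>i\<in>{..<length lam}. (T (lam ! i) ^^ n) (x i)) = x) \<longleftrightarrow>
        x \<in> (\<Pi>\<^sub>E i\<in>{..<length lam}. periodic_points (X (lam ! i)) (T (lam ! i)) n)" for x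
    unfolding partition_space_def periodic_points_def PiE_def extensional_def Pi_def
    by (auto simp: fun_eq_iff restrict_def split: if_splits)
  note * = this
  show ?thesis
  proof (rule Set.set_eqI)
    fix x
    have "x \<in> periodic_points (partition_space X lam) (partition_map T lam) n \<longleftrightarrow>
          x \<in> partition_space X lam \<and> (partition_map T lam ^^ n) x = x"
      unfolding periodic_points_def by blast
    also have "\<dots> \<longleftrightarrow> x \<in> partition_space X lam \<and> (\<lambda>i\<in>{..<length lam}. (T (lam ! i) ^^ n) (x i)) = x"
    proof (rule conj_cong[OF refl])
      assume "x \<in> partition_space X lam"
      hence "(partition_map T lam ^^ n) x = (\<lambda>i\<in>{..<length lam}. (T (lam ! i) ^^ n) (x i))"
        using assms by (rule partition_map_funpow)
      thus "(partition_map T lam ^^ n) x = x \<longleftrightarrow> (\<lambda>i\<in>{..<length lam}. (T (lam ! i) ^^ n) (x i)) = x"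
        by simp
    qed
    finally show "x \<in> periodic_points (partition_space X lam) (partition_map T lam) n \<longleftrightarrow>
        x \<in> (\<Pi>\<^sub>E i\<in>{..<length lam}. periodic_points (X (lam ! i)) (T (lam ! i)) n)"
      unfolding * .
  qed
qed

text \<open>A tuple is fixed by the \<open>n\<close>-th iterate of a product exactly if each of its coordinates is. The
finiteness of the orbit sets of the product comes out of the same description.\<close>
theorem orbit_count_partition_convolution:
  assumes T: "\<And>r. r \<in> set lam \<Longrightarrow> T r \<in> X r \<rightarrow> X r"
    and fin: "\<And>r n. r \<in> set lam \<Longrightarrow> n > 0 \<Longrightarrow> finite (closed_orbits (X r) (T r) n)"
    and n: "n > 0"
  shows "(\<Sum>d | d dvd n. d * orbit_count (partition_space X lam) (partition_map T lam) d) =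
         (\<Prod>r\<leftarrow>lam. \<Sum>d | d dvd n. d * orbit_count (X r) (T r) d)"
proof -
  have maps: "partition_map T lam \<in> partition_space X lam \<rightarrow> partition_space X lam"
    using T by (rule partition_map_maps)
  have per: "periodic_points (partition_space X lam) (partition_map T lam) d =
           (\<Pi>\<^sub>E i\<in>{..<length lam}. periodic_points (X (lam ! i)) (T (lam ! i)) d)" for d
    using T by (rule periodic_points_partition)
  have comp: "finite (periodic_points (X (lam ! i)) (T (lam ! i)) d)"
      "card (periodic_points (X (lam ! i)) (T (lam ! i)) d) = (\<Sum>e | e dvd d. e * orbit_count (X (lam ! i)) (T (lam ! i)) e)"
    if "i < length lam" "d > 0" for i d
    using card_periodic_points[of "T (lam ! i)" "X (lam ! i)" d] T[of "lam ! i"] fin[of "lam ! i"] that by auto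
  have P: "finite (periodic_points (partition_space X lam) (partition_map T lam) d)" if "d > 0" for d
    unfolding per
    by (rule finite_PiE) (use comp(1) that in auto)
  have "(\<Sum>d | d dvd n. d * orbit_count (partition_space X lam) (partition_map T lam) d) =
        card (periodic_points (partition_space X lam) (partition_map T lam) n)"
    using card_periodic_points(2)[OF maps n finite_closed_orbits_if_finite_periodic[OF maps _ P]] by simp
  also have "\<dots> = (\<Prod>i<length lam. card (periodic_points (X (lam ! i)) (T (lam ! i)) n))"
    unfolding per by (simp add: card_PiE)
  also have "\<dots> = (\<Prod>i<length lam. \<Sum>d | d dvd n. d * orbit_count (X (lam ! i)) (T (lam ! i)) d)"
    using comp(2) n by (intro prod.cong) auto
  also have "\<dots> = (\<Prod>r\<leftarrow>lam. \<Sum>d | d dvd n. d * orbit_count (X r) (T r) d)"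
    by (simp add: prod.list_conv_set_nth atLeast0LessThan)
  finally show ?thesis .
qed

section \<open>Dirichlet convolution\<close>

definition dirichlet_prod :: "(nat \<Rightarrow> 'a::comm_semiring_1) \<Rightarrow> (nat \<Rightarrow> 'a) \<Rightarrow> nat \<Rightarrow> 'a" where
  "dirichlet_prod f g n = (\<Sum>d | d dvd n. f d * g (n div d))"

lemma dirichlet_prod_cong:
  assumes "n > 0" "\<And>d. d > 0 \<Longrightarrow> f d = f' d" "\<And>d. d > 0 \<Longrightarrow> g d = g' d"
  shows "dirichlet_prod f g n = dirichlet_prod f' g' n"
  unfolding dirichlet_prod_def
proof (rule sum.cong[OF refl])
  fix d assume "d \<in> {d. d dvd n}"
  then obtain k where "n = d * k" by auto
  thus "f d * g (n div d) = f' d * g' (n div d)" using assms by auto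
qed

lemma dirichlet_prod_commute:
  assumes "n > 0" shows "dirichlet_prod f g n = dirichlet_prod g f n"
  unfolding dirichlet_prod_def
  by (rule sum.reindex_bij_witness[of _ "\<lambda>d. n div d" "\<lambda>d. n div d"])
     (use assms in \<open>auto simp: mult.commute elim!: dvdE\<close>)

lemma dirichlet_prod_assoc:
  assumes "n > 0" shows "dirichlet_prod (dirichlet_prod f g) h n = dirichlet_prod f (dirichlet_prod g h) n"
proof -
  have "dirichlet_prod (dirichlet_prod f g) h n = (\<Sum>d | d dvd n. \<Sum>e | e dvd d. f e * g (d div e) * h (n div d))"
    unfolding dirichlet_prod_def by (simp add: sum_distrib_right)
  also have "\<dots> = (\<Sum>(d, e)\<in>(SIGMA d:{d. d dvd n}. {e. e dvd d}). f e * g (d div e) * h (n div d))"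
    using assms by (subst sum.Sigma) (auto intro!: finite_divisors_nat dest: dvd_pos_nat)
  also have "\<dots> = (\<Sum>(e, k)\<in>(SIGMA e:{e. e dvd n}. {k. k dvd n div e}). f e * (g k * h (n div e div k)))"
    by (rule sum.reindex_bij_witness[of _ "\<lambda>(e, k). (e * k, e)" "\<lambda>(d, e). (e, d div e)"])
       (use assms in \<open>auto simp: mult_ac elim!: dvdE\<close>)
  also have "\<dots> = (\<Sum>e | e dvd n. \<Sum>k | k dvd n div e. f e * (g k * h (n div e div k)))"
    using assms by (subst sum.Sigma) (auto intro!: finite_divisors_nat elim!: dvdE)
  also have "\<dots> = dirichlet_prod f (dirichlet_prod g h) n"
    unfolding dirichlet_prod_def by (simp add: sum_distrib_left)
  finally show ?thesis .
qed

lemma dirichlet_prod_twist: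
  assumes "n > 0" and "\<And>a b. a > 0 \<Longrightarrow> b > 0 \<Longrightarrow> t (a * b) = t a * t b"
  shows "dirichlet_prod (\<lambda>n. t n * f n) (\<lambda>n. t n * g n) n = t n * dirichlet_prod f g n"
  unfolding dirichlet_prod_def sum_distrib_left
proof (rule sum.cong[OF refl])
  fix d assume "d \<in> {d. d dvd n}"
  then obtain k where "n = d * k" by auto
  thus "t d * f d * (t (n div d) * g (n div d)) = t n * (f d * g (n div d))"
    using assms by (auto simp: mult_ac)
qed

lemma dirichlet_prod_1 [simp]: "dirichlet_prod f g (Suc 0) = f (Suc 0) * g (Suc 0)"
proof -
  have "{d. d dvd Suc 0} = {Suc 0}" by auto
  thus ?thesis by (simp add: dirichlet_prod_def)
qed

lemma norm_product_summable_on: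
  fixes f :: "'i \<Rightarrow> 'a::{real_normed_field,banach}" and g :: "'j \<Rightarrow> 'a"
  assumes "(\<lambda>n. norm (f n)) summable_on A" "(\<lambda>n. norm (g n)) summable_on B"
  shows "(\<lambda>(d, e). norm (f d * g e)) summable_on A \<times> B"
proof -
  have "(\<lambda>x. norm (case x of (d, e) \<Rightarrow> f d * g e)) summable_on A \<times> B"
  proof (rule Infinite_Sum.abs_summable_on_Sigma_iff[THEN iffD2], intro conjI ballI)
    fix x
    show "(\<lambda>y. norm (case (x, y) of (d, e) \<Rightarrow> f d * g e)) summable_on B"
      using summable_on_cmult_right[OF assms(2), of "norm (f x)"] by (simp add: norm_mult)
  next
    have "(\<lambda>x. infsum (\<lambda>y. norm (case (x, y) of (d, e) \<Rightarrow> f d * g e)) B) =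
          (\<lambda>x. norm (f x) * infsum (\<lambda>y. norm (g y)) B)"
      by (simp add: norm_mult infsum_cmult_right')
    thus "(\<lambda>x. norm (infsum (\<lambda>y. norm (case (x, y) of (d, e) \<Rightarrow> f d * g e)) B)) summable_on A"
      using summable_on_cmult_left[OF assms(1), of "infsum (\<lambda>y. norm (g y)) B"]
      by (simp add: infsum_nonneg)
  qed
  thus ?thesis by (simp add: case_prod_unfold)
qed

text \<open>Rearranging the absolutely convergent double sum over pairs \<open>(d, e)\<close> by the product \<open>n = d e\<close>.\<close>
lemma dirichlet_prod_summable:
  fixes f g :: "nat \<Rightarrow> 'a::{real_normed_field,banach}"
  assumes f: "(\<lambda>n. norm (f n)) summable_on {0<..}" and g: "(\<lambda>n. norm (g n)) summable_on {0<..}"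
  shows "(\<lambda>n. norm (dirichlet_prod f g n)) summable_on {0<..}"
    and "infsum (dirichlet_prod f g) {0<..} = infsum f {0<..} * infsum g {0<..}"
proof -
  let ?S = "SIGMA n:{0<..}. {d::nat. d dvd n}"
  define k where "k = (\<lambda>(n, d). f d * g (n div d))"
  have sm: "(\<lambda>(d, e). norm (f d * g e)) summable_on {0<..} \<times> {0<..}"
    using norm_product_summable_on[OF f g] .
  have sm': "(\<lambda>(d, e). f d * g e) summable_on {0<..} \<times> {0<..}"
    by (rule abs_summable_summable) (use sm in \<open>simp add: case_prod_unfold\<close>)
  have "(\<lambda>x. norm (k x)) summable_on ?S \<longleftrightarrow> (\<lambda>(d, e). norm (f d * g e)) summable_on {0<..} \<times> {0<..}"
    by (rule summable_on_reindex_bij_witness[of _ "\<lambda>(d, e). (d * e, d)" "\<lambda>(n, d). (d, n div d)"])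
       (auto simp: k_def elim!: dvdE)
  hence ks: "(\<lambda>x. norm (k x)) summable_on ?S" using sm by simp
  have kI: "infsum k ?S = infsum (\<lambda>(d, e). f d * g e) ({0<..} \<times> {0<..})"
    by (rule infsum_reindex_bij_witness[of _ "\<lambda>(d, e). (d * e, d)" "\<lambda>(n, d). (d, n div d)"])
       (auto simp: k_def elim!: dvdE)
  have kn: "infsum (\<lambda>d. k (n, d)) {d. d dvd n} = dirichlet_prod f g n" if "n \<in> {0<..}" for n
    using that by (simp add: k_def dirichlet_prod_def)
  have "(\<lambda>n. infsum (\<lambda>d. norm (k (n, d))) {d. d dvd n}) summable_on {0<..}"
    using Infinite_Sum.abs_summable_on_Sigma_iff[of k "{0<..}" "\<lambda>n. {d. d dvd n}"] ks by (simp add: infsum_nonneg)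
  thus "(\<lambda>n. norm (dirichlet_prod f g n)) summable_on {0<..}"
  proof (rule summable_on_comparison_test)
    fix n :: nat assume n: "n \<in> {0<..}"
    have "norm (dirichlet_prod f g n) \<le> (\<Sum>d | d dvd n. norm (k (n, d)))"
      unfolding dirichlet_prod_def k_def by (auto intro: sum_norm_le)
    thus "norm (dirichlet_prod f g n) \<le> infsum (\<lambda>d. norm (k (n, d))) {d. d dvd n}"
      using n by simp
  qed auto
  have "infsum (dirichlet_prod f g) {0<..} = infsum (\<lambda>n. infsum (\<lambda>d. k (n, d)) {d. d dvd n}) {0<..}"
    using kn by (intro infsum_cong) auto
  also have "\<dots> = infsum k ?S"
    by (rule infsum_Sigma_banach) (use abs_summable_summable[OF ks] in simp)
  also have "\<dots> = infsum (\<lambda>d. infsum (\<lambda>e. f d * g e) {0<..}) {0<..}"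
    unfolding kI by (rule infsum_Sigma'_banach[symmetric]) (rule sm')
  also have "\<dots> = infsum f {0<..} * infsum g {0<..}"
    by (simp add: infsum_cmult_right' infsum_cmult_left')
  finally show "infsum (dirichlet_prod f g) {0<..} = infsum f {0<..} * infsum g {0<..}" .
qed

section \<open>Fixed point counts as divisor sums\<close>

text \<open>The arithmetic functions \<open>F\<close> of interest are \<open>n\<^sup>N\<close> times a divisor sum \<open>\<Sum>e | n. H e\<close> with a small
nonnegative \<open>H\<close>, so \<open>\<Sum> F(n) n\<^sup>-\<^sup>u\<close> is \<open>\<zeta>(u - N)\<close> times a series that converges absolutely for
\<open>Re u > N\<close>. This predicate describes the admissible \<open>H\<close>.\<close>
definition summable_weight :: "(nat \<Rightarrow> real) \<Rightarrow> bool" where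
  "summable_weight H \<longleftrightarrow> (\<forall>n. H n \<ge> 0) \<and> H 1 = 1 \<and>
     (\<forall>\<sigma>>0. (\<lambda>n. H n * real n powr -\<sigma>) summable_on {0<..})"

lemma powr_summable_on:
  assumes "\<sigma> > 1" shows "(\<lambda>n::nat. real n powr -\<sigma>) summable_on {0<..}"
proof -
  have "summable (\<lambda>n. real n powr -\<sigma>)" using assms by (simp add: summable_real_powr_iff)
  hence "(\<lambda>n. real n powr -\<sigma>) summable_on UNIV"
    by (intro summable_nonneg_imp_summable_on) auto
  thus ?thesis by (rule summable_on_subset_banach) auto
qed

text \<open>The convolution of \<open>n\<^sup>-\<^sup>1, \<dots>, n\<^sup>-\<^sup>r\<close>: the number of subgroups of index \<open>n\<close> in \<open>\<int>\<^sup>r\<^sup>+\<^sup>1\<close> is the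
convolution of \<open>1, n, \<dots>, n\<^sup>r\<close>, and dividing by \<open>n\<^sup>r\<close> leaves the constant function \<open>1\<close>, convolved
with this weight.\<close>
fun subgroup_weight :: "nat \<Rightarrow> nat \<Rightarrow> real" where
  "subgroup_weight 0 n = (if n = 1 then 1 else 0)"
| "subgroup_weight (Suc r) n = dirichlet_prod (subgroup_weight r) (\<lambda>n. 1 / real n ^ Suc r) n"

lemma subgroup_number_subgroup_weight:
  assumes "n > 0"
  shows "real (subgroup_number (Suc r) n) = real n ^ r * (\<Sum>e | e dvd n. subgroup_weight r e)"
  using assms
proof (induction r arbitrary: n)
  case 0
  have "(\<Sum>d | d dvd n. d * (if d = 1 then 1 else 0)) = (\<Sum>d | d dvd n. if d = 1 then 1 else (0::nat))"
    by (intro sum.cong) auto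
  thus ?case using 0 by simp
next
  case (Suc r)
  have "real (subgroup_number (Suc (Suc r)) n) = (\<Sum>d | d dvd n. real d * real (subgroup_number (Suc r) d))"
    by simp
  also have "\<dots> = (\<Sum>d | d dvd n. real n ^ Suc r * (dirichlet_prod (subgroup_weight r) (\<lambda>_. 1) d * (1 / real (n div d) ^ Suc r)))"
  proof (rule sum.cong[OF refl])
    fix d assume "d \<in> {d. d dvd n}"
    hence d: "d dvd n" "d > 0" using Suc.prems by (auto intro: Nat.gr0I)
    then obtain k where k: "n = d * k" by auto
    have "k > 0" using k Suc.prems by auto
    thus "real d * real (subgroup_number (Suc r) d) =
      real n ^ Suc r * (dirichlet_prod (subgroup_weight r) (\<lambda>_. 1) d * (1 / real (n div d) ^ Suc r))"
      using d Suc.IH[OF d(2)] by (simp add: dirichlet_prod_def k power_mult_distrib field_simps)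
  qed
  also have "\<dots> = real n ^ Suc r * dirichlet_prod (dirichlet_prod (subgroup_weight r) (\<lambda>_. 1)) (\<lambda>n. 1 / real n ^ Suc r) n"
    unfolding dirichlet_prod_def[of "dirichlet_prod _ _"] by (simp add: sum_distrib_left)
  also have "dirichlet_prod (dirichlet_prod (subgroup_weight r) (\<lambda>_. 1)) (\<lambda>n. 1 / real n ^ Suc r) n =
             dirichlet_prod (dirichlet_prod (subgroup_weight r) (\<lambda>n. 1 / real n ^ Suc r)) (\<lambda>_. 1) n"
    using Suc.prems dirichlet_prod_assoc[OF Suc.prems] dirichlet_prod_commute
    by (metis (no_types, lifting) dirichlet_prod_cong)
  also have "\<dots> = (\<Sum>e | e dvd n. subgroup_weight (Suc r) e)"
    by (simp add: dirichlet_prod_def)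
  finally show ?case .
qed

text \<open>All exponents in \<open>n\<^sup>-\<^sup>1, \<dots>, n\<^sup>-\<^sup>r\<close> are at most \<open>-1\<close>, so any additional \<open>n\<^sup>-\<^sup>\<sigma>\<close> makes the series
converge.\<close>
lemma summable_weight_subgroup_weight: "summable_weight (subgroup_weight r)"
proof (induction r)
  case 0
  have "(\<lambda>n. subgroup_weight 0 n * real n powr -\<sigma>) summable_on {0<..}" for \<sigma>
  proof -
    have "(\<lambda>n. subgroup_weight 0 n * real n powr -\<sigma>) summable_on {0<..} \<longleftrightarrow>
          (\<lambda>n. subgroup_weight 0 n * real n powr -\<sigma>) summable_on {1}"
      by (rule summable_on_cong_neutral) auto
    thus ?thesis by simp
  qed
  thus ?case by (simp add: summable_weight_def)
next
  case (Suc r)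
  let ?k = "\<lambda>n. 1 / real n ^ Suc r"
  have nonneg: "subgroup_weight (Suc r) n \<ge> 0" for n
    using Suc unfolding subgroup_weight.simps dirichlet_prod_def summable_weight_def by (intro sum_nonneg) auto
  have "(\<lambda>n. subgroup_weight (Suc r) n * real n powr -\<sigma>) summable_on {0<..}" if "\<sigma> > 0" for \<sigma>
  proof -
    have "(\<lambda>n. norm (dirichlet_prod (\<lambda>n. real n powr -\<sigma> * subgroup_weight r n) (\<lambda>n. real n powr -\<sigma> * ?k n) n)) summable_on {0<..}"
    proof (rule dirichlet_prod_summable)
      have "(\<lambda>n. subgroup_weight r n * real n powr -\<sigma>) summable_on {0<..}"
        using Suc that by (simp add: summable_weight_def)
      thus "(\<lambda>n. norm (real n powr -\<sigma> * subgroup_weight r n)) summable_on {0<..}"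
        using Suc by (simp add: summable_weight_def mult.commute)
      have "(\<lambda>n. real n powr -(\<sigma> + real (Suc r))) summable_on {0<..}"
        by (rule powr_summable_on) (use that in simp)
      also have "?this \<longleftrightarrow> (\<lambda>n. norm (real n powr -\<sigma> * ?k n)) summable_on {0<..}"
        by (rule summable_on_cong) (simp add: powr_diff powr_minus powr_add powr_realpow field_simps)
      finally show "(\<lambda>n. norm (real n powr -\<sigma> * ?k n)) summable_on {0<..}" .
    qed
    also have "?this \<longleftrightarrow> (\<lambda>n. subgroup_weight (Suc r) n * real n powr -\<sigma>) summable_on {0<..}"
    proof (rule summable_on_cong)
      fix n :: nat assume "n \<in> {0<..}"
      hence "dirichlet_prod (\<lambda>n. real n powr -\<sigma> * subgroup_weight r n) (\<lambda>n. real n powr -\<sigma> * ?k n) n = real n powr -\<sigma> * subgroup_weight (Suc r) n"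
        unfolding subgroup_weight.simps by (intro dirichlet_prod_twist) (auto simp: powr_mult)
      thus "norm (dirichlet_prod (\<lambda>n. real n powr -\<sigma> * subgroup_weight r n) (\<lambda>n. real n powr -\<sigma> * ?k n) n) = subgroup_weight (Suc r) n * real n powr -\<sigma>"
        using nonneg[of n] by (simp add: mult.commute del: subgroup_weight.simps)
    qed
    finally show ?thesis .
  qed
  moreover have "subgroup_weight (Suc r) 1 = 1" using Suc by (simp add: summable_weight_def)
  ultimately show ?case using nonneg by (simp add: summable_weight_def del: subgroup_weight.simps)
qed

text \<open>The operation on weights that corresponds to multiplying divisor sums pointwise: \<open>d\<close> and \<open>e\<close> both
divide \<open>n\<close> exactly if \<open>lcm d e\<close> does.\<close>
definition lcm_conv :: "(nat \<Rightarrow> real) \<Rightarrow> (nat \<Rightarrow> real) \<Rightarrow> nat \<Rightarrow> real" where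
  "lcm_conv f g n = (\<Sum>(d, e)\<in>{(d, e). lcm d e = n}. f d * g e)"

lemma finite_lcm_pairs: "n > 0 \<Longrightarrow> finite {(d, e). lcm d e = (n::nat)}"
  by (rule finite_subset[of _ "{..n} \<times> {..n}"]) (auto intro!: dvd_imp_le)

lemma lcm_conv_divisor_sum:
  assumes "n > 0"
  shows "(\<Sum>d | d dvd n. f d) * (\<Sum>e | e dvd n. g e) = (\<Sum>k | k dvd n. lcm_conv f g k)"
proof -
  have pos: "k > 0" if "k dvd n" for k using that assms by (auto intro: Nat.gr0I)
  have "(\<Sum>k | k dvd n. lcm_conv f g k) = (\<Sum>(k, p)\<in>(SIGMA k:{k. k dvd n}. {(d, e). lcm d e = k}). case p of (d, e) \<Rightarrow> f d * g e)"
    unfolding lcm_conv_def using assms pos finite_lcm_pairs by (subst sum.Sigma) auto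
  also have "\<dots> = (\<Sum>(d, e)\<in>{d. d dvd n} \<times> {e. e dvd n}. f d * g e)"
    by (rule sum.reindex_bij_witness[of _ "\<lambda>(d, e). (lcm d e, (d, e))" "\<lambda>(k, p). p"])
       (auto intro: dvd_trans)
  also have "\<dots> = (\<Sum>d | d dvd n. f d) * (\<Sum>e | e dvd n. g e)"
    by (simp add: sum_product sum.cartesian_product)
  finally show ?thesis by simp
qed

text \<open>Since \<open>lcm d e\<close> is at least \<open>sqrt (d e)\<close>, the series at \<open>\<sigma>\<close> is bounded by the product of the two
given series at \<open>\<sigma> / 2\<close>. This is why weights are required to be summable for every \<open>\<sigma> > 0\<close>.\<close>
lemma summable_weight_lcm_conv:
  assumes f: "summable_weight f" and g: "summable_weight g"
  shows "summable_weight (lcm_conv f g)"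
proof -
  have pos: "f n \<ge> 0" "g n \<ge> 0" for n using f g by (auto simp: summable_weight_def)
  have "{(d, e). lcm d e = (1::nat)} = {(1, 1)}" by auto
  hence "lcm_conv f g 1 = 1" using f g by (simp add: lcm_conv_def summable_weight_def)
  moreover have "(\<lambda>n. lcm_conv f g n * real n powr -\<sigma>) summable_on {0<..}" if "\<sigma> > 0" for \<sigma>
  proof -
    let ?S = "SIGMA n:{0<..}. {(d, e). lcm d e = (n::nat)}"
    define F where "F = (\<lambda>d e. (f d * real d powr -(\<sigma>/2)) * (g e * real e powr -(\<sigma>/2)))"
    have "(\<lambda>(d, e). norm (F d e)) summable_on {0<..} \<times> {0<..}"
      unfolding F_def
    proof (rule norm_product_summable_on)
      show "(\<lambda>n. norm (f n * real n powr - (\<sigma> / 2))) summable_on {0<..}"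
        using f that unfolding summable_weight_def by simp
      show "(\<lambda>n. norm (g n * real n powr - (\<sigma> / 2))) summable_on {0<..}"
        using g that unfolding summable_weight_def by simp
    qed
    hence "(\<lambda>(d, e). f d * g e * real (lcm d e) powr -\<sigma>) summable_on {0<..} \<times> {0<..}"
    proof (rule summable_on_comparison_test)
      fix x :: "nat \<times> nat" assume "x \<in> {0<..} \<times> {0<..}"
      then obtain d e where x: "x = (d, e)" "d > 0" "e > 0" by (cases x) auto
      have l: "lcm d e \<ge> d" "lcm d e \<ge> e" using x by (auto intro!: dvd_imp_le lcm_pos_nat)
      have "real (lcm d e) powr -\<sigma> = real (lcm d e) powr -(\<sigma>/2) * real (lcm d e) powr -(\<sigma>/2)"
        by (simp flip: powr_add)
      also have "\<dots> \<le> real d powr -(\<sigma>/2) * real e powr -(\<sigma>/2)"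
        using l x that by (intro mult_mono powr_mono2') auto
      finally have "f d * g e * real (lcm d e) powr -\<sigma> \<le> f d * g e * (real d powr -(\<sigma>/2) * real e powr -(\<sigma>/2))"
        using pos by (intro mult_left_mono) auto
      also have "\<dots> = norm (F d e)" using pos by (simp add: F_def)
      finally show "(case x of (d, e) \<Rightarrow> f d * g e * real (lcm d e) powr -\<sigma>) \<le> (case x of (d, e) \<Rightarrow> norm (F d e))"
        by (simp add: x)
    qed (use pos in auto)
    also have "?this \<longleftrightarrow> (\<lambda>(n, p). case p of (d, e) \<Rightarrow> f d * g e * real n powr -\<sigma>) summable_on ?S"
      by (rule summable_on_reindex_bij_witness[of _ "\<lambda>(n, p). p" "\<lambda>(d, e). (lcm d e, (d, e))"])
         (auto simp: lcm_pos_nat intro!: Nat.gr0I)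
    finally have "(\<lambda>n. infsum (\<lambda>p. case p of (d, e) \<Rightarrow> f d * g e * real n powr -\<sigma>) {(d, e). lcm d e = n}) summable_on {0<..}"
      by (rule summable_on_Sigma_banach)
    also have "?this \<longleftrightarrow> ?thesis"
    proof (rule summable_on_cong)
      fix n :: nat assume "n \<in> {0<..}"
      hence "finite {(d, e). lcm d e = n}" by (simp add: finite_lcm_pairs)
      thus "infsum (\<lambda>p. case p of (d, e) \<Rightarrow> f d * g e * real n powr -\<sigma>) {(d, e). lcm d e = n} = lcm_conv f g n * real n powr -\<sigma>"
        by (simp add: lcm_conv_def sum_distrib_right case_prod_unfold)
    qed
    finally show ?thesis .
  qed
  moreover have "lcm_conv f g n \<ge> 0" for n
    unfolding lcm_conv_def by (intro sum_nonneg) (auto simp: pos)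
  ultimately show ?thesis by (simp add: summable_weight_def)
qed

text \<open>For the product map this is the number of points fixed by the \<open>n\<close>-th iterate: a map with
\<open>a\<^sub>n(\<int>\<^sup>r)\<close> orbits of length \<open>n\<close> has \<open>\<Sum>d | n. d a\<^sub>d(\<int>\<^sup>r) = a\<^sub>n(\<int>\<^sup>r\<^sup>+\<^sup>1)\<close> such points.\<close>
definition fixed_point_count :: "nat list \<Rightarrow> nat \<Rightarrow> nat" where
  "fixed_point_count lam n = (\<Prod>r\<leftarrow>lam. subgroup_number (Suc r) n)"

theorem fixed_point_count_weight:
  "\<exists>H. summable_weight H \<and> (\<forall>n>0. real (fixed_point_count lam n) = real n ^ sum_list lam * (\<Sum>e | e dvd n. H e))"
proof (induction lam)
  case Nil
  thus ?case
    by (intro exI[of _ "subgroup_weight 0"] conjI summable_weight_subgroup_weight) (simp add: fixed_point_count_def)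
next
  case (Cons r lam)
  then obtain H where H: "summable_weight H"
    "\<And>n. n > 0 \<Longrightarrow> real (fixed_point_count lam n) = real n ^ sum_list lam * (\<Sum>e | e dvd n. H e)" by blast
  have "real (fixed_point_count (r # lam) n) = real n ^ sum_list (r # lam) * (\<Sum>e | e dvd n. lcm_conv (subgroup_weight r) H e)"
    if n: "n > 0" for n
  proof -
    have "real (fixed_point_count (r # lam) n) = real (subgroup_number (Suc r) n) * real (fixed_point_count lam n)"
      by (simp add: fixed_point_count_def)
    thus ?thesis
      using subgroup_number_subgroup_weight[OF n, of r] H(2)[OF n] lcm_conv_divisor_sum[OF n, of "subgroup_weight r" H]
      by (simp add: power_add mult_ac del: subgroup_number.simps)
  qed
  thus ?case using summable_weight_lcm_conv[OF summable_weight_subgroup_weight H(1)] by blast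
qed

section \<open>Growth of the orbit counts\<close>

lemma dirichlet_prod_split:
  fixes f k :: "nat \<Rightarrow> real"
  assumes "n > 0"
  shows "dirichlet_prod f k n = f n * k 1 + (\<Sum>d | d dvd n \<and> d < n. f d * k (n div d))"
proof -
  have "{d. d dvd n} = insert n {d. d dvd n \<and> d < n}"
    using assms by (auto dest: dvd_imp_le)
  thus ?thesis using assms by (simp add: dirichlet_prod_def)
qed

text \<open>The solution \<open>b\<close> of \<open>b * k = g\<close> when \<open>k 1 = 1\<close>. In this recursive form its absolute
summability can be read off from the size of \<open>k\<close>.\<close>
function dirichlet_quot :: "(nat \<Rightarrow> real) \<Rightarrow> (nat \<Rightarrow> real) \<Rightarrow> nat \<Rightarrow> real" where
  "dirichlet_quot g k n = g n - (\<Sum>d | d dvd n \<and> d < n. dirichlet_quot g k d * k (n div d))"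
  by auto
termination by (relation "Wellfounded.measure (\<lambda>(g, k, n). n)") auto

declare dirichlet_quot.simps [simp del]

lemma dirichlet_prod_dirichlet_quot:
  assumes "n > 0" "k 1 = 1" shows "dirichlet_prod (dirichlet_quot g k) k n = g n"
  using dirichlet_prod_split[OF assms(1), of "dirichlet_quot g k" k] assms dirichlet_quot.simps[of g k n] by simp

lemma dirichlet_prod_cancel_right:
  fixes u v k :: "nat \<Rightarrow> real"
  assumes "k 1 = 1" "\<And>n. n > 0 \<Longrightarrow> dirichlet_prod u k n = dirichlet_prod v k n" and "n > 0"
  shows "u n = v n"
  using assms(3)
proof (induction n rule: less_induct)
  case (less n)
  have "u d = v d" if "d dvd n" "d < n" for d
    using less that by (auto intro: Nat.gr0I)
  hence "(\<Sum>d | d dvd n \<and> d < n. u d * k (n div d)) = (\<Sum>d | d dvd n \<and> d < n. v d * k (n div d))"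
    by (intro sum.cong) auto
  thus ?case
    using dirichlet_prod_split[OF less.prems, of u k] dirichlet_prod_split[OF less.prems, of v k] assms(2)[OF less.prems] assms(1)
    by simp
qed

text \<open>A Neumann series argument: convolution with \<open>k\<close> is the identity plus an operator of norm
\<open>q < 1\<close> on absolutely summable sequences. Concretely, the partial sums \<open>A\<close> of \<open>\<bar>b\<bar>\<close> satisfy
\<open>A \<le> G + q A\<close>.\<close>
lemma dirichlet_quot_summable:
  assumes g: "(\<lambda>n. \<bar>g n\<bar>) summable_on {0<..}" and k: "(\<lambda>n. \<bar>k n\<bar>) summable_on {0<..}"
    and k1: "k 1 = 1" and small: "infsum (\<lambda>n. \<bar>k n\<bar>) {0<..} < 2"
  shows "(\<lambda>n. \<bar>dirichlet_quot g k n\<bar>) summable_on {0<..}"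
proof -
  define b where "b = dirichlet_quot g k"
  define q where "q = infsum (\<lambda>n. \<bar>k n\<bar>) {0<..} - 1"
  define G where "G = infsum (\<lambda>n. \<bar>g n\<bar>) {0<..}"
  have bn: "\<bar>b n\<bar> \<le> \<bar>g n\<bar> + (\<Sum>d | d dvd n \<and> d < n. \<bar>b d\<bar> * \<bar>k (n div d)\<bar>)" for n
  proof -
    have "\<bar>b n\<bar> \<le> \<bar>g n\<bar> + \<bar>\<Sum>d | d dvd n \<and> d < n. b d * k (n div d)\<bar>"
      unfolding b_def by (subst dirichlet_quot.simps) linarith
    also have "\<bar>\<Sum>d | d dvd n \<and> d < n. b d * k (n div d)\<bar> \<le> (\<Sum>d | d dvd n \<and> d < n. \<bar>b d\<bar> * \<bar>k (n div d)\<bar>)"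
      by (rule order.trans[OF sum_abs]) (simp add: abs_mult)
    finally show ?thesis by simp
  qed
  have kq: "(\<Sum>e\<in>{2..x}. \<bar>k e\<bar>) \<le> q" for x :: nat
  proof -
    have "(\<Sum>e\<in>insert 1 {2..x}. \<bar>k e\<bar>) \<le> infsum (\<lambda>n. \<bar>k n\<bar>) {0<..}"
      by (rule finite_sum_le_infsum[OF k]) auto
    thus ?thesis using k1 by (simp add: q_def)
  qed
  have gG: "(\<Sum>e\<in>{1..x}. \<bar>g e\<bar>) \<le> G" for x :: nat
    unfolding G_def by (rule finite_sum_le_infsum[OF g]) auto
  have bound: "(\<Sum>n\<in>{1..x}. \<bar>b n\<bar>) \<le> G / (1 - q)" for x :: nat
  proof -
    let ?A = "\<Sum>n\<in>{1..x}. \<bar>b n\<bar>"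
    have "(\<Sum>n\<in>{1..x}. \<Sum>d | d dvd n \<and> d < n. \<bar>b d\<bar> * \<bar>k (n div d)\<bar>) =
          (\<Sum>(n, d)\<in>(SIGMA n:{1..x}. {d. d dvd n \<and> d < n}). \<bar>b d\<bar> * \<bar>k (n div d)\<bar>)"
      by (subst sum.Sigma) auto
    also have "\<dots> = (\<Sum>(d, e)\<in>(\<lambda>(n, d). (d, n div d)) ` (SIGMA n:{1..x}. {d. d dvd n \<and> d < n}). \<bar>b d\<bar> * \<bar>k e\<bar>)"
      by (subst sum.reindex) (auto simp: inj_on_def case_prod_unfold elim!: dvdE)
    also have "\<dots> \<le> (\<Sum>(d, e)\<in>{1..x} \<times> {2..x}. \<bar>b d\<bar> * \<bar>k e\<bar>)"
    proof (rule sum_mono2)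
      show "(\<lambda>(n, d). (d, n div d)) ` (SIGMA n:{1..x}. {d. d dvd n \<and> d < n}) \<subseteq> {1..x} \<times> {2..x}"
      proof safe
        fix n d assume n: "n \<in> {1..x}" and d: "d dvd n" "d < n"
        then obtain e where e: "n = d * e" by auto
        have "d > 0" "e > 0" using e n by auto
        moreover have "e \<noteq> 1" using e d by auto
        moreover have "d \<le> x" "e \<le> x" using e \<open>d > 0\<close> \<open>e > 0\<close> n by (auto intro: order.trans[of _ n])
        moreover have "n div d = e" using e \<open>d > 0\<close> by simp
        ultimately show "d \<in> {1..x}" "n div d \<in> {2..x}" by auto
      qed
    qed auto
    also have "\<dots> = ?A * (\<Sum>e\<in>{2..x}. \<bar>k e\<bar>)"
      by (simp add: sum_product sum.cartesian_product)
    also have "\<dots> \<le> ?A * q"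
      by (intro mult_left_mono kq sum_nonneg) auto
    finally have "(\<Sum>n\<in>{1..x}. \<Sum>d | d dvd n \<and> d < n. \<bar>b d\<bar> * \<bar>k (n div d)\<bar>) \<le> ?A * q" .
    moreover have "?A \<le> (\<Sum>n\<in>{1..x}. \<bar>g n\<bar>) + (\<Sum>n\<in>{1..x}. \<Sum>d | d dvd n \<and> d < n. \<bar>b d\<bar> * \<bar>k (n div d)\<bar>)"
      unfolding sum.distrib[symmetric] by (intro sum_mono bn)
    ultimately have "?A * (1 - q) \<le> G" using gG[of x] by (simp add: algebra_simps)
    thus ?thesis using small by (simp add: q_def field_simps)
  qed
  have "(\<lambda>n. \<bar>b n\<bar>) summable_on {0<..}"
  proof (rule nonneg_bdd_above_summable_on)
    show "bdd_above (sum (\<lambda>n. \<bar>b n\<bar>) ` {F. F \<subseteq> {0<..} \<and> finite F})"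
    proof (rule bdd_aboveI2)
      fix F :: "nat set" assume "F \<in> {F. F \<subseteq> {0<..} \<and> finite F}"
      hence F: "F \<subseteq> {0<..}" "finite F" by auto
      have "F \<subseteq> {1..Max (insert 0 F)}" using F by (auto simp: Suc_le_eq)
      hence "sum (\<lambda>n. \<bar>b n\<bar>) F \<le> (\<Sum>n\<in>{1..Max (insert 0 F)}. \<bar>b n\<bar>)"
        by (intro sum_mono2) auto
      thus "sum (\<lambda>n. \<bar>b n\<bar>) F \<le> G / (1 - q)" using bound order.trans by blast
    qed
  qed auto
  thus ?thesis by (simp add: b_def)
qed

lemma sums_Suc_imp_has_sum:
  fixes f :: "nat \<Rightarrow> 'a::banach"
  assumes "summable (\<lambda>n. norm (f (Suc n)))" "(\<lambda>n. f (Suc n)) sums S"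
  shows "(f has_sum S) {0<..}"
proof -
  have "((\<lambda>n. f (Suc n)) has_sum S) UNIV"
    using assms by (rule norm_summable_imp_has_sum)
  moreover have "bij_betw Suc UNIV {0<..}"
    by (rule bij_betwI[of _ _ _ "\<lambda>n. n - 1"]) auto
  ultimately show ?thesis using has_sum_reindex_bij_betw[of Suc UNIV "{0<..}" f S] by simp
qed

text \<open>The constant \<open>2\<close> matters: it makes \<open>\<zeta>(\<sigma>) - 1 < 1\<close>, the condition for inverting convolution with
\<open>n\<^sup>-\<^sup>\<sigma>\<close> by a Neumann series.\<close>
lemma infsum_powr_less_2:
  assumes "\<sigma> \<ge> 2"
  shows "infsum (\<lambda>n::nat. real n powr -\<sigma>) {0<..} < 2"
proof -
  have "(\<lambda>n. 1 / (real (Suc n))\<^sup>2) sums (pi\<^sup>2 / 6)"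
    using inverse_squares_sums by (simp add: add.commute)
  hence "((\<lambda>n. 1 / (real n)\<^sup>2) has_sum (pi\<^sup>2 / 6)) {0<..}"
    by (intro sums_Suc_imp_has_sum) (auto dest: sums_summable)
  hence *: "(\<lambda>n. 1 / (real n)\<^sup>2) summable_on {0<..}" "infsum (\<lambda>n. 1 / (real n)\<^sup>2) {0<..} = pi\<^sup>2 / 6"
    by (auto simp: has_sum_iff)
  have "infsum (\<lambda>n::nat. real n powr -\<sigma>) {0<..} \<le> infsum (\<lambda>n. 1 / (real n)\<^sup>2) {0<..}"
  proof (rule infsum_mono)
    fix n :: nat assume n: "n \<in> {0<..}"
    have "real n powr -\<sigma> \<le> real n powr -2" using n assms by (intro powr_mono) auto
    thus "real n powr -\<sigma> \<le> 1 / (real n)\<^sup>2" using n by (simp add: powr_minus_divide)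
  qed (use * powr_summable_on assms in auto)
  also have "\<dots> < 2"
  proof -
    have "pi\<^sup>2 \<le> (16/5)\<^sup>2" using pi_approx by (intro power_mono) auto
    thus ?thesis using * by (simp add: power2_eq_square)
  qed
  finally show ?thesis .
qed

text \<open>The orbit counts \<open>O'\<close> are, up to the factor \<open>n\<^sup>N\<close>, the convolution of \<open>1 / n\<close> with an absolutely
summable \<open>b\<close> of positive sum. Everything is divided by powers of \<open>n\<close> so that the summability
condition carries no exponent. The relation between \<open>O'\<close> and the fixed point counts contains a further convolution with
\<open>k n = 1 / n\<^sup>N\<^sup>+\<^sup>1\<close>, and \<open>b\<close> is the quotient of \<open>H n / n\<close> by \<open>k\<close>; the sum of \<open>b\<close> is the quotient of two
positive sums.\<close>
theorem orbit_weights: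
  fixes O' :: "nat \<Rightarrow> nat"
  assumes N: "N \<ge> 1" and H: "summable_weight H"
    and O: "\<And>n. n > 0 \<Longrightarrow> real (\<Sum>d | d dvd n. d * O' d) = real n ^ N * (\<Sum>e | e dvd n. H e)"
  shows "\<exists>b. (\<lambda>n. \<bar>b n\<bar>) summable_on {0<..} \<and> infsum b {0<..} > 0 \<and>
             (\<forall>n>0. real (O' n) = real n ^ N * dirichlet_prod b (\<lambda>n. 1 / real n) n)"
proof -
  define k where "k = (\<lambda>n::nat. 1 / real n ^ (N + 1))"
  define g where "g = (\<lambda>n::nat. H n / real n)"
  define b where "b = dirichlet_quot g k"
  have k1: "k 1 = 1" by (simp add: k_def)
  have k_powr: "\<bar>k n\<bar> = real n powr -(real N + 1)" if "n \<in> {0<..}" for n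
  proof -
    have "real n powr -(real N + 1) = inverse (real n powr real (N + 1))"
      by (simp only: powr_minus of_nat_add of_nat_1)
    also have "\<dots> = inverse (real n ^ (N + 1))" using that by (subst powr_realpow) auto
    finally show ?thesis by (simp add: k_def divide_inverse)
  qed
  have ks: "(\<lambda>n. \<bar>k n\<bar>) summable_on {0<..}"
    using powr_summable_on[of "real N + 1"] N k_powr by (subst summable_on_cong[OF k_powr]) auto
  have ki: "infsum (\<lambda>n. \<bar>k n\<bar>) {0<..} < 2"
    using infsum_powr_less_2[of "real N + 1"] N by (subst infsum_cong[OF k_powr]) auto
  have gH: "g n = H n * real n powr -1" if "n \<in> {0<..}" for n
    using that by (simp add: g_def powr_minus_divide)
  have g0: "g n \<ge> 0" for n using H by (simp add: g_def summable_weight_def)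
  have gs: "g summable_on {0<..}"
  proof (subst summable_on_cong[OF gH])
    show "(\<lambda>n. H n * real n powr -1) summable_on {0<..}"
      using H zero_less_one unfolding summable_weight_def by blast
  qed auto
  hence gs': "(\<lambda>n. \<bar>g n\<bar>) summable_on {0<..}" using g0 by simp
  have bs: "(\<lambda>n. \<bar>b n\<bar>) summable_on {0<..}"
    unfolding b_def by (rule dirichlet_quot_summable[OF gs' ks k1 ki])
  have bk: "dirichlet_prod b k n = g n" if "n > 0" for n
    unfolding b_def using that k1 by (rule dirichlet_prod_dirichlet_quot)
  have "infsum b {0<..} * infsum k {0<..} = infsum (dirichlet_prod b k) {0<..}"
    using dirichlet_prod_summable(2)[of b k] bs ks by simp
  also have "\<dots> = infsum g {0<..}"
    using bk by (intro infsum_cong) auto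
  also have "\<dots> > 0"
  proof -
    have "(\<Sum>n\<in>{1}. g n) \<le> infsum g {0<..}"
      by (rule finite_sum_le_infsum[OF gs]) (use g0 in auto)
    thus ?thesis using H by (simp add: g_def summable_weight_def)
  qed
  finally have "infsum b {0<..} * infsum k {0<..} > 0" .
  moreover have "infsum k {0<..} \<ge> 0" by (rule infsum_nonneg) (simp add: k_def)
  ultimately have b_pos: "infsum b {0<..} > 0" by (simp add: zero_less_mult_iff)
  \<comment> \<open>Both sides have the same convolution with k, namely g convolved with 1 / n.\<close>
  have "real (O' n) / real n ^ N = dirichlet_prod (\<lambda>n. 1 / real n) b n" if "n > 0" for n
  proof (rule dirichlet_prod_cancel_right[where k = k and u = "\<lambda>n. real (O' n) / real n ^ N" and v = "dirichlet_prod (\<lambda>n. 1 / real n) b"])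
    show "k 1 = 1" "n > 0" by (rule k1, rule that)
  next
    fix n :: nat assume n: "n > 0"
    have "dirichlet_prod (\<lambda>n. real (O' n) / real n ^ N) k n = (\<Sum>d | d dvd n. real (d * O' d) / real n ^ (N + 1))"
      unfolding dirichlet_prod_def
    proof (rule sum.cong[OF refl])
      fix d assume "d \<in> {d. d dvd n}"
      then obtain e where e: "n = d * e" by auto
      have "d > 0" "e > 0" using e n by auto
      thus "real (O' d) / real d ^ N * k (n div d) = real (d * O' d) / real n ^ (N + 1)"
        by (simp add: e k_def power_mult_distrib field_simps)
    qed
    also have "\<dots> = real (\<Sum>d | d dvd n. d * O' d) / real n ^ (N + 1)"
      by (simp add: sum_divide_distrib)
    also have "\<dots> = (\<Sum>e | e dvd n. H e) / real n"
      unfolding O[OF n] using n by simp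
    also have "\<dots> = dirichlet_prod g (\<lambda>n. 1 / real n) n"
      unfolding dirichlet_prod_def sum_divide_distrib
    proof (rule sum.cong[OF refl])
      fix d assume "d \<in> {d. d dvd n}"
      then obtain e where e: "n = d * e" by auto
      have "d > 0" "e > 0" using e n by auto
      thus "H d / real n = g d * (1 / real (n div d))"
        by (simp add: e g_def field_simps)
    qed
    also have "\<dots> = dirichlet_prod (dirichlet_prod b k) (\<lambda>n. 1 / real n) n"
      using n bk by (intro dirichlet_prod_cong) auto
    also have "\<dots> = dirichlet_prod (\<lambda>n. 1 / real n) (dirichlet_prod b k) n"
      by (rule dirichlet_prod_commute[OF n])
    also have "\<dots> = dirichlet_prod (dirichlet_prod (\<lambda>n. 1 / real n) b) k n"
      by (rule dirichlet_prod_assoc[OF n, symmetric])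
    finally show "dirichlet_prod (\<lambda>n. real (O' n) / real n ^ N) k n = dirichlet_prod (dirichlet_prod (\<lambda>n. 1 / real n) b) k n" .
  qed
  hence "real (O' n) = real n ^ N * dirichlet_prod b (\<lambda>n. 1 / real n) n" if "n > 0" for n
    using that dirichlet_prod_commute[OF that, of b "\<lambda>n. 1 / real n"] by (simp add: field_simps)
  thus ?thesis using bs b_pos by blast
qed

lemma power_diff_bounds:
  fixes x :: real assumes "x \<ge> 0"
  shows "real n * x ^ (n - 1) \<le> (x + 1) ^ n - x ^ n" "(x + 1) ^ n - x ^ n \<le> real n * (x + 1) ^ (n - 1)"
proof (induction n)
  case (Suc n)
  have e: "(x + 1) ^ Suc n - x ^ Suc n = (x + 1) * ((x + 1) ^ n - x ^ n) + x ^ n"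
    by (simp add: algebra_simps)
  {
    case 1
    have "x * (real n * x ^ (n - 1)) \<le> (x + 1) * ((x + 1) ^ n - x ^ n)"
      by (rule mult_mono) (use Suc assms in auto)
    moreover have "x * (real n * x ^ (n - 1)) = real n * x ^ n" by (cases n) auto
    moreover have "real (Suc n) * x ^ (Suc n - 1) = real n * x ^ n + x ^ n" by (simp add: algebra_simps)
    ultimately show ?case unfolding e by linarith
  next
    case 2
    have "(x + 1) * ((x + 1) ^ n - x ^ n) \<le> (x + 1) * (real n * (x + 1) ^ (n - 1))"
      by (rule mult_left_mono) (use Suc assms in auto)
    moreover have "(x + 1) * (real n * (x + 1) ^ (n - 1)) = real n * (x + 1) ^ n" by (cases n) auto
    moreover have "x ^ n \<le> (x + 1) ^ n" using assms by (intro power_mono) auto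
    moreover have "real (Suc n) * (x + 1) ^ (Suc n - 1) = real n * (x + 1) ^ n + (x + 1) ^ n"
      by (simp add: algebra_simps)
    ultimately show ?case unfolding e by linarith
  }
qed auto

lemma power_sum_bounds:
  assumes "N \<ge> 1"
  shows "real m ^ N \<le> real N * (\<Sum>j=1..m. real j ^ (N - 1))"
    and "real N * (\<Sum>j=1..m. real j ^ (N - 1)) \<le> real (m + 1) ^ N"
    and "(\<Sum>j=1..m. real j ^ (N - 1)) \<le> real m ^ N"
proof -
  show "real m ^ N \<le> real N * (\<Sum>j=1..m. real j ^ (N - 1))"
  proof (induction m)
    case (Suc m)
    thus ?case using power_diff_bounds(2)[of "real m" N] by (simp add: algebra_simps)
  qed (use assms in \<open>auto simp: power_0_left\<close>)
  show "real N * (\<Sum>j=1..m. real j ^ (N - 1)) \<le> real (m + 1) ^ N"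
  proof (induction m)
    case (Suc m)
    thus ?case using power_diff_bounds(1)[of "real (Suc m)" N] by (simp add: algebra_simps)
  qed auto
  have "(\<Sum>j=1..m. real j ^ (N - 1)) \<le> (\<Sum>j=1..m. real m ^ (N - 1))"
    by (intro sum_mono power_mono) auto
  also have "\<dots> = real m ^ N" using assms by (cases N) auto
  finally show "(\<Sum>j=1..m. real j ^ (N - 1)) \<le> real m ^ N" .
qed

lemma power_sum_limit:
  assumes "N \<ge> 1"
  shows "(\<lambda>m. (\<Sum>j=1..m. real j ^ (N - 1)) / real m ^ N) \<longlonglongrightarrow> 1 / real N"
proof (rule tendsto_sandwich)
  show "\<forall>\<^sub>F m in sequentially. 1 / real N \<le> (\<Sum>j=1..m. real j ^ (N - 1)) / real m ^ N"
    using eventually_gt_at_top[of 0]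
  proof eventually_elim
    case (elim m)
    thus ?case using power_sum_bounds(1)[OF assms, of m] assms by (simp add: field_simps)
  qed
  show "\<forall>\<^sub>F m in sequentially. (\<Sum>j=1..m. real j ^ (N - 1)) / real m ^ N \<le> ((real m + 1) / real m) ^ N / real N"
    using eventually_gt_at_top[of 0]
  proof eventually_elim
    case (elim m)
    thus ?case using power_sum_bounds(2)[OF assms, of m] assms by (simp add: field_simps)
  qed
  have "(\<lambda>m. (real m + 1) / real m) \<longlonglongrightarrow> 1"
    using LIMSEQ_Suc_n_over_n by (simp add: add.commute)
  from tendsto_divide[OF tendsto_power[OF this] tendsto_const, of "real N" N]
  show "(\<lambda>m. ((real m + 1) / real m) ^ N / real N) \<longlonglongrightarrow> 1 / real N" using assms by simp
qed auto

lemma div_over_tendsto: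
  assumes "e > 0" shows "(\<lambda>x. real e * real (x div e) / real x) \<longlonglongrightarrow> 1"
proof (rule tendsto_sandwich)
  have *: "real e * real (x div e) = real x - real (x mod e)" for x
    by (metis add_diff_cancel_right' mult_div_mod_eq of_nat_add of_nat_mult)
  show "\<forall>\<^sub>F x in sequentially. 1 - real e / real x \<le> real e * real (x div e) / real x"
    using eventually_gt_at_top[of 0]
  proof eventually_elim
    case (elim x)
    have "real (x mod e) \<le> real e" using assms by (simp add: less_imp_le)
    thus ?case using elim unfolding * by (simp add: field_simps)
  qed
  show "\<forall>\<^sub>F x in sequentially. real e * real (x div e) / real x \<le> 1"
    using eventually_gt_at_top[of 0] by eventually_elim (simp add: *)
  show "(\<lambda>x. 1 - real e / real x) \<longlonglongrightarrow> 1"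
    using tendsto_diff[OF tendsto_const[of 1] lim_const_over_n[of "real e"]] by simp
qed auto

text \<open>Writing \<open>n = e j\<close>, the sum of \<open>a\<close> up to \<open>x\<close> becomes \<open>\<Sum>e. b e e\<^sup>N P(x div e)\<close> with the power sum
\<open>P m = 1 + \<dots> + m\<^sup>N\<^sup>-\<^sup>1\<close>. Divided by \<open>x\<^sup>N\<close>, each term tends to \<open>b e / N\<close> and is dominated by
\<open>\<bar>b e\<bar>\<close>, so Tannery's theorem gives the limit.\<close>
theorem summatory_asymptotics:
  assumes N: "N \<ge> 1" and b: "(\<lambda>n. \<bar>b n\<bar>) summable_on {0<..}"
    and a: "\<And>n. n > 0 \<Longrightarrow> a n = real n ^ N * dirichlet_prod b (\<lambda>n. 1 / real n) n"
  shows "(\<lambda>x. (\<Sum>n=1..x. a n) / real x ^ N) \<longlonglongrightarrow> infsum b {0<..} / real N"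
proof -
  define P where "P = (\<lambda>m. \<Sum>j=1..m. real j ^ (N - 1))"
  define T where "T = (\<lambda>e x. real e ^ N * P (x div e) / real x ^ N)"
  have sum_eq: "(\<Sum>n=1..x. a n) = (\<Sum>e=1..x. b e * (real e ^ N * P (x div e)))" for x
  proof -
    have "(\<Sum>n=1..x. a n) = (\<Sum>n=1..x. \<Sum>e | e dvd n. b e * (real e * real n ^ (N - 1)))"
    proof (rule sum.cong[OF refl])
      fix n assume "n \<in> {1..x}"
      hence n: "n > 0" by simp
      have "real n ^ N * dirichlet_prod b (\<lambda>n. 1 / real n) n = (\<Sum>e | e dvd n. b e * (real e * real n ^ (N - 1)))"
        unfolding dirichlet_prod_def sum_distrib_left
      proof (rule sum.cong[OF refl])
        fix e assume "e \<in> {e. e dvd n}"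
        then obtain k where k: "n = e * k" by auto
        have "e > 0" "k > 0" using k n by auto
        moreover have "real n ^ N = real n * real n ^ (N - 1)" using N by (cases N) auto
        ultimately show "real n ^ N * (b e * (1 / real (n div e))) = b e * (real e * real n ^ (N - 1))"
          by (simp add: k)
      qed
      thus "a n = (\<Sum>e | e dvd n. b e * (real e * real n ^ (N - 1)))" using a[OF n] by simp
    qed
    also have "\<dots> = (\<Sum>(n, e)\<in>(SIGMA n:{1..x}. {e. e dvd n}). b e * (real e * real n ^ (N - 1)))"
      by (subst sum.Sigma) auto
    also have "\<dots> = (\<Sum>(e, j)\<in>(SIGMA e:{1..x}. {1..x div e}). b e * (real e * real (e * j) ^ (N - 1)))"
    proof (rule sum.reindex_bij_witness[of _ "\<lambda>(e, j). (e * j, e)" "\<lambda>(n, e). (e, n div e)"], goal_cases)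
      case (2 p)
      then obtain n e where p: "p = (n, e)" "1 \<le> n" "n \<le> x" "e dvd n" by auto
      then obtain k where k: "n = e * k" by auto
      have "e > 0" "k > 0" using k p by auto
      moreover have "e \<le> x" using \<open>k > 0\<close> k p by (auto intro: order.trans[of _ n])
      moreover have "k \<le> x div e" using k p \<open>e > 0\<close>
        by (simp add: less_eq_div_iff_mult_less_eq mult.commute)
      ultimately show ?case using p k by simp
    next
      case (4 p)
      thus ?case by (auto simp: less_eq_div_iff_mult_less_eq mult.commute)
    qed auto
    also have "\<dots> = (\<Sum>e=1..x. \<Sum>j=1..x div e. b e * (real e * real (e * j) ^ (N - 1)))"
      by (subst sum.Sigma) auto
    also have "\<dots> = (\<Sum>e=1..x. b e * (real e ^ N * P (x div e)))"
    proof (rule sum.cong[OF refl])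
      fix e
      have "real e ^ N = real e * real e ^ (N - 1)" using N by (cases N) auto
      thus "(\<Sum>j=1..x div e. b e * (real e * real (e * j) ^ (N - 1))) = b e * (real e ^ N * P (x div e))"
        unfolding P_def sum_distrib_left by (intro sum.cong) (auto simp: power_mult_distrib)
    qed
    finally show ?thesis .
  qed
  have suminf_eq: "(\<Sum>n=1..x. a n) / real x ^ N = (\<Sum>k. b (Suc k) * T (Suc k) x)" for x
  proof -
    have "(\<Sum>k. b (Suc k) * T (Suc k) x) = (\<Sum>k<x. b (Suc k) * T (Suc k) x)"
      by (rule suminf_finite) (auto simp: T_def P_def not_less)
    also have "\<dots> = (\<Sum>e=1..x. b e * T e x)"
      by (rule sum.reindex_bij_witness[of _ "\<lambda>e. e - 1" Suc]) auto
    also have "\<dots> = (\<Sum>n=1..x. a n) / real x ^ N"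
      unfolding sum_eq sum_divide_distrib by (simp add: T_def)
    finally show ?thesis by simp
  qed
  have T_le: "\<bar>T e x\<bar> \<le> 1" if "e > 0" for e x
  proof (cases "x = 0")
    case False
    have "P (x div e) \<le> real (x div e) ^ N" unfolding P_def using power_sum_bounds(3)[OF N] .
    hence "real e ^ N * P (x div e) \<le> real e ^ N * real (x div e) ^ N"
      by (intro mult_left_mono) auto
    also have "\<dots> = real (e * (x div e)) ^ N" by (simp add: power_mult_distrib)
    also have "\<dots> \<le> real x ^ N"
    proof (rule power_mono)
      show "real (e * (x div e)) \<le> real x" by (simp only: of_nat_le_iff times_div_less_eq_dividend)
    qed auto
    finally have "T e x \<le> 1" using False by (simp add: T_def)
    moreover have "T e x \<ge> 0" by (auto simp: T_def P_def intro!: divide_nonneg_nonneg mult_nonneg_nonneg sum_nonneg)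
    ultimately show ?thesis by simp
  qed (use N in \<open>simp add: T_def power_0_left\<close>)
  have T_lim: "(\<lambda>x. T e x) \<longlonglongrightarrow> 1 / real N" if "e > 0" for e
  proof -
    have "filterlim (\<lambda>x. x div e) at_top sequentially"
      unfolding filterlim_at_top
    proof
      fix Z
      show "\<forall>\<^sub>F x in sequentially. Z \<le> x div e"
        using eventually_ge_at_top[of "Z * e"] by eventually_elim (use that in \<open>simp add: less_eq_div_iff_mult_less_eq\<close>)
    qed
    from filterlim_compose[OF power_sum_limit[OF N] this]
    have 1: "(\<lambda>x. P (x div e) / real (x div e) ^ N) \<longlonglongrightarrow> 1 / real N" by (simp add: P_def)
    have 2: "(\<lambda>x. (real e * real (x div e) / real x) ^ N) \<longlonglongrightarrow> 1 ^ N"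
      by (intro tendsto_power div_over_tendsto that)
    have "(\<lambda>x. (P (x div e) / real (x div e) ^ N) * (real e * real (x div e) / real x) ^ N) \<longlonglongrightarrow> 1 / real N"
      using tendsto_mult[OF 1 2] by simp
    thus ?thesis
    proof (rule Lim_transform_eventually)
      show "\<forall>\<^sub>F x in sequentially. (P (x div e) / real (x div e) ^ N) * (real e * real (x div e) / real x) ^ N = T e x"
        using eventually_ge_at_top[of e]
      proof eventually_elim
        case (elim x)
        hence "x div e > 0" using that by (simp add: div_greater_zero_iff)
        thus ?case by (simp add: T_def power_mult_distrib power_divide field_simps)
      qed
    qed
  qed
  have bs: "summable (\<lambda>k. \<bar>b (Suc k)\<bar>)"
  proof -
    have "bij_betw Suc UNIV {0<..}"
      by (rule bij_betwI[of _ _ _ "\<lambda>n. n - 1"]) auto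
    hence "(\<lambda>k. \<bar>b (Suc k)\<bar>) summable_on UNIV"
      using summable_on_reindex_bij_betw[of Suc UNIV "{0<..}" "\<lambda>n. \<bar>b n\<bar>"] b by simp
    thus ?thesis by (rule summable_on_imp_summable)
  qed
  have b_sum: "(b has_sum (\<Sum>k. b (Suc k))) {0<..}"
    using bs by (intro sums_Suc_imp_has_sum summable_sums) (auto intro: summable_rabs_cancel)
  have "(\<lambda>x. \<Sum>k. b (Suc k) * T (Suc k) x) \<longlonglongrightarrow> (\<Sum>k. b (Suc k) * (1 / real N))"
  proof (rule tannerys_theorem[THEN conjunct2, THEN conjunct2])
    show "(\<lambda>x. b (Suc k) * T (Suc k) x) \<longlonglongrightarrow> b (Suc k) * (1 / real N)" for k
      by (intro tendsto_mult tendsto_const T_lim) simp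
    show "\<forall>\<^sub>F (k, x) in sequentially \<times>\<^sub>F sequentially. norm (b (Suc k) * T (Suc k) x) \<le> \<bar>b (Suc k)\<bar>"
      using T_le by (intro always_eventually) (auto simp: abs_mult mult_left_le)
  qed (use bs in auto)
  also have "(\<Sum>k. b (Suc k) * (1 / real N)) = (\<Sum>k. b (Suc k)) * (1 / real N)"
    using bs by (intro suminf_mult2[symmetric]) (auto intro: summable_rabs_cancel)
  also have "(\<Sum>k. b (Suc k)) = infsum b {0<..}" using b_sum by (simp add: infsumI)
  finally show ?thesis unfolding suminf_eq by (simp only: mult_1_right times_divide_eq_right)
qed

section \<open>The abscissa of convergence\<close>

lemma cos_ge_half: assumes "\<bar>x::real\<bar> \<le> 1" shows "cos x \<ge> 1 / 2"
proof -
  have "cos (pi / 3) \<le> cos \<bar>x\<bar>"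
    using assms pi_gt3 by (intro cos_monotone_0_pi_le) auto
  thus ?thesis by (simp add: cos_60)
qed

lemma sum_atLeast1_diff:
  fixes f :: "nat \<Rightarrow> 'a::ab_group_add"
  assumes "x \<le> y"
  shows "(\<Sum>n=1..y. f n) - (\<Sum>n=1..x. f n) = (\<Sum>n\<in>{x<..y}. f n)"
proof -
  have "{1..y} = {1..x} \<union> {x<..y}" using assms by auto
  hence "(\<Sum>n=1..y. f n) = (\<Sum>n=1..x. f n) + (\<Sum>n\<in>{x<..y}. f n)"
    by (simp only:) (rule sum.union_disjoint, auto)
  thus ?thesis by simp
qed

text \<open>On a block \<open>{q k<..(q + 1) k}\<close> the argument of \<open>n\<^sup>-\<^sup>s\<close> varies by at most \<open>\<bar>Im s\<bar> / q \<le> 1\<close>, so after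
a common rotation all terms have real part at least half their absolute value. The growth of the
partial sums of \<open>a\<close> therefore keeps the block sums of a series with \<open>Re s < N\<close> away from \<open>0\<close>, in
contradiction to the Cauchy criterion.\<close>
theorem divergence_left_of_growth:
  fixes a :: "nat \<Rightarrow> nat"
  assumes lim: "(\<lambda>x. (\<Sum>n=1..x. real (a n)) / real x ^ N) \<longlonglongrightarrow> K" and K: "K > 0" and N: "N \<ge> 1"
    and summ: "summable (\<lambda>n. of_nat (a (Suc n)) * of_nat (Suc n) powr (-s) :: complex)"
  shows "Re s \<ge> real N"
proof (rule ccontr)
  assume "\<not> Re s \<ge> real N"
  hence less: "Re s < real N" by simp
  define \<sigma> t where "\<sigma> = Re s" and "t = Im s"
  define q where "q = Suc (nat \<lceil>\<bar>t\<bar>\<rceil>)"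
  have q: "real q \<ge> \<bar>t\<bar>" "q > 0" unfolding q_def by linarith+
  define S where "S = (\<lambda>x. \<Sum>n=1..x. real (a n))"
  define u where "u = (\<lambda>n. of_nat (a n) * of_nat n powr (-s) :: complex)"
  \<comment> \<open>The minimum covers both signs of \<sigma>: n powr -\<sigma> is smallest at one of the ends of the block.\<close>
  define C where "C = min (real q powr -\<sigma>) (real (q + 1) powr -\<sigma>)"
  have C: "C > 0" using q by (simp add: C_def)
  have block: "norm (\<Sum>n\<in>{q*k<..(q+1)*k}. u n) \<ge> C * real k powr -\<sigma> / 2 * (S ((q+1)*k) - S (q*k))"
    if k: "k > 0" for k
  proof -
    \<comment> \<open>Multiplication by w rotates the terms of the block into the right half-plane.\<close>
    define w where "w = (of_nat (q*k) powr (\<i> * t) :: complex)"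
    have qk: "q * k > 0" using q k by simp
    have w: "norm w = 1" using qk by (simp add: w_def norm_powr_real_powr)
    have term_ge: "Re (w * u n) \<ge> real (a n) * (C * real k powr -\<sigma> / 2)" if n: "n \<in> {q*k<..(q+1)*k}" for n
    proof -
      have n0: "n > 0" using n by auto
      define \<theta> where "\<theta> = t * (ln (real (q*k)) - ln (real n))"
      have "w * of_nat n powr (-s) = exp (of_real (-\<sigma> * ln (real n)) + \<i> * of_real \<theta>)"
      proof -
        have "Ln (of_nat (q*k)) = of_real (ln (real (q*k)))" "Ln (of_nat n) = of_real (ln (real n))"
          using Ln_of_nat[OF qk] Ln_of_nat[OF n0] .
        hence "w * of_nat n powr (-s) = exp (\<i> * t * of_real (ln (real (q*k))) + (-s) * of_real (ln (real n)))"
          using qk n0 unfolding w_def powr_def exp_add by (simp only: of_nat_eq_0_iff) simp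
        also have "\<i> * t * of_real (ln (real (q*k))) + (-s) * of_real (ln (real n)) =
            of_real (-\<sigma> * ln (real n)) + \<i> * of_real \<theta>"
          by (simp add: complex_eq_iff \<theta>_def \<sigma>_def t_def algebra_simps)
        finally show ?thesis .
      qed
      hence "Re (w * of_nat n powr (-s)) = exp (-\<sigma> * ln (real n)) * cos \<theta>"
        by (simp add: Re_exp)
      hence re: "Re (w * of_nat n powr (-s)) = real n powr -\<sigma> * cos \<theta>"
        using n0 by (simp add: powr_def)
      have "\<bar>ln (real (q*k)) - ln (real n)\<bar> \<le> 1 / real q"
      proof -
        have "ln (real n) - ln (real (q*k)) = ln (real n / real (q*k))" using n0 qk by (subst ln_divide_pos) auto
        also have "\<dots> \<le> real n / real (q*k) - 1" using n0 qk by (intro ln_le_minus_one) auto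
        also have "\<dots> \<le> real ((q+1)*k) / real (q*k) - 1"
        proof (intro diff_right_mono divide_right_mono)
          show "real n \<le> real ((q+1)*k)" using n by (simp only: of_nat_le_iff greaterThanAtMost_iff)
        qed auto
        also have "\<dots> = 1 / real q" using q k by (simp add: field_simps)
        finally have "ln (real n) - ln (real (q*k)) \<le> 1 / real q" .
        moreover have "ln (real (q*k)) \<le> ln (real n)"
        proof (rule ln_mono)
          show "real (q*k) \<le> real n" using n by (simp only: of_nat_le_iff greaterThanAtMost_iff less_imp_le)
        qed (use qk in simp)
        ultimately show ?thesis by simp
      qed
      hence "\<bar>\<theta>\<bar> \<le> \<bar>t\<bar> * (1 / real q)"
        unfolding \<theta>_def abs_mult by (intro mult_left_mono) auto
      also have "\<dots> \<le> 1" using q by simp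
      finally have cos: "cos \<theta> \<ge> 1/2" by (rule cos_ge_half)
      have "C * real k powr -\<sigma> \<le> real n powr -\<sigma>"
      proof (cases "\<sigma> \<ge> 0")
        case True
        have "C * real k powr -\<sigma> \<le> real (q+1) powr -\<sigma> * real k powr -\<sigma>"
          by (intro mult_right_mono) (auto simp: C_def)
        also have "\<dots> = real ((q+1)*k) powr -\<sigma>" by (simp only: powr_mult of_nat_mult)
        also have "\<dots> \<le> real n powr -\<sigma>"
        proof (rule powr_mono2')
          show "real n \<le> real ((q+1)*k)" using n by (simp only: of_nat_le_iff greaterThanAtMost_iff)
        qed (use True n0 in auto)
        finally show ?thesis .
      next
        case False
        have "C * real k powr -\<sigma> \<le> real q powr -\<sigma> * real k powr -\<sigma>"
          by (intro mult_right_mono) (auto simp: C_def)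
        also have "\<dots> = real (q*k) powr -\<sigma>" by (simp only: powr_mult of_nat_mult)
        also have "\<dots> \<le> real n powr -\<sigma>"
        proof (rule powr_mono2)
          show "real (q*k) \<le> real n" using n by (simp only: of_nat_le_iff greaterThanAtMost_iff less_imp_le)
        qed (use False in auto)
        finally show ?thesis .
      qed
      hence "C * real k powr -\<sigma> * (1/2) \<le> real n powr -\<sigma> * cos \<theta>"
        using cos C by (intro mult_mono) auto
      hence "C * real k powr -\<sigma> / 2 \<le> Re (w * of_nat n powr (-s))" using re by simp
      hence "real (a n) * (C * real k powr -\<sigma> / 2) \<le> real (a n) * Re (w * of_nat n powr (-s))"
        by (intro mult_left_mono) auto
      also have "\<dots> = Re (of_real (real (a n)) * (w * of_nat n powr (-s)))"
        by (simp only: times_complex.sel Re_complex_of_real Im_complex_of_real mult_zero_left diff_zero)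
      also have "of_real (real (a n)) * (w * of_nat n powr (-s)) = w * u n"
        by (simp add: u_def mult_ac)
      finally show ?thesis .
    qed
    have "S ((q+1)*k) - S (q*k) = (\<Sum>n\<in>{q*k<..(q+1)*k}. real (a n))"
      unfolding S_def by (rule sum_atLeast1_diff) simp
    hence "C * real k powr -\<sigma> / 2 * (S ((q+1)*k) - S (q*k)) =
        (\<Sum>n\<in>{q*k<..(q+1)*k}. real (a n)) * (C * real k powr -\<sigma> / 2)"
      by (simp only: mult.commute[of "C * real k powr -\<sigma> / 2"])
    also have "\<dots> = (\<Sum>n\<in>{q*k<..(q+1)*k}. real (a n) * (C * real k powr -\<sigma> / 2))"
      by (rule sum_distrib_right)
    also have "\<dots> \<le> (\<Sum>n\<in>{q*k<..(q+1)*k}. Re (w * u n))" by (intro sum_mono term_ge)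
    also have "\<dots> = Re (w * (\<Sum>n\<in>{q*k<..(q+1)*k}. u n))" by (simp add: sum_distrib_left)
    also have "\<dots> \<le> norm (w * (\<Sum>n\<in>{q*k<..(q+1)*k}. u n))" by (rule complex_Re_le_cmod)
    also have "\<dots> = norm (\<Sum>n\<in>{q*k<..(q+1)*k}. u n)" by (simp add: norm_mult w)
    finally show ?thesis .
  qed
  have sub: "filterlim (\<lambda>k. c * k) at_top sequentially" if "c > 0" for c :: nat
    using that by (intro filterlim_at_top_mono[OF filterlim_ident]) (auto intro!: always_eventually)
  have SL: "(\<lambda>k. S (c*k) / real k ^ N) \<longlonglongrightarrow> K * real c ^ N" if "c > 0" for c
  proof -
    have "(\<lambda>k. S (c*k) / real (c*k) ^ N * real c ^ N) \<longlonglongrightarrow> K * real c ^ N"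
      using filterlim_compose[OF lim sub[OF that]] unfolding S_def by (intro tendsto_mult tendsto_const) 
    thus ?thesis
      by (rule Lim_transform_eventually) (use that in \<open>auto intro!: always_eventually simp: power_mult_distrib\<close>)
  qed
  have "(\<lambda>k. S ((q+1)*k) / real k ^ N - S (q*k) / real k ^ N) \<longlonglongrightarrow> K * real (q+1) ^ N - K * real q ^ N"
    by (intro tendsto_diff SL) (use q in auto)
  hence D: "(\<lambda>k. C / 2 * ((S ((q+1)*k) - S (q*k)) / real k ^ N)) \<longlonglongrightarrow> C / 2 * (K * real (q+1) ^ N - K * real q ^ N)"
    by (intro tendsto_mult tendsto_const) (simp add: diff_divide_distrib)
  have "real q ^ N < real (q+1) ^ N" using N by (intro power_strict_mono) auto
  hence L: "C / 2 * (K * real (q+1) ^ N - K * real q ^ N) > 0" using C K by simp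
  have lim0: "(\<lambda>k. norm (\<Sum>n\<in>{q*k<..(q+1)*k}. u n)) \<longlonglongrightarrow> 0"
  proof -
    define V where "V = (\<lambda>x. \<Sum>n<x. u (Suc n))"
    have V: "V \<longlonglongrightarrow> (\<Sum>n. u (Suc n))"
      using summable_LIMSEQ[OF summ] by (simp add: V_def u_def)
    have "(\<lambda>k. V ((q+1)*k) - V (q*k)) \<longlonglongrightarrow> (\<Sum>n. u (Suc n)) - (\<Sum>n. u (Suc n))"
      by (intro tendsto_diff filterlim_compose[OF V] sub) (use q in auto)
    moreover have "V ((q+1)*k) - V (q*k) = (\<Sum>n\<in>{q*k<..(q+1)*k}. u n)" for k
    proof -
      have V': "V x = (\<Sum>n=1..x. u n)" for x
        unfolding V_def by (rule sum.reindex_bij_witness[of _ "\<lambda>e. e - 1" Suc]) auto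
      show ?thesis unfolding V' by (rule sum_atLeast1_diff) simp
    qed
    ultimately show ?thesis by (simp add: tendsto_norm_zero)
  qed
  have ev: "\<forall>\<^sub>F k in sequentially. C / 2 * ((S ((q+1)*k) - S (q*k)) / real k ^ N) \<le> norm (\<Sum>n\<in>{q*k<..(q+1)*k}. u n)"
    using eventually_gt_at_top[of 0]
  proof eventually_elim
    case (elim k)
    have S: "S (q*k) \<le> S ((q+1)*k)" unfolding S_def by (intro sum_mono2) auto
    have "C / 2 * ((S ((q+1)*k) - S (q*k)) / real k ^ N) = C / 2 * (S ((q+1)*k) - S (q*k)) * real k powr -(real N)"
      using elim by (simp add: powr_minus powr_realpow field_simps)
    also have "\<dots> \<le> C / 2 * (S ((q+1)*k) - S (q*k)) * real k powr -\<sigma>"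
      using elim less C S by (intro mult_left_mono powr_mono) (auto simp: \<sigma>_def)
    also have "\<dots> = C * real k powr -\<sigma> / 2 * (S ((q+1)*k) - S (q*k))" by simp
    finally show ?case using block[OF elim] by linarith
  qed
  have "C / 2 * (K * real (q+1) ^ N - K * real q ^ N) \<le> 0"
    by (rule tendsto_le[OF sequentially_bot lim0 D ev])
  thus False using L by simp
qed

theorem abscissa_eq:
  fixes a :: "nat \<Rightarrow> nat"
  assumes "(\<lambda>x. (\<Sum>n=1..x. real (a n)) / real x ^ N) \<longlonglongrightarrow> K" "K > 0" "N \<ge> 1"
    and summ: "\<And>\<sigma>. \<sigma> > real N \<Longrightarrow> summable (\<lambda>n. real (a (Suc n)) * real (Suc n) powr -\<sigma>)"
  shows "abscissa_of_convergence (\<lambda>n. of_nat (a n)) = ereal (real N)"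
  unfolding abscissa_of_convergence_def
proof (rule antisym)
  let ?A = "{s. summable (\<lambda>n. of_nat (a (Suc n)) * of_nat (Suc n) powr (-s) :: complex)}"
  show "ereal (real N) \<le> (INF s\<in>?A. ereal (Re s))"
    by (rule INF_greatest) (use divergence_left_of_growth[OF assms(1-3)] in auto)
  show "(INF s\<in>?A. ereal (Re s)) \<le> ereal (real N)"
  proof (rule ereal_le_epsilon2)
    fix \<epsilon> :: real assume "\<epsilon> > 0"
    define s where "s = complex_of_real (real N + \<epsilon>)"
    have "summable (\<lambda>n. complex_of_real (real (a (Suc n)) * real (Suc n) powr -(real N + \<epsilon>)))"
      unfolding summable_of_real_iff by (rule summ) (use \<open>\<epsilon> > 0\<close> in simp)
    moreover have "complex_of_real (real (a (Suc n)) * real (Suc n) powr -(real N + \<epsilon>)) =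
        of_nat (a (Suc n)) * of_nat (Suc n) powr (-s)" for n
      unfolding s_def by (simp add: powr_of_real[symmetric] del: of_nat_Suc)
    ultimately have "s \<in> ?A" by (simp only: mem_Collect_eq)
    hence "(INF s\<in>?A. ereal (Re s)) \<le> ereal (Re s)" by (rule INF_lower)
    thus "(INF s\<in>?A. ereal (Re s)) \<le> ereal (real N) + ereal \<epsilon>" by (simp add: s_def)
  qed
qed

section \<open>Dirichlet series\<close>

definition abs_summable_at :: "(nat \<Rightarrow> complex) \<Rightarrow> real \<Rightarrow> bool" where
  "abs_summable_at a \<sigma> \<longleftrightarrow> (\<lambda>n. norm (a n) * real n powr -\<sigma>) summable_on {0<..}"

lemma norm_of_nat_powr: "n > 0 \<Longrightarrow> norm (of_nat n powr s :: complex) = real n powr Re s"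
  by (simp add: powr_def Ln_of_nat norm_exp_eq_Re)

lemma of_nat_mult_powr: "(of_nat (a * b) :: complex) powr s = of_nat a powr s * of_nat b powr s"
proof (cases "a = 0 \<or> b = 0")
  case False
  hence pos: "a > 0" "b > 0" "a * b > 0" by auto
  have "ln (real (a * b)) = ln (real a) + ln (real b)" using pos by (simp add: ln_mult)
  hence "Ln (of_nat (a * b)) = Ln (of_nat a) + Ln (of_nat b)"
    unfolding Ln_of_nat[OF pos(1)] Ln_of_nat[OF pos(2)] Ln_of_nat[OF pos(3)] by simp
  thus ?thesis using pos unfolding powr_def by (simp add: exp_add algebra_simps)
qed auto

lemma bij_Suc: "bij_betw Suc UNIV {0<..}"
  by (rule bij_betwI[of _ _ _ "\<lambda>n. n - 1"]) auto

lemma abs_summable_at_iff_norm_summable: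
  "abs_summable_at a (Re s) \<longleftrightarrow> (\<lambda>n. norm (a n * of_nat n powr (-s))) summable_on {0<..}"
  unfolding abs_summable_at_def by (rule summable_on_cong) (simp add: norm_mult norm_of_nat_powr)

lemma abs_summable_at_summable: "abs_summable_at a (Re s) \<Longrightarrow> summable (\<lambda>n. norm (a (Suc n) * of_nat (Suc n) powr (-s)))"
  unfolding abs_summable_at_iff_norm_summable
  using summable_on_reindex_bij_betw[OF bij_Suc, of "\<lambda>n. norm (a n * of_nat n powr (-s))"]
  by (intro summable_on_imp_summable) simp

lemma dirichlet_series_infsum:
  assumes "abs_summable_at a (Re s)"
  shows "dirichlet_series a s = infsum (\<lambda>n. a n * of_nat n powr (-s)) {0<..}"
proof -
  have "((\<lambda>n. a (Suc n) * of_nat (Suc n) powr (-s)) has_sum dirichlet_series a s) UNIV"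
    unfolding dirichlet_series_def
    using abs_summable_at_summable[OF assms] by (intro norm_summable_imp_has_sum summable_sums) (auto dest: summable_norm_cancel)
  thus ?thesis
    using has_sum_reindex_bij_betw[OF bij_Suc, of "\<lambda>n. a n * of_nat n powr (-s)"] by (simp add: infsumI)
qed

lemma dirichlet_series_dirichlet_prod:
  assumes "abs_summable_at a (Re s)" "abs_summable_at b (Re s)"
  shows "abs_summable_at (dirichlet_prod a b) (Re s)"
    and "dirichlet_series (dirichlet_prod a b) s = dirichlet_series a s * dirichlet_series b s"
proof -
  let ?t = "\<lambda>n::nat. of_nat n powr (-s) :: complex"
  have eq: "dirichlet_prod a b n * ?t n = dirichlet_prod (\<lambda>n. a n * ?t n) (\<lambda>n. b n * ?t n) n" if "n \<in> {0<..}" for n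
    using dirichlet_prod_twist[of n ?t a b] that by (simp add: of_nat_mult_powr mult.commute del: of_nat_mult)
  note * = assms[unfolded abs_summable_at_iff_norm_summable]
  show 1: "abs_summable_at (dirichlet_prod a b) (Re s)"
    unfolding abs_summable_at_iff_norm_summable using dirichlet_prod_summable(1)[OF *]
    by (subst summable_on_cong[OF arg_cong[of _ _ norm, OF eq]]) auto
  show "dirichlet_series (dirichlet_prod a b) s = dirichlet_series a s * dirichlet_series b s"
    unfolding dirichlet_series_infsum[OF 1] dirichlet_series_infsum[OF assms(1)] dirichlet_series_infsum[OF assms(2)]
    using dirichlet_prod_summable(2)[OF *] by (subst infsum_cong[OF eq]) auto
qed

lemma powr_shift_of_nat: "n > 0 \<Longrightarrow> of_nat n ^ k * of_nat n powr (-s) = (of_nat n powr (-(s - of_nat k)) :: complex)"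
  by (simp add: powr_diff powr_minus powr_nat' field_simps)

lemma dirichlet_series_shift:
  "dirichlet_series (\<lambda>n. of_nat n ^ k * a n) s = dirichlet_series a (s - of_nat k)"
  unfolding dirichlet_series_def using powr_shift_of_nat[of "Suc _" k s]
  by (intro suminf_cong) (simp add: mult_ac del: of_nat_Suc)

lemma abs_summable_at_shift: "abs_summable_at (\<lambda>n. of_nat n ^ k * a n) \<sigma> \<longleftrightarrow> abs_summable_at a (\<sigma> - real k)"
  unfolding abs_summable_at_def
  by (rule summable_on_cong)
     (simp add: norm_mult norm_power powr_diff powr_minus powr_realpow field_simps)

lemma abs_summable_at_1: "\<sigma> > 1 \<Longrightarrow> abs_summable_at (\<lambda>_. 1) \<sigma>"
  unfolding abs_summable_at_def using powr_summable_on by simp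

lemma holomorphic_on_suminf:
  assumes S: "open S" and f: "\<And>n. f n holomorphic_on S"
    and bnd: "\<And>z. z \<in> S \<Longrightarrow> \<exists>d>0. cball z d \<subseteq> S \<and> (\<exists>M. summable M \<and> (\<forall>n. \<forall>w\<in>cball z d. norm (f n w) \<le> M n))"
  shows "(\<lambda>w. \<Sum>n. f n w) holomorphic_on S"
proof (rule holomorphic_uniform_sequence[OF S])
  show "(\<lambda>w. \<Sum>i<n. f i w) holomorphic_on S" for n
    using f by (intro holomorphic_intros)
  fix z assume "z \<in> S"
  from bnd[OF this] obtain d M where d: "d > 0" "cball z d \<subseteq> S" "summable M"
    "\<And>n w. w \<in> cball z d \<Longrightarrow> norm (f n w) \<le> M n" by blast
  have "uniform_limit (cball z d) (\<lambda>n w. \<Sum>i<n. f i w) (\<lambda>w. \<Sum>n. f n w) sequentially"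
    by (rule Weierstrass_m_test[OF _ d(3)]) (use d(4) in auto)
  thus "\<exists>d>0. cball z d \<subseteq> S \<and> uniform_limit (cball z d) (\<lambda>n w. \<Sum>i<n. f i w) (\<lambda>w. \<Sum>n. f n w) sequentially"
    using d by blast
qed

lemma open_halfplane: "open {s. Re s > c}"
  by (simp add: open_halfspace_Re_gt)

lemma cball_halfplane:
  assumes "Re z > c" obtains d where "d > 0" "\<And>w. w \<in> cball z d \<Longrightarrow> Re w \<ge> c + d"
proof -
  define d where "d = (Re z - c) / 2"
  have "Re w \<ge> c + d" if "w \<in> cball z d" for w
  proof -
    have "Re z - Re w \<le> d"
      using that complex_Re_le_cmod[of "z - w"] by (simp add: dist_norm)
    thus ?thesis by (simp add: d_def field_simps)
  qed
  moreover have "d > 0" using assms by (simp add: d_def)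
  ultimately show ?thesis using that by blast
qed

theorem holomorphic_dirichlet_series:
  assumes "\<And>\<sigma>. \<sigma> > c \<Longrightarrow> abs_summable_at a \<sigma>"
  shows "dirichlet_series a holomorphic_on {s. Re s > c}"
  unfolding dirichlet_series_def[abs_def]
proof (rule holomorphic_on_suminf[OF open_halfplane])
  show "(\<lambda>w. a (Suc n) * of_nat (Suc n) powr (-w)) holomorphic_on {s. Re s > c}" for n
    by (intro holomorphic_intros) (auto simp del: of_nat_Suc)
  fix z assume "z \<in> {s. Re s > c}"
  hence "Re z > c" by simp
  then obtain d where d: "d > 0" "\<And>w. w \<in> cball z d \<Longrightarrow> Re w \<ge> c + d" by (rule cball_halfplane) blast
  define M where "M = (\<lambda>n. norm (a (Suc n) * of_nat (Suc n) powr (-of_real (c + d))))"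
  have "summable M"
    unfolding M_def by (rule abs_summable_at_summable) (use assms d(1) in simp)
  moreover have "norm (a (Suc n) * of_nat (Suc n) powr (-w)) \<le> M n" if "w \<in> cball z d" for n w
    using d(2)[OF that] unfolding M_def norm_mult norm_of_nat_powr[OF zero_less_Suc]
    by (intro mult_left_mono powr_mono) auto
  moreover have "cball z d \<subseteq> {s. Re s > c}" using d by force
  ultimately show "\<exists>d>0. cball z d \<subseteq> {s. Re s > c} \<and>
      (\<exists>M. summable M \<and> (\<forall>n. \<forall>w\<in>cball z d. norm (a (Suc n) * of_nat (Suc n) powr (-w)) \<le> M n))"
    using d(1) by blast
qed

section \<open>Gluing meromorphic functions on half-planes\<close>

lemma meromorphic_eq_near:
  assumes f: "f meromorphic_on {s. Re s > a}" and g: "g meromorphic_on {s. Re s > b}"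
    and eq: "\<And>s. Re s > c \<Longrightarrow> f s = g s" and z: "Re z > a" "Re z > b"
  shows "eventually (\<lambda>w. f w = g w) (at z)"
proof -
  define A where "A = {s. Re s > max a b}"
  have A: "open A" "connected A"
    unfolding A_def by (rule open_halfplane, rule convex_connected[OF convex_halfspace_Re_gt])
  have "(\<lambda>w. f w - g w) meromorphic_on A"
    by (intro meromorphic_intros meromorphic_on_subset[OF f] meromorphic_on_subset[OF g]) (auto simp: A_def)
  hence "eventually (\<lambda>w. f w - g w = 0) (cosparse A) \<or> eventually (\<lambda>w. f w - g w \<noteq> 0) (cosparse A)"
    using A by (rule meromorphic_imp_constant_or_avoid)
  moreover have "\<not> eventually (\<lambda>w. f w - g w \<noteq> 0) (cosparse A)"
  proof
    define z0 where "z0 = complex_of_real (max (max a b) c + 1)"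
    have z0A: "z0 \<in> A" by (simp add: A_def z0_def) linarith
    assume "eventually (\<lambda>w. f w - g w \<noteq> 0) (cosparse A)"
    hence "eventually (\<lambda>w. f w - g w \<noteq> 0) (at z0)"
      using A z0A by (simp add: eventually_cosparse_open_eq)
    moreover have "eventually (\<lambda>w. w \<in> {s. Re s > c} - {z0}) (at z0)"
      by (intro eventually_at_in_open open_halfplane) (simp add: z0_def)
    ultimately have "eventually (\<lambda>w. False) (at z0)"
      by eventually_elim (use eq in auto)
    thus False by simp
  qed
  ultimately have "eventually (\<lambda>w. f w - g w = 0) (at z)"
    using A z by (auto simp: eventually_cosparse_open_eq A_def)
  thus ?thesis by eventually_elim simp
qed

text \<open>The functions agree only outside of isolated points, where a meromorphic function may have been
given any value. Passing to \<open>remove_sings\<close> makes them agree everywhere on common domains.\<close>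
theorem meromorphic_glue:
  fixes f :: "nat \<Rightarrow> complex \<Rightarrow> complex" and r :: "nat \<Rightarrow> real"
  assumes f: "\<And>n. f n meromorphic_on {s. Re s > r n}"
    and eq: "\<And>n s. Re s > c \<Longrightarrow> f n s = h s"
  shows "\<exists>g. g meromorphic_on (\<Union>n. {s. Re s > r n}) \<and> (\<forall>n s. Re s > r n \<longrightarrow> g s = remove_sings (f n) s)"
proof -
  define g where "g = (\<lambda>s. remove_sings (f (LEAST n. Re s > r n)) s)"
  have g: "g s = remove_sings (f n) s" if "Re s > r n" for n s
  proof -
    have "Re s > r (LEAST n. Re s > r n)" using that by (rule LeastI)
    from meromorphic_eq_near[OF f f _ this that, of c]
    have "eventually (\<lambda>w. f (LEAST n. Re s > r n) w = f n w) (at s)" using eq by metis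
    thus ?thesis unfolding g_def by (rule remove_sings_cong) simp
  qed
  have "g meromorphic_on {s. Re s > r n}" for n
  proof -
    have "g meromorphic_on {s. Re s > r n} \<longleftrightarrow> remove_sings (f n) meromorphic_on {s. Re s > r n}"
    proof (rule meromorphic_on_cong)
      fix z assume "z \<in> {s. Re s > r n}"
      hence "eventually (\<lambda>w. w \<in> {s. Re s > r n} - {z}) (at z)"
        by (intro eventually_at_in_open open_halfplane)
      thus "eventually (\<lambda>w. g w = remove_sings (f n) w) (at z)"
        by eventually_elim (use g in auto)
    qed simp
    thus ?thesis using f remove_sings_meromorphic by blast
  qed
  hence "g meromorphic_on (\<Union>n. {s. Re s > r n})" by (intro meromorphic_on_UN)
  thus ?thesis using g by blast
qed

section \<open>Continuation of the zeta function\<close>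

lemma norm_gchoose_fact_le:
  fixes a :: complex
  assumes "norm a \<le> A" shows "norm ((a gchoose k) * fact k) \<le> (A + real k) ^ k"
proof -
  have "(a gchoose k) * fact k = (\<Prod>i=0..<k. a - of_nat i)"
    by (simp add: gbinomial_prod_rev mult.commute)
  also have "norm \<dots> = (\<Prod>i=0..<k. norm (a - of_nat i))" by (simp add: prod_norm)
  also have "\<dots> \<le> (\<Prod>i=0..<k. A + real k)"
  proof (rule prod_mono)
    fix i assume "i \<in> {0..<k}"
    hence "norm (a - of_nat i) \<le> A + real k"
      using norm_triangle_ineq4[of a "of_nat i"] assms by simp
    thus "0 \<le> norm (a - of_nat i) \<and> norm (a - of_nat i) \<le> A + real k" by simp
  qed
  finally show ?thesis by simp
qed

text \<open>Taylor's theorem on \<open>[0, 1]\<close> for \<open>(1 + t)\<^sup>a\<close>. What matters is that the constant is uniform for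
bounded \<open>a\<close>.\<close>
lemma binomial_remainder_bound:
  assumes "A \<ge> 0"
  shows "\<exists>M. \<forall>a t. norm a \<le> A \<longrightarrow> 0 \<le> t \<longrightarrow> t \<le> 1 \<longrightarrow>
    norm ((1 + complex_of_real t) powr a - (\<Sum>k\<le>m. (a gchoose k) * of_real t ^ k)) \<le> M * t ^ Suc m"
proof -
  define M where "M = (A + real (Suc m)) ^ Suc m * 2 powr (A + real (Suc m))"
  have "norm ((1 + complex_of_real t) powr a - (\<Sum>k\<le>m. (a gchoose k) * of_real t ^ k)) \<le> M * t ^ Suc m"
    if a: "norm a \<le> A" and t: "0 \<le> t" "t \<le> 1" for a t
  proof -
    define S where "S = closed_segment (0::complex) 1"
    have S: "x \<in> S \<longleftrightarrow> (\<exists>u. x = of_real u \<and> 0 \<le> u \<and> u \<le> 1)" for x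
      by (auto simp: S_def closed_segment_def scaleR_conv_of_real)
    define f where "f = (\<lambda>i (x::complex). (a gchoose i) * fact i * (1 + x) powr (a - of_nat i))"
    have "norm (f 0 (of_real t) - (\<Sum>i\<le>m. f i 0 * (of_real t - 0) ^ i / fact i)) \<le> M * norm (of_real t - (0::complex)) ^ Suc m / fact m"
    proof (rule complex_Taylor[of S])
      show "convex S" by (simp add: S_def)
      show "0 \<in> S" "of_real t \<in> S" using t by (auto simp: S)
      show "(f i has_field_derivative f (Suc i) x) (at x within S)" if xS: "x \<in> S" for i x
      proof -
        obtain u where u: "x = of_real u" "0 \<le> u" using iffD1[OF S xS] by blast
        have "1 + x \<notin> \<real>\<^sub>\<le>\<^sub>0" using u by (auto simp: complex_nonpos_Reals_iff)
        hence "(f i has_field_derivative (a gchoose i) * fact i * ((a - of_nat i) * (1 + x) powr (a - of_nat i - 1))) (at x)"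
          unfolding f_def by (auto intro!: derivative_eq_intros)
        also have "(a gchoose i) * fact i * ((a - of_nat i) * (1 + x) powr (a - of_nat i - 1)) = f (Suc i) x"
        proof -
          have "(a gchoose Suc i) * fact (Suc i) = (a gchoose i) * fact i * (a - of_nat i)"
            by (simp only: gbinomial_mult_fact' prod.atLeast0_lessThan_Suc)
          moreover have "a - of_nat i - 1 = a - of_nat (Suc i)" by simp
          ultimately show ?thesis unfolding f_def by (simp only: mult.assoc)
        qed
        finally show ?thesis by (rule has_field_derivative_at_within)
      qed
      show "norm (f (Suc m) x) \<le> M" if xS: "x \<in> S" for x
      proof -
        obtain u where u: "x = of_real u" "0 \<le> u" "u \<le> 1" using iffD1[OF S xS] by blast
        have "norm ((1 + x) powr (a - of_nat (Suc m))) = (1 + u) powr Re (a - of_nat (Suc m))"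
        proof -
          have "1 + x = of_real (1 + u)" using u by simp
          moreover have "norm (complex_of_real (1 + u) powr (a - of_nat (Suc m))) = (1 + u) powr Re (a - of_nat (Suc m))"
            using u(2) norm_powr_real_powr[of "of_real (1 + u)" "a - of_nat (Suc m)"]
            unfolding Re_complex_of_real by simp
          ultimately show ?thesis by metis
        qed
        also have "\<dots> \<le> (1 + u) powr (A + real (Suc m))"
          using u a abs_Re_le_cmod[of a] by (intro powr_mono) auto
        also have "\<dots> \<le> 2 powr (A + real (Suc m))"
          using u assms by (intro powr_mono2) auto
        finally show ?thesis
          unfolding f_def M_def norm_mult using norm_gchoose_fact_le[OF a, of "Suc m"] assms
          by (intro mult_mono) (auto simp: norm_mult)
      qed
    qed
    also have "\<dots> = M * t ^ Suc m / fact m" using t by simp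
    also have "\<dots> \<le> M * t ^ Suc m"
    proof -
      have "M * t ^ Suc m \<ge> 0" using assms t by (simp add: M_def)
      moreover have "(fact m :: real) \<ge> 1" by (rule fact_ge_1)
      ultimately show ?thesis using frac_le[of "M * t ^ Suc m" "M * t ^ Suc m" 1 "fact m"] by simp
    qed
    also have "f 0 (of_real t) = (1 + of_real t) powr a" by (simp add: f_def)
    also have "(\<Sum>i\<le>m. f i 0 * (of_real t - 0) ^ i / fact i) = (\<Sum>k\<le>m. (a gchoose k) * of_real t ^ k)"
      by (simp add: f_def)
    finally show ?thesis .
  qed
  thus ?thesis by blast
qed


text \<open>The error of the binomial expansion of \<open>(n + 1)\<^sup>1\<^sup>-\<^sup>s = n\<^sup>1\<^sup>-\<^sup>s (1 + 1/n)\<^sup>1\<^sup>-\<^sup>s\<close> after the term of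
order \<open>K + 1\<close>, with the index shifted so that it starts at \<open>0\<close>.\<close>
definition zeta_remainder_term :: "nat \<Rightarrow> complex \<Rightarrow> nat \<Rightarrow> complex" where
  "zeta_remainder_term K s n = of_nat (Suc (Suc n)) powr (1 - s) -
     (\<Sum>k\<le>Suc K. ((1 - s) gchoose k) * of_nat (Suc n) powr (1 - s - of_nat k))"

definition zeta_remainder :: "nat \<Rightarrow> complex \<Rightarrow> complex" where
  "zeta_remainder K s = (\<Sum>n. zeta_remainder_term K s n)"

lemma zeta_remainder_term_bound:
  assumes "A \<ge> 0"
  shows "\<exists>M\<ge>0. \<forall>s n. norm (1 - s) \<le> A \<longrightarrow>
    norm (zeta_remainder_term K s n) \<le> M * real (Suc n) powr (-(Re s + real K + 1))"
proof -
  obtain M where M: "\<And>a t. norm a \<le> A \<Longrightarrow> 0 \<le> t \<Longrightarrow> t \<le> 1 \<Longrightarrow>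
      norm ((1 + complex_of_real t) powr a - (\<Sum>k\<le>Suc K. (a gchoose k) * of_real t ^ k)) \<le> M * t ^ Suc (Suc K)"
    using binomial_remainder_bound[OF assms] by blast
  have "norm (zeta_remainder_term K s n) \<le> \<bar>M\<bar> * real (Suc n) powr (-(Re s + real K + 1))"
    if s: "norm (1 - s) \<le> A" for s n
  proof -
    define u where "u = real (Suc n)"
    have u: "u > 0" "u \<ge> 1" by (auto simp: u_def)
    define t where "t = 1 / u"
    have t: "0 \<le> t" "t \<le> 1" "t > 0" using u by (auto simp: t_def)
    have 1: "of_nat (Suc (Suc n)) powr (1 - s) = of_real u powr (1 - s) * (1 + complex_of_real t) powr (1 - s)"
    proof -
      have "u * (1 + t) = real (Suc (Suc n))"
        using u unfolding t_def by (simp add: distrib_left) (simp add: u_def)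
      hence "(of_nat (Suc (Suc n)) :: complex) = of_real (u * (1 + t))"
        by (simp only: of_real_of_nat_eq)
      also have "\<dots> = of_real u * (1 + of_real t)" by simp
      finally show ?thesis
        using powr_times_real[of "of_real u" "1 + of_real t" "1 - s"] u t by simp
    qed
    have 2: "of_nat (Suc n) powr (1 - s - of_nat k) = of_real u powr (1 - s) * complex_of_real t ^ k" for k
    proof -
      have "(of_nat (Suc n) :: complex) = of_real u" by (simp add: u_def)
      moreover have "complex_of_real u powr (of_nat k) = of_real u ^ k"
        using u by (intro powr_nat') auto
      ultimately show ?thesis using u
        by (simp add: powr_diff t_def power_divide divide_inverse power_inverse)
    qed
    have "zeta_remainder_term K s n = of_real u powr (1 - s) *
        ((1 + complex_of_real t) powr (1 - s) - (\<Sum>k\<le>Suc K. ((1 - s) gchoose k) * of_real t ^ k))"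
      unfolding zeta_remainder_term_def 1 2 right_diff_distrib sum_distrib_left by (simp add: mult_ac)
    also have "norm \<dots> \<le> u powr (1 - Re s) * (\<bar>M\<bar> * t ^ Suc (Suc K))"
      unfolding norm_mult
    proof (rule mult_mono)
      show "norm (complex_of_real u powr (1 - s)) \<le> u powr (1 - Re s)"
        using u by (simp add: norm_powr_real_powr)
      have "M * t ^ Suc (Suc K) \<le> \<bar>M\<bar> * t ^ Suc (Suc K)" using t by (intro mult_right_mono) auto
      thus "norm ((1 + complex_of_real t) powr (1 - s) - (\<Sum>k\<le>Suc K. ((1 - s) gchoose k) * of_real t ^ k)) \<le> \<bar>M\<bar> * t ^ Suc (Suc K)"
        using M[OF s t(1,2)] by linarith
    qed auto
    also have "t ^ Suc (Suc K) = u powr (-(real (Suc (Suc K))))"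
      unfolding t_def using u by (simp add: powr_minus powr_realpow power_divide divide_inverse power_inverse del: power_Suc of_nat_Suc)
    also have "u powr (1 - Re s) * (\<bar>M\<bar> * u powr (-(real (Suc (Suc K))))) = \<bar>M\<bar> * (u powr (1 - Re s) * u powr (-(real (Suc (Suc K)))))"
      by simp
    also have "u powr (1 - Re s) * u powr (-(real (Suc (Suc K)))) = u powr (-(Re s + real K + 1))"
      unfolding powr_add[symmetric] by (simp add: algebra_simps)
    finally show ?thesis by (simp add: u_def)
  qed
  thus ?thesis by (intro exI[of _ "\<bar>M\<bar>"]) auto
qed

lemma holomorphic_gbinomial [holomorphic_intros]:
  assumes "f holomorphic_on S" shows "(\<lambda>s. f s gchoose k) holomorphic_on S"
  unfolding gbinomial_prod_rev using assms by (intro holomorphic_intros) auto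

lemma summable_powr_Suc: "\<sigma> > 1 \<Longrightarrow> summable (\<lambda>n. real (Suc n) powr -\<sigma>)"
  using summable_real_powr_iff[of "-\<sigma>"] summable_Suc_iff[of "\<lambda>n. real n powr -\<sigma>"] by simp

lemma zeta_remainder_holomorphic: "zeta_remainder K holomorphic_on {s. Re s > - real K}"
  unfolding zeta_remainder_def[abs_def]
proof (rule holomorphic_on_suminf[OF open_halfplane])
  show "(\<lambda>w. zeta_remainder_term K w n) holomorphic_on {s. Re s > - real K}" for n
    unfolding zeta_remainder_term_def by (intro holomorphic_intros) (auto simp del: of_nat_Suc)
  fix z assume "z \<in> {s. Re s > - real K}"
  hence "Re z > - real K" by simp
  then obtain d where d: "d > 0" "\<And>w. w \<in> cball z d \<Longrightarrow> Re w \<ge> - real K + d" by (rule cball_halfplane) blast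
  have "norm (1 - z) + d \<ge> 0" using d by simp
  from zeta_remainder_term_bound[OF this, of K] obtain M where M: "M \<ge> 0"
    "\<And>s n. norm (1 - s) \<le> norm (1 - z) + d \<Longrightarrow> norm (zeta_remainder_term K s n) \<le> M * real (Suc n) powr (-(Re s + real K + 1))"
    by blast
  have "summable (\<lambda>n. M * real (Suc n) powr (-(1 + d)))"
    by (intro summable_mult summable_powr_Suc) (use d in auto)
  moreover have "norm (zeta_remainder_term K w n) \<le> M * real (Suc n) powr (-(1 + d))" if w: "w \<in> cball z d" for w n
  proof -
    have "norm (1 - w) \<le> norm (1 - z) + norm (z - w)"
      using norm_triangle_ineq[of "1 - z" "z - w"] by simp
    also have "\<dots> \<le> norm (1 - z) + d" using w by (simp add: dist_norm)
    finally have "norm (zeta_remainder_term K w n) \<le> M * real (Suc n) powr (-(Re w + real K + 1))" by (rule M(2))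
    also have "\<dots> \<le> M * real (Suc n) powr (-(1 + d))"
      using d(2)[OF w] M(1) by (intro mult_left_mono powr_mono) auto
    finally show ?thesis .
  qed
  moreover have "cball z d \<subseteq> {s. Re s > - real K}" using d by force
  ultimately show "\<exists>d>0. cball z d \<subseteq> {s. Re s > - real K} \<and>
      (\<exists>M. summable M \<and> (\<forall>n. \<forall>w\<in>cball z d. norm (zeta_remainder_term K w n) \<le> M n))"
    using d(1) by blast
qed

lemma dirichlet_one_sums:
  assumes "Re s > 1"
  shows "(\<lambda>n. of_nat (Suc n) powr (-s)) sums dirichlet_series (\<lambda>_. 1) s"
proof -
  have "summable (\<lambda>n. 1 * of_nat (Suc n) powr (-s) :: complex)"
    using abs_summable_at_summable[OF abs_summable_at_1[OF assms]] by (rule summable_norm_cancel)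
  from summable_sums[OF this] show ?thesis unfolding dirichlet_series_def by simp
qed

text \<open>Sum the binomial expansion of \<open>(n + 1)\<^sup>1\<^sup>-\<^sup>s - n\<^sup>1\<^sup>-\<^sup>s\<close> over all \<open>n\<close>: the left side telescopes to
\<open>-1\<close> and the term of order \<open>k\<close> on the right gives \<open>\<zeta>(s + k - 1)\<close>.\<close>
lemma zeta_recursion:
  assumes s: "Re s > 1"
  shows "(s - 1) * dirichlet_series (\<lambda>_. 1) s =
     1 + (\<Sum>k=2..Suc K. ((1 - s) gchoose k) * dirichlet_series (\<lambda>_. 1) (s + of_nat k - 1)) + zeta_remainder K s"
proof -
  let ?z = "dirichlet_series (\<lambda>_. 1)"
  have "(\<lambda>n. of_nat (Suc n) powr (1 - s) :: complex) \<longlonglongrightarrow> 0"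
  proof (rule tendsto_norm_zero_cancel)
    have "(\<lambda>n. real (Suc n) powr (1 - Re s)) \<longlonglongrightarrow> 0"
    proof (rule tendsto_neg_powr)
      show "filterlim (\<lambda>n. real (Suc n)) at_top sequentially"
        by (rule filterlim_compose[OF filterlim_real_sequentially filterlim_Suc])
    qed (use s in simp)
    thus "(\<lambda>n. norm (of_nat (Suc n) powr (1 - s) :: complex)) \<longlonglongrightarrow> 0"
      unfolding norm_of_nat_powr[OF zero_less_Suc] by simp
  qed
  from telescope_sums[OF this]
  have 1: "(\<lambda>n. of_nat (Suc (Suc n)) powr (1 - s) - of_nat (Suc n) powr (1 - s)) sums (-1 :: complex)" by simp
  have 2: "(\<lambda>n. \<Sum>k=1..Suc K. ((1 - s) gchoose k) * of_nat (Suc n) powr (1 - s - of_nat k)) sums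
        (\<Sum>k=1..Suc K. ((1 - s) gchoose k) * ?z (s + of_nat k - 1))"
  proof (intro sums_sum sums_mult)
    fix k assume "k \<in> {1..Suc K}"
    hence "Re (s + of_nat k - 1) > 1" using s by simp
    from dirichlet_one_sums[OF this]
    show "(\<lambda>n. of_nat (Suc n) powr (1 - s - of_nat k)) sums ?z (s + of_nat k - 1)"
      by (simp add: algebra_simps)
  qed
  have split: "(\<Sum>k\<le>Suc K. f k) = f 0 + (\<Sum>k=1..Suc K. f k)" for f :: "nat \<Rightarrow> complex"
  proof -
    have "{..Suc K} = insert 0 {1..Suc K}" by auto
    thus ?thesis by simp
  qed
  have "(\<lambda>n. zeta_remainder_term K s n) sums (-1 - (\<Sum>k=1..Suc K. ((1 - s) gchoose k) * ?z (s + of_nat k - 1)))"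
    using sums_diff[OF 1 2] unfolding zeta_remainder_term_def split by (simp add: diff_diff_eq)
  hence "zeta_remainder K s = -1 - (\<Sum>k=1..Suc K. ((1 - s) gchoose k) * ?z (s + of_nat k - 1))"
    unfolding zeta_remainder_def by (rule sums_unique[symmetric])
  also have "(\<Sum>k=1..Suc K. ((1 - s) gchoose k) * ?z (s + of_nat k - 1)) =
      (1 - s) * ?z s + (\<Sum>k=2..Suc K. ((1 - s) gchoose k) * ?z (s + of_nat k - 1))"
  proof -
    have "{1..Suc K} = insert 1 {2..Suc K}" by auto
    thus ?thesis by simp
  qed
  finally show ?thesis by (simp add: algebra_simps)
qed

text \<open>The recursion expresses \<open>\<zeta>(s)\<close> through values of \<open>\<zeta>\<close> at least \<open>1\<close> further to the right and a
remainder that is holomorphic for \<open>Re s > -K\<close>, so each step gains a strip of width \<open>1\<close>.\<close>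
lemma zeta_continuation_halfplane:
  "\<exists>Z. Z meromorphic_on {s. Re s > 1 - real K} \<and> (\<forall>s. Re s > 1 \<longrightarrow> Z s = dirichlet_series (\<lambda>_. 1) s)"
proof (induction K)
  case 0
  have "dirichlet_series (\<lambda>_. 1) holomorphic_on {s. Re s > 1}"
    by (rule holomorphic_dirichlet_series) (rule abs_summable_at_1)
  hence "dirichlet_series (\<lambda>_. 1) meromorphic_on {s. Re s > 1}"
    by (intro analytic_on_imp_meromorphic_on) (simp add: analytic_on_open open_halfplane)
  thus ?case by (intro exI[of _ "dirichlet_series (\<lambda>_. 1)"]) simp
next
  case (Suc K)
  then obtain Z where Z: "Z meromorphic_on {s. Re s > 1 - real K}"
    "\<And>s. Re s > 1 \<Longrightarrow> Z s = dirichlet_series (\<lambda>_. 1) s" by blast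
  define Z' where "Z' = (\<lambda>s. (1 + (\<Sum>k=2..Suc K. ((1 - s) gchoose k) * Z (s + of_nat k - 1)) + zeta_remainder K s) / (s - 1))"
  let ?A = "{s. Re s > 1 - real (Suc K)}"
  have "Z' meromorphic_on ?A"
    unfolding Z'_def
  proof (intro meromorphic_intros)
    fix k assume k: "k \<in> {2..Suc K}"
    show "(\<lambda>s. (1 - s) gchoose k) meromorphic_on ?A"
      by (intro analytic_on_imp_meromorphic_on) (simp add: analytic_on_open open_halfplane holomorphic_intros)
    show "(\<lambda>s. Z (s + of_nat k - 1)) meromorphic_on ?A"
      by (rule meromorphic_on_compose[OF Z(1)]) (use k in \<open>auto intro!: analytic_intros\<close>)
  next
    show "zeta_remainder K meromorphic_on ?A"
      using zeta_remainder_holomorphic[of K]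
      by (intro analytic_on_imp_meromorphic_on) (simp add: analytic_on_open open_halfplane)
  qed
  moreover have "Z' s = dirichlet_series (\<lambda>_. 1) s" if s: "Re s > 1" for s
  proof -
    have "(\<Sum>k=2..Suc K. ((1 - s) gchoose k) * Z (s + of_nat k - 1)) =
          (\<Sum>k=2..Suc K. ((1 - s) gchoose k) * dirichlet_series (\<lambda>_. 1) (s + of_nat k - 1))"
      using s Z(2) by (intro sum.cong) auto
    hence "Z' s = (s - 1) * dirichlet_series (\<lambda>_. 1) s / (s - 1)"
      unfolding Z'_def zeta_recursion[OF s, of K] by simp
    thus ?thesis using s by auto
  qed
  ultimately show ?case by blast
qed

text \<open>The case \<open>K = 0\<close> of the recursion, \<open>\<zeta>(s) = G(s) / (s - 1)\<close>, is kept as first member of the glued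
family because it describes the pole.\<close>
theorem zeta_continuation:
  "\<exists>Z. Z meromorphic_on UNIV \<and> (\<forall>s. Re s > 1 \<longrightarrow> Z s = dirichlet_series (\<lambda>_. 1) s) \<and>
     (\<exists>G. G holomorphic_on {s. Re s > 0} \<and> G 1 = 1 \<and> (\<forall>s. Re s > 0 \<longrightarrow> s \<noteq> 1 \<longrightarrow> Z s = G s / (s - 1)))"
proof -
  define G where "G = (\<lambda>s. 1 + zeta_remainder 0 s)"
  have G: "G holomorphic_on {s. Re s > 0}"
    unfolding G_def using zeta_remainder_holomorphic[of 0] by (intro holomorphic_intros) simp
  have "zeta_remainder_term 0 1 n = 0" for n
    by (simp add: zeta_remainder_term_def del: of_nat_Suc)
  hence "zeta_remainder_term 0 1 = (\<lambda>_. 0)" by (intro ext)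
  hence G1: "G 1 = 1" by (simp add: G_def zeta_remainder_def)
  have "\<forall>K. \<exists>Z. Z meromorphic_on {s. Re s > 1 - real K} \<and> (\<forall>s. Re s > 1 \<longrightarrow> Z s = dirichlet_series (\<lambda>_. 1) s)"
    using zeta_continuation_halfplane by blast
  then obtain Z where Z: "\<And>K. Z K meromorphic_on {s. Re s > 1 - real K}"
    "\<And>K s. Re s > 1 \<Longrightarrow> Z K s = dirichlet_series (\<lambda>_. 1) s" by metis
  define f where "f = (\<lambda>n. if n = 0 then (\<lambda>s. G s / (s - 1)) else Z (Suc n))"
  have an0: "f 0 analytic_on {s. Re s > 0} - {1}"
    unfolding f_def using G
    by (auto intro!: analytic_intros intro: analytic_on_subset simp: analytic_on_open[OF open_halfplane, symmetric])
  have f: "f n meromorphic_on {s. Re s > - real n}" for n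
  proof (cases "n = 0")
    case True
    have "G meromorphic_on {s. Re s > 0}"
      using G by (intro analytic_on_imp_meromorphic_on) (simp add: analytic_on_open open_halfplane)
    thus ?thesis using True unfolding f_def by (auto intro!: meromorphic_intros)
  next
    case False
    thus ?thesis using Z(1)[of "Suc n"] by (simp add: f_def)
  qed
  have eq: "f n s = dirichlet_series (\<lambda>_. 1) s" if s: "Re s > 1" for n s
  proof (cases "n = 0")
    case True
    have "f 0 s = (s - 1) * dirichlet_series (\<lambda>_. 1) s / (s - 1)"
      unfolding f_def zeta_recursion[OF s, of 0] by (simp add: G_def)
    thus ?thesis using s True by auto
  qed (use s Z(2) in \<open>auto simp: f_def\<close>)
  from meromorphic_glue[of f "\<lambda>n. - real n", OF f eq]
  obtain g where g: "g meromorphic_on (\<Union>n. {s. Re s > - real n})"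
    "\<And>n s. Re s > - real n \<Longrightarrow> g s = remove_sings (f n) s" by blast
  have "(\<Union>n. {s. Re s > - real n}) = UNIV"
  proof (intro equalityI subsetI)
    fix s :: complex
    obtain n :: nat where "real n > - Re s" using reals_Archimedean2 by blast
    thus "s \<in> (\<Union>n. {s. Re s > - real n})" by (auto intro!: exI[of _ n])
  qed auto
  hence g1: "g meromorphic_on UNIV" using g(1) by simp
  have g0: "g s = f 0 s" if "Re s > 0" "s \<noteq> 1" for s
  proof -
    have "f 0 analytic_on {s}" by (rule analytic_on_subset[OF an0]) (use that in auto)
    thus ?thesis using g(2)[of 0 s] that by simp
  qed
  show ?thesis
  proof (rule exI[of _ g], intro conjI exI[of _ G] G G1 g1 allI impI)
    fix s :: complex assume s: "Re s > 1"
    hence "s \<noteq> 1" by auto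
    thus "g s = dirichlet_series (\<lambda>_. 1) s" using g0[of s] eq[OF s, of 0] s by simp
  next
    fix s :: complex assume "Re s > 0" "s \<noteq> 1"
    thus "g s = G s / (s - 1)" using g0 by (simp add: f_def)
  qed
qed

definition zeta :: "complex \<Rightarrow> complex" where
  "zeta = (SOME Z. Z meromorphic_on UNIV \<and> (\<forall>s. Re s > 1 \<longrightarrow> Z s = dirichlet_series (\<lambda>_. 1) s) \<and>
     (\<exists>G. G holomorphic_on {s. Re s > 0} \<and> G 1 = 1 \<and> (\<forall>s. Re s > 0 \<longrightarrow> s \<noteq> 1 \<longrightarrow> Z s = G s / (s - 1))))"

lemma zeta_meromorphic: "zeta meromorphic_on UNIV"
  and zeta_eq: "Re s > 1 \<Longrightarrow> zeta s = dirichlet_series (\<lambda>_. 1) s"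
  and zeta_pole: "\<exists>G. G holomorphic_on {s. Re s > 0} \<and> G 1 = 1 \<and> (\<forall>s. Re s > 0 \<longrightarrow> s \<noteq> 1 \<longrightarrow> zeta s = G s / (s - 1))"
  using someI_ex[OF zeta_continuation, folded zeta_def] by blast+

lemma zeta_analytic: "zeta analytic_on {s. Re s > 0} - {1}"
proof -
  obtain G where G: "G holomorphic_on {s. Re s > 0}" "\<And>s. Re s > 0 \<Longrightarrow> s \<noteq> 1 \<Longrightarrow> zeta s = G s / (s - 1)"
    using zeta_pole by blast
  have o: "open ({s. Re s > 0} - {1::complex})" by (intro open_Diff open_halfplane) auto
  have "(\<lambda>s. G s / (s - 1)) holomorphic_on {s. Re s > 0} - {1}"
    by (intro holomorphic_intros holomorphic_on_subset[OF G(1)]) auto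
  hence "zeta holomorphic_on {s. Re s > 0} - {1}"
    by (rule holomorphic_transform) (use G(2) in auto)
  thus ?thesis by (simp add: analytic_on_open[OF o])
qed

lemma meromorphic_zeta_affine [meromorphic_intros]: "(\<lambda>s. zeta (a * s + b)) meromorphic_on A"
  by (rule meromorphic_on_compose[OF zeta_meromorphic]) (auto intro!: analytic_intros)

text \<open>\<open>\<bar>\<zeta>(s) - 1\<bar> \<le> \<zeta>(2) - 1 < 1\<close>.\<close>
lemma zeta_nonzero:
  assumes s: "Re s \<ge> 2" shows "zeta s \<noteq> 0"
proof -
  let ?f = "\<lambda>n::nat. of_nat n powr (-s) :: complex"
  have d: "abs_summable_at (\<lambda>_. 1) (Re s)" using s by (intro abs_summable_at_1) simp
  have z: "zeta s = infsum ?f {0<..}" using dirichlet_series_infsum[OF d] zeta_eq[of s] s by simp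
  have ns: "(\<lambda>n. norm (?f n)) summable_on {0<..}" using d unfolding abs_summable_at_iff_norm_summable by simp
  have eq: "{0<..} = {1::nat} \<union> {1<..}" by auto
  have ns1: "(\<lambda>n. norm (?f n)) summable_on {1<..}" by (rule summable_on_subset_banach[OF ns]) auto
  have "infsum ?f {0<..} = infsum ?f {1} + infsum ?f {1<..}"
    unfolding eq by (rule infsum_Un_disjoint) (use abs_summable_summable[OF ns1] in auto)
  hence 1: "infsum ?f {0<..} = 1 + infsum ?f {1<..}" by simp
  have "infsum (\<lambda>n. norm (?f n)) {0<..} = infsum (\<lambda>n. norm (?f n)) {1} + infsum (\<lambda>n. norm (?f n)) {1<..}"
    unfolding eq by (rule infsum_Un_disjoint) (use ns1 in auto)
  hence 2: "infsum (\<lambda>n. norm (?f n)) {0<..} = 1 + infsum (\<lambda>n. norm (?f n)) {1<..}" by simp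
  have "infsum (\<lambda>n. norm (?f n)) {0<..} = infsum (\<lambda>n. real n powr - Re s) {0<..}"
    by (intro infsum_cong) (simp add: norm_of_nat_powr)
  hence 3: "infsum (\<lambda>n. norm (?f n)) {0<..} < 2" using infsum_powr_less_2[OF s] by simp
  have "norm (infsum ?f {1<..}) \<le> infsum (\<lambda>n. norm (?f n)) {1<..}" by (rule norm_infsum_bound[OF ns1])
  hence "norm (infsum ?f {1<..}) < 1" using 2 3 by linarith
  moreover have "norm (infsum ?f {1<..}) = 1" if "1 + infsum ?f {1<..} = 0"
    using that by (metis add.inverse_inverse add_eq_0_iff norm_minus_cancel norm_one)
  ultimately show ?thesis unfolding z 1 by auto
qed

section \<open>Euler products\<close>

definition multiplicative :: "(nat \<Rightarrow> 'a::comm_semiring_1) \<Rightarrow> bool" where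
  "multiplicative f \<longleftrightarrow> f 1 = 1 \<and> (\<forall>m n. m > 0 \<longrightarrow> n > 0 \<longrightarrow> coprime m n \<longrightarrow> f (m * n) = f m * f n)"

lemma gcd_coprime_factor:
  fixes a b m n :: nat
  assumes "coprime m n" "a dvd m" "b dvd n" shows "gcd (a * b) m = a"
proof (rule dvd_antisym)
  have "coprime b m" using assms coprime_divisors[of b n m m] by (simp add: coprime_commute)
  hence "coprime (gcd (a * b) m) b" using coprime_divisors[of "gcd (a * b) m" m b b] by (simp add: coprime_commute)
  thus "gcd (a * b) m dvd a" using coprime_dvd_mult_left_iff gcd_dvd1 by blast
  show "a dvd gcd (a * b) m" using assms by simp
qed

text \<open>The divisors of \<open>m n\<close> are the products of a divisor of \<open>m\<close> and a divisor of \<open>n\<close>, uniquely so for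
coprime \<open>m\<close> and \<open>n\<close>.\<close>
lemma multiplicative_dirichlet_prod:
  assumes f: "multiplicative f" and g: "multiplicative g"
  shows "multiplicative (dirichlet_prod f g)"
proof -
  have "dirichlet_prod f g (m * n) = dirichlet_prod f g m * dirichlet_prod f g n" if mn: "m > 0" "n > 0" "coprime m n" for m n
  proof -
    have "dirichlet_prod f g m * dirichlet_prod f g n = (\<Sum>(a, b)\<in>{a. a dvd m} \<times> {b. b dvd n}. (f a * g (m div a)) * (f b * g (n div b)))"
      by (simp add: dirichlet_prod_def sum_product sum.cartesian_product)
    also have "\<dots> = (\<Sum>d | d dvd m * n. f d * g (m * n div d))"
    proof (rule sum.reindex_bij_witness[of _ "\<lambda>d. (gcd d m, gcd d n)" "\<lambda>(a, b). a * b"], goal_cases)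
      case (1 p)
      then obtain a b where p: "p = (a, b)" "a dvd m" "b dvd n" by auto
      have "gcd (a * b) m = a" "gcd (a * b) n = b"
        using gcd_coprime_factor[of m n a b] gcd_coprime_factor[of n m b a] mn(3) p
        by (simp_all add: coprime_commute mult.commute)
      thus ?case using p by simp
    next
      case (2 p) thus ?case by (auto intro: mult_dvd_mono)
    next
      case (3 d)
      hence "d dvd m * n" by simp
      then obtain a b where ab: "d = a * b" "a dvd m" "b dvd n" using division_decomp by blast
      have "gcd d m = a" "gcd d n = b"
        using gcd_coprime_factor[of m n a b] gcd_coprime_factor[of n m b a] mn(3) ab
        by (simp_all add: coprime_commute mult.commute)
      thus ?case using ab by simp
    next
      case (4 d) thus ?case by auto
    next
      case (5 p)
      then obtain a b where p: "p = (a, b)" "a dvd m" "b dvd n" by auto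
      obtain k l where kl: "m = a * k" "n = b * l" using p(2,3) by (elim dvdE)
      have pos: "a > 0" "b > 0" "k > 0" "l > 0" using kl mn by auto
      have "coprime a b" "coprime k l"
        using mn(3) unfolding kl by (auto simp: coprime_mult_left_iff coprime_mult_right_iff)
      moreover have "m * n div (a * b) = k * l"
      proof -
        have "m * n = (a * b) * (k * l)" by (simp add: kl mult_ac)
        thus ?thesis using pos by simp
      qed
      ultimately show ?case
        using f g pos unfolding p multiplicative_def by (simp add: kl mult_ac)
    qed
    finally show ?thesis by (simp add: dirichlet_prod_def)
  qed
  moreover have "dirichlet_prod f g 1 = 1" using f g by (simp add: multiplicative_def)
  ultimately show ?thesis by (simp add: multiplicative_def)
qed

lemma multiplicative_mult:
  "multiplicative f \<Longrightarrow> multiplicative g \<Longrightarrow> multiplicative (\<lambda>n. f n * g n)"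
  by (auto simp: multiplicative_def mult_ac)

lemma multiplicative_subgroup_number: "multiplicative (subgroup_number r)"
proof (induction r)
  case 0
  have "m * n = 1 \<longleftrightarrow> m = 1 \<and> n = (1::nat)" for m n by (rule nat_mult_eq_1_iff)
  thus ?case by (auto simp: multiplicative_def)
next
  case (Suc r)
  have "multiplicative (\<lambda>d::nat. d)" "multiplicative (\<lambda>_. 1::nat)" by (auto simp: multiplicative_def)
  hence "multiplicative (dirichlet_prod (\<lambda>d. d * subgroup_number r d) (\<lambda>_. 1))"
    using Suc by (intro multiplicative_dirichlet_prod multiplicative_mult)
  moreover have "dirichlet_prod (\<lambda>d. d * subgroup_number r d) (\<lambda>_. 1) = subgroup_number (Suc r)"
    by (rule ext) (simp add: dirichlet_prod_def)
  ultimately show ?case by metis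
qed

lemma multiplicative_fixed_point_count: "multiplicative (fixed_point_count lam)"
proof (induction lam)
  case Nil
  show ?case by (simp add: fixed_point_count_def[abs_def] multiplicative_def)
next
  case (Cons r lam)
  have "fixed_point_count (r # lam) = (\<lambda>n. subgroup_number (Suc r) n * fixed_point_count lam n)"
    by (rule ext) (simp only: fixed_point_count_def list.map prod_list.Cons)
  thus ?case using multiplicative_mult[OF multiplicative_subgroup_number Cons] by metis
qed

definition smooth_numbers :: "nat set \<Rightarrow> nat set" where
  "smooth_numbers S = {n. n > 0 \<and> prime_factors n \<subseteq> S}"

text \<open>Splitting off the exact power of \<open>p\<close>; this is the induction step of the finite Euler product.\<close>
lemma smooth_numbers_insert:
  assumes p: "prime p" "p \<notin> S"
  shows "bij_betw (\<lambda>(k, n). p ^ k * n) (UNIV \<times> smooth_numbers S) (smooth_numbers (insert p S))"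
proof -
  have ndvd: "\<not> p dvd n" if "n \<in> smooth_numbers S" for n
    using that p by (auto simp: smooth_numbers_def prime_factors_dvd)
  have mult: "multiplicity p (p ^ k * n) = k" if "n \<in> smooth_numbers S" for k n
    using ndvd[OF that] p that
    by (subst prime_elem_multiplicity_mult_distrib) (auto simp: smooth_numbers_def not_dvd_imp_multiplicity_0)
  have "inj_on (\<lambda>(k, n). p ^ k * n) (UNIV \<times> smooth_numbers S)"
  proof (rule inj_onI, clarify)
    fix k n k' n' assume n: "n \<in> smooth_numbers S" "n' \<in> smooth_numbers S" and eq: "p ^ k * n = p ^ k' * n'"
    have "k = k'" using mult[OF n(1), of k] mult[OF n(2), of k'] eq by simp
    moreover have "p ^ k' > 0" using p prime_gt_0_nat by simp
    ultimately show "k = k' \<and> n = n'" using eq p by auto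
  qed
  moreover have "(\<lambda>(k, n). p ^ k * n) ` (UNIV \<times> smooth_numbers S) = smooth_numbers (insert p S)"
  proof (intro equalityI subsetI)
    fix m assume "m \<in> (\<lambda>(k, n). p ^ k * n) ` (UNIV \<times> smooth_numbers S)"
    then obtain k n where m: "m = p ^ k * n" and n: "n \<in> smooth_numbers S" by auto
    have "q = p \<or> q \<in> S" if "prime q" "q dvd m" for q
    proof -
      have "q dvd p ^ k \<or> q dvd n" using that m prime_dvd_mult_iff by blast
      thus ?thesis
      proof
        assume "q dvd p ^ k"
        hence "q dvd p" using that prime_dvd_power by blast
        thus ?thesis using that p primes_dvd_imp_eq by blast
      next
        assume "q dvd n"
        thus ?thesis using that n by (auto simp: smooth_numbers_def prime_factors_dvd)
      qed
    qed
    moreover have "m > 0" using m n p prime_gt_0_nat by (auto simp: smooth_numbers_def)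
    ultimately show "m \<in> smooth_numbers (insert p S)"
      by (auto simp: smooth_numbers_def prime_factors_dvd)
  next
    fix m assume m: "m \<in> smooth_numbers (insert p S)"
    hence m0: "m \<noteq> 0" by (auto simp: smooth_numbers_def)
    moreover have "\<not> is_unit p" using p not_prime_unit by blast
    ultimately obtain k n where n: "m = p ^ k * n" "\<not> p dvd n" using multiplicity_decompose' by blast
    have "n \<noteq> 0" using n m0 by (intro notI) simp
    have "q \<in> S" if "prime q" "q dvd n" for q
    proof -
      have "q dvd m" using that n(1) by (metis dvd_mult)
      hence "q \<in> insert p S" using m m0 that by (auto simp: smooth_numbers_def prime_factors_dvd)
      thus ?thesis using that n(2) by auto
    qed
    hence "n \<in> smooth_numbers S" using \<open>n \<noteq> 0\<close> by (auto simp: smooth_numbers_def prime_factors_dvd)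
    thus "m \<in> (\<lambda>(k, n). p ^ k * n) ` (UNIV \<times> smooth_numbers S)" using n(1) by auto
  qed
  ultimately show ?thesis by (simp add: bij_betw_def)
qed

lemma smooth_numbers_coprime:
  assumes "prime p" "p \<notin> S" "n \<in> smooth_numbers S" shows "coprime (p ^ k) n"
proof -
  have "\<not> p dvd n" using assms by (auto simp: smooth_numbers_def prime_factors_dvd)
  thus ?thesis using assms(1) by (simp add: prime_imp_coprime coprime_power_left_iff)
qed

lemma euler_product_finite:
  fixes f :: "nat \<Rightarrow> complex"
  assumes f: "multiplicative f" and sm: "(\<lambda>n. norm (f n)) summable_on {0<..}"
    and S: "finite S" "\<And>p. p \<in> S \<Longrightarrow> prime p"
  shows "(\<Prod>p\<in>S. infsum (\<lambda>k. f (p ^ k)) UNIV) = infsum f (smooth_numbers S)"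
  using S
proof (induction S rule: finite_induct)
  case empty
  have "smooth_numbers {} = {1}"
    by (auto simp: smooth_numbers_def prime_factorization_empty_iff)
  thus ?case using f by (simp add: multiplicative_def)
next
  case (insert p S)
  have p: "prime p" using insert by simp
  note bij = smooth_numbers_insert[OF p insert.hyps(2)]
  have fs: "f summable_on smooth_numbers (insert p S)"
    by (rule summable_on_subset_banach[OF abs_summable_summable[OF sm]]) (auto simp: smooth_numbers_def)
  have eq: "f (p ^ k * n) = f (p ^ k) * f n" if "n \<in> smooth_numbers S" for k n
    using f smooth_numbers_coprime[OF p insert.hyps(2) that, of k] that p prime_gt_0_nat
    by (auto simp: multiplicative_def smooth_numbers_def)
  have "(\<lambda>x. f (case x of (k, n) \<Rightarrow> p ^ k * n)) summable_on UNIV \<times> smooth_numbers S"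
    using summable_on_reindex_bij_betw[OF bij, of f] fs by simp
  hence fs': "(\<lambda>(k, n). f (p ^ k) * f n) summable_on UNIV \<times> smooth_numbers S"
    by (rule summable_on_cong[THEN iffD1, rotated]) (auto simp: eq)
  have "infsum f (smooth_numbers (insert p S)) = infsum (\<lambda>x. f (case x of (k, n) \<Rightarrow> p ^ k * n)) (UNIV \<times> smooth_numbers S)"
    by (rule infsum_reindex_bij_betw[OF bij, symmetric])
  also have "\<dots> = infsum (\<lambda>(k, n). f (p ^ k) * f n) (UNIV \<times> smooth_numbers S)"
    by (rule infsum_cong) (auto simp: eq)
  also have "\<dots> = infsum (\<lambda>k. infsum (\<lambda>n. f (p ^ k) * f n) (smooth_numbers S)) UNIV"
    by (rule infsum_Sigma'_banach[symmetric]) (rule fs')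
  also have "\<dots> = infsum (\<lambda>k. f (p ^ k)) UNIV * infsum f (smooth_numbers S)"
    by (simp add: infsum_cmult_right' infsum_cmult_left')
  finally show ?case using insert by simp
qed

text \<open>The numbers missed by the primes below \<open>P + 1\<close> exceed \<open>P\<close>, so the error is a tail of the series.\<close>
theorem euler_product_limit:
  fixes f :: "nat \<Rightarrow> complex"
  assumes f: "multiplicative f" and sm: "(\<lambda>n. norm (f n)) summable_on {0<..}"
  shows "(\<lambda>P. \<Prod>p | prime p \<and> p < P. infsum (\<lambda>k. f (p ^ k)) UNIV) \<longlonglongrightarrow> infsum f {0<..}"
proof -
  define S where "S = (\<lambda>P. {p::nat. prime p \<and> p < P})"
  have S: "finite (S P)" "p \<in> S P \<Longrightarrow> prime p" for P p
    by (auto simp: S_def)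
  define R where "R = (\<lambda>P. infsum (\<lambda>n. norm (f n)) {0<..} - (\<Sum>n<P. norm (f (Suc n))))"
  have bound: "norm ((\<Prod>p\<in>S (Suc P). infsum (\<lambda>k. f (p ^ k)) UNIV) - infsum f {0<..}) \<le> R P" for P
  proof -
    let ?A = "smooth_numbers (S (Suc P))" and ?B = "{0<..} - smooth_numbers (S (Suc P))"
    have AB: "?A \<union> ?B = {0<..}" "?A \<inter> ?B = {}" by (auto simp: smooth_numbers_def)
    have smA: "(\<lambda>n. norm (f n)) summable_on ?A" and smB: "(\<lambda>n. norm (f n)) summable_on ?B"
      by (rule summable_on_subset_banach[OF sm], use AB in blast)+
    have "infsum f (?A \<union> ?B) = infsum f ?A + infsum f ?B"
      by (rule infsum_Un_disjoint) (use AB(2) abs_summable_summable[OF smA] abs_summable_summable[OF smB] in auto)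
    hence "infsum f {0<..} = infsum f ?A + infsum f ?B" unfolding AB .
    hence "norm ((\<Prod>p\<in>S (Suc P). infsum (\<lambda>k. f (p ^ k)) UNIV) - infsum f {0<..}) = norm (infsum f ?B)"
      using euler_product_finite[OF f sm S] by (simp add: norm_minus_commute)
    also have "\<dots> \<le> infsum (\<lambda>n. norm (f n)) ?B" by (rule norm_infsum_bound[OF smB])
    also have "?B \<subseteq> {P<..}"
    proof
      fix n assume n: "n \<in> ?B"
      then obtain q where q: "q \<in> prime_factors n" "q \<notin> S (Suc P)" by (auto simp: smooth_numbers_def)
      hence "prime q" "q dvd n" by (auto simp: prime_factors_dvd)
      moreover have "q \<le> n" using \<open>q dvd n\<close> n by (auto intro: dvd_imp_le)
      ultimately show "n \<in> {P<..}" using q by (auto simp: S_def)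
    qed
    have smP: "(\<lambda>n. norm (f n)) summable_on {P<..}" by (rule summable_on_subset_banach[OF sm]) auto
    have "infsum (\<lambda>n. norm (f n)) ?B \<le> infsum (\<lambda>n. norm (f n)) {P<..}"
      by (rule infsum_mono2[OF smB smP]) (use \<open>?B \<subseteq> {P<..}\<close> in auto)
    also have "\<dots> = R P"
    proof -
      have eq: "{0<..} = {1..P} \<union> {P<..}" by auto
      have "infsum (\<lambda>n. norm (f n)) {0<..} = infsum (\<lambda>n. norm (f n)) {1..P} + infsum (\<lambda>n. norm (f n)) {P<..}"
        unfolding eq by (rule infsum_Un_disjoint) (use smP in auto)
      moreover have "(\<Sum>n=1..P. norm (f n)) = (\<Sum>n<P. norm (f (Suc n)))"
        by (rule sum.reindex_bij_witness[of _ Suc "\<lambda>e. e - 1"]) auto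
      ultimately show ?thesis by (simp add: R_def)
    qed
    finally show ?thesis .
  qed
  have "((\<lambda>n. norm (f (Suc n))) has_sum infsum (\<lambda>n. norm (f n)) {0<..}) UNIV"
    using has_sum_reindex_bij_betw[OF bij_Suc, of "\<lambda>n. norm (f n)"] sm by simp
  hence "(\<lambda>P. \<Sum>n<P. norm (f (Suc n))) \<longlonglongrightarrow> infsum (\<lambda>n. norm (f n)) {0<..}"
    using has_sum_imp_sums sums_def by blast
  hence "R \<longlonglongrightarrow> infsum (\<lambda>n. norm (f n)) {0<..} - infsum (\<lambda>n. norm (f n)) {0<..}"
    unfolding R_def by (intro tendsto_diff tendsto_const)
  hence "R \<longlonglongrightarrow> 0" by simp
  hence "(\<lambda>P. (\<Prod>p\<in>S (Suc P). infsum (\<lambda>k. f (p ^ k)) UNIV) - infsum f {0<..}) \<longlonglongrightarrow> 0"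
    by (rule Lim_null_comparison[rotated]) (use bound in \<open>auto intro!: always_eventually\<close>)
  hence "(\<lambda>P. (\<Prod>p\<in>S (Suc P). infsum (\<lambda>k. f (p ^ k)) UNIV)) \<longlonglongrightarrow> infsum f {0<..}"
    by (rule LIM_zero_cancel)
  thus ?thesis unfolding S_def by (rule LIMSEQ_imp_Suc)
qed

lemma euler_product_zeta:
  assumes s: "Re s > 1"
  shows "(\<lambda>P. \<Prod>p | prime p \<and> p < P. 1 / (1 - of_nat p powr (-s))) \<longlonglongrightarrow> zeta s"
proof -
  let ?f = "\<lambda>n::nat. of_nat n powr (-s) :: complex"
  have d: "abs_summable_at (\<lambda>_. 1) (Re s)" using s by (rule abs_summable_at_1)
  have sm: "(\<lambda>n. norm (?f n)) summable_on {0<..}" using d unfolding abs_summable_at_iff_norm_summable by simp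
  have "multiplicative ?f" unfolding multiplicative_def of_nat_mult_powr by simp
  from euler_product_limit[OF this sm]
  have "(\<lambda>P. \<Prod>p | prime p \<and> p < P. infsum (\<lambda>k. ?f (p ^ k)) UNIV) \<longlonglongrightarrow> zeta s"
    using dirichlet_series_infsum[OF d] zeta_eq[OF s] by simp
  also have "(\<lambda>P. \<Prod>p | prime p \<and> p < P. infsum (\<lambda>k. ?f (p ^ k)) UNIV) =
             (\<lambda>P. \<Prod>p | prime p \<and> p < P. 1 / (1 - of_nat p powr (-s)))"
  proof (intro ext prod.cong refl)
    fix P p :: nat assume "p \<in> {p. prime p \<and> p < P}"
    hence p: "p > 1" using prime_gt_1_nat[of p] by simp
    have pow: "?f (p ^ k) = ?f p ^ k" for k
      by (induction k) (simp_all only: power_0 power_Suc of_nat_mult_powr of_nat_1 powr_one_eq_one)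
    have "norm (?f p) < 1"
    proof -
      have "norm (?f p) = real p powr (- Re s)" using p by (simp add: norm_of_nat_powr)
      also have "\<dots> < real p powr 0" using p s by (intro powr_less_mono) auto
      finally show ?thesis using p by simp
    qed
    hence "((\<lambda>k. ?f p ^ k) has_sum 1 / (1 - ?f p)) UNIV"
      by (intro norm_summable_imp_has_sum geometric_sums) (simp add: norm_power summable_geometric)
    thus "infsum (\<lambda>k. ?f (p ^ k)) UNIV = 1 / (1 - of_nat p powr (-s))"
      unfolding pow by (rule infsumI)
  qed
  finally show ?thesis .
qed

section \<open>Fixed point counts at prime powers\<close>

text \<open>The Gaussian binomial coefficient of \<open>k + r\<close> over \<open>r\<close> at \<open>p\<close>, which counts the subgroups of
index \<open>p\<^sup>k\<close> in \<open>\<int>\<^sup>r\<^sup>+\<^sup>1\<close>.\<close>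
definition gauss_binomial :: "nat \<Rightarrow> nat \<Rightarrow> nat \<Rightarrow> real" where
  "gauss_binomial p r k = (\<Prod>i=1..r. (real p ^ (k + i) - 1) / (real p ^ i - 1))"

lemma power_gt_one: "p \<ge> 2 \<Longrightarrow> i \<ge> 1 \<Longrightarrow> real p ^ i > 1"
  by (rule one_less_power) auto

lemma gauss_binomial_Suc_Suc:
  assumes p: "p \<ge> 2"
  shows "gauss_binomial p (Suc r) (Suc k) = gauss_binomial p (Suc r) k + real p ^ Suc k * gauss_binomial p r (Suc k)"
proof -
  define A where "A = gauss_binomial p r (Suc k)"
  have pos: "real p ^ i - 1 \<noteq> 0" if "i \<ge> 1" for i
    using power_gt_one[OF p that] by simp
  have 1: "gauss_binomial p (Suc r) (Suc k) = A * ((real p ^ (Suc k + Suc r) - 1) / (real p ^ Suc r - 1))"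
    by (simp add: gauss_binomial_def A_def)
  have "(\<Prod>i=1..Suc r. real p ^ (k + i) - 1) = (real p ^ Suc k - 1) * (\<Prod>i=1..r. real p ^ (Suc k + i) - 1)"
    using prod.atLeast_Suc_atMost[of 1 "Suc r" "\<lambda>i. real p ^ (k + i) - 1"] prod.shift_bounds_cl_Suc_ivl[of "\<lambda>i. real p ^ (k + i) - 1" 1 r]
    by simp
  moreover have "(\<Prod>i=1..Suc r. real p ^ i - 1) = (real p ^ Suc r - 1) * (\<Prod>i=1..r. real p ^ i - 1)"
    by simp
  ultimately have 2: "gauss_binomial p (Suc r) k = A * ((real p ^ Suc k - 1) / (real p ^ Suc r - 1))"
    unfolding gauss_binomial_def A_def prod_dividef by simp
  have "(real p ^ (Suc k + Suc r) - 1) / (real p ^ Suc r - 1) = (real p ^ Suc k - 1) / (real p ^ Suc r - 1) + real p ^ Suc k"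
    using pos[of "Suc r"] by (simp add: field_simps power_add)
  thus ?thesis unfolding 1 2 A_def[symmetric] by (simp add: algebra_simps)
qed

lemma gauss_binomial_0: assumes p: "p \<ge> 2" shows "gauss_binomial p r 0 = 1"
  unfolding gauss_binomial_def
proof (rule prod.neutral, clarify)
  fix i assume "i \<in> {1..r}"
  thus "(real p ^ (0 + i) - 1) / (real p ^ i - 1) = 1"
    using power_gt_one[OF p, of i] by simp
qed

lemma subgroup_number_prime_power:
  assumes p: "prime p"
  shows "real (subgroup_number (Suc r) (p ^ k)) = gauss_binomial p r k"
proof (induction r arbitrary: k)
  case 0
  have "(\<Sum>d | d dvd p ^ k. d * (if d = 1 then 1 else 0)) = (\<Sum>d | d dvd p ^ k. if d = 1 then 1 else (0::nat))"
    by (intro sum.cong) auto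
  thus ?case using p prime_gt_0_nat by (simp add: gauss_binomial_def)
next
  case (Suc r)
  have p2: "p \<ge> 2" using p by (rule prime_ge_2_nat)
  have div: "{d. d dvd p ^ k} = (\<lambda>i. p ^ i) ` {..k}"
    using divides_primepow_nat[OF p] by auto
  have "inj_on (\<lambda>i. p ^ i) {..k}" using p2 by (auto simp: inj_on_def power_inject_exp)
  hence "subgroup_number (Suc (Suc r)) (p ^ k) = (\<Sum>i\<le>k. p ^ i * subgroup_number (Suc r) (p ^ i))"
    unfolding subgroup_number.simps(2)[of "Suc r"] div by (subst sum.reindex) auto
  hence "real (subgroup_number (Suc (Suc r)) (p ^ k)) = (\<Sum>i\<le>k. real p ^ i * gauss_binomial p r i)"
    using Suc.IH by (simp del: subgroup_number.simps)
  also have "\<dots> = gauss_binomial p (Suc r) k"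
    by (induction k) (simp_all add: gauss_binomial_0[OF p2] gauss_binomial_Suc_Suc[OF p2])
  finally show ?case .
qed

text \<open>As a function of \<open>y = p\<^sup>-\<^sup>k\<close>, the \<open>i\<close>-th factor of the Gaussian binomial coefficient is
\<open>p\<^sup>k\<close> times this linear polynomial. So the fixed point count at \<open>p\<^sup>k\<close> is \<open>p\<^sup>N\<^sup>k\<close> times a polynomial in
\<open>y\<close>, and the generating function over \<open>k\<close> is a sum of \<open>N + 1\<close> geometric series.\<close>
definition linear_factor :: "nat \<Rightarrow> nat \<Rightarrow> real poly" where
  "linear_factor i p = [: real p ^ i / (real p ^ i - 1), -1 / (real p ^ i - 1) :]"

definition fixed_point_poly :: "nat list \<Rightarrow> nat \<Rightarrow> real poly" where
  "fixed_point_poly lam p = (\<Prod>r\<leftarrow>lam. \<Prod>i=1..r. linear_factor i p)"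

lemma fixed_point_count_prime_power:
  assumes p: "prime p"
  shows "real (fixed_point_count lam (p ^ k)) = real p ^ (sum_list lam * k) * poly (fixed_point_poly lam p) (1 / real p ^ k)"
proof (induction lam)
  case Nil
  thus ?case by (simp add: fixed_point_count_def fixed_point_poly_def)
next
  case (Cons r lam)
  have p0: "real p > 0" using p prime_gt_0_nat by simp
  have fac: "real p ^ k * poly (linear_factor i p) (1 / real p ^ k) = (real p ^ (k + i) - 1) / (real p ^ i - 1)" for i
  proof -
    have "x * (a / c + (1 / x) * (-1 / c)) = (x * a - 1) / c" if "x \<noteq> 0" for x a c :: real
      using that by (cases "c = 0") (auto simp: field_simps)
    from this[of "real p ^ k" "real p ^ i" "real p ^ i - 1"] show ?thesis
      using p0 by (simp add: linear_factor_def power_add)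
  qed
  have "gauss_binomial p r k = (\<Prod>i=1..r. real p ^ k * poly (linear_factor i p) (1 / real p ^ k))"
    unfolding gauss_binomial_def fac ..
  also have "\<dots> = real p ^ (k * r) * poly (\<Prod>i=1..r. linear_factor i p) (1 / real p ^ k)"
    by (simp add: prod.distrib poly_prod power_mult)
  finally show ?case
    using Cons subgroup_number_prime_power[OF p, of r k]
    by (simp add: fixed_point_count_def fixed_point_poly_def power_add distrib_right distrib_left mult_ac del: subgroup_number.simps)
qed

lemma degree_fixed_point_poly: "degree (fixed_point_poly lam p) \<le> sum_list lam"
proof (induction lam)
  case (Cons r lam)
  have "degree (\<Prod>i=1..r. linear_factor i p) \<le> (\<Sum>i=1..r. degree (linear_factor i p))"
    by (rule degree_prod_sum_le[unfolded o_def]) auto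
  also have "\<dots> \<le> (\<Sum>i=1..r. 1)" by (intro sum_mono) (simp add: linear_factor_def)
  finally have "degree (\<Prod>i=1..r. linear_factor i p) \<le> r" by simp
  thus ?case
    using Cons degree_mult_le[of "\<Prod>i=1..r. linear_factor i p" "fixed_point_poly lam p"]
    by (simp add: fixed_point_poly_def)
qed (simp add: fixed_point_poly_def)

text \<open>The shape \<open>(1 + m/p) - (m/p) y\<close> of a family of polynomials up to terms of order \<open>p\<^sup>-\<^sup>2\<close>. It is
stable under products, with the values of \<open>m\<close> added; terms of order \<open>p\<^sup>-\<^sup>2\<close> will not affect
convergence to the right of \<open>N - 2\<close>.\<close>
definition leading_behaviour :: "nat \<Rightarrow> (nat \<Rightarrow> real poly) \<Rightarrow> bool" where
  "leading_behaviour m D \<longleftrightarrow>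
     (\<lambda>p. coeff (D p) 0 - 1 - real m / real p) \<in> O(\<lambda>p. 1 / real p ^ 2) \<and>
     (\<lambda>p. coeff (D p) 1 + real m / real p) \<in> O(\<lambda>p. 1 / real p ^ 2) \<and>
     (\<forall>i\<ge>2. (\<lambda>p. coeff (D p) i) \<in> O(\<lambda>p. 1 / real p ^ 2))"

lemma leading_behaviour_bounds:
  assumes "leading_behaviour m D"
  shows "(\<lambda>p. coeff (D p) 0 - 1) \<in> O(\<lambda>p. 1 / real p)"
    and "(\<lambda>p. coeff (D p) 0) \<in> O(\<lambda>_. 1)"
    and "(\<lambda>p. coeff (D p) 1) \<in> O(\<lambda>p. 1 / real p)"
    and "(\<lambda>p. coeff (D p) i) \<in> O(\<lambda>_. 1)"
proof -
  have e1: "(\<lambda>p. 1 / real p ^ 2) \<in> O(\<lambda>p. 1 / real p)" by real_asymp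
  have e2: "(\<lambda>p. 1 / real p) \<in> O(\<lambda>_. 1)" by real_asymp
  have e3: "(\<lambda>p. 1 / real p ^ 2) \<in> O(\<lambda>_. 1)" by real_asymp
  have m: "(\<lambda>p. real m / real p) \<in> O(\<lambda>p. 1 / real p)" by (cases m) (auto, real_asymp)
  note d = assms[unfolded leading_behaviour_def]
  have "(\<lambda>p. (coeff (D p) 0 - 1 - real m / real p) + real m / real p) \<in> O(\<lambda>p. 1 / real p)"
    by (rule sum_in_bigo(1)[OF landau_o.big.trans[OF _ e1] m]) (use d in blast)
  thus 1: "(\<lambda>p. coeff (D p) 0 - 1) \<in> O(\<lambda>p. 1 / real p)" by simp
  have "(\<lambda>p. (coeff (D p) 0 - 1) + 1) \<in> O(\<lambda>_. 1)"
    by (intro sum_in_bigo landau_o.big.trans[OF 1 e2]) auto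
  thus 2: "(\<lambda>p. coeff (D p) 0) \<in> O(\<lambda>_. 1)" by simp
  have "(\<lambda>p. (coeff (D p) 1 + real m / real p) - real m / real p) \<in> O(\<lambda>p. 1 / real p)"
    by (rule sum_in_bigo(2)[OF landau_o.big.trans[OF _ e1] m]) (use d in blast)
  thus 3: "(\<lambda>p. coeff (D p) 1) \<in> O(\<lambda>p. 1 / real p)" by simp
  consider "i = 0" | "i = 1" | "i \<ge> 2" by linarith
  thus "(\<lambda>p. coeff (D p) i) \<in> O(\<lambda>_. 1)"
  proof cases
    case 3
    thus ?thesis using assms landau_o.big.trans[OF _ e3] by (auto simp: leading_behaviour_def)
  qed (use 2 landau_o.big.trans[OF 3 e2] in auto)
qed

lemma bigo_mult_square:
  assumes "f \<in> O(\<lambda>_. 1)" "g \<in> O(\<lambda>p. 1 / real p ^ 2)"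
  shows "(\<lambda>p. f p * g p) \<in> O(\<lambda>p. 1 / real p ^ 2)"
  using landau_o.big.mult[OF assms] by simp

lemma bigo_mult_square':
  assumes "f \<in> O(\<lambda>p. 1 / real p)" "g \<in> O(\<lambda>p. 1 / real p)"
  shows "(\<lambda>p. f p * g p) \<in> O(\<lambda>p. 1 / real p ^ 2)"
  using landau_o.big.mult[OF assms] by (simp add: power2_eq_square)

lemma leading_behaviour_mult:
  assumes D: "leading_behaviour m D" and D': "leading_behaviour m' D'"
  shows "leading_behaviour (m + m') (\<lambda>p. D p * D' p)"
proof -
  let ?e = "\<lambda>p::nat. 1 / real p ^ 2"
  let ?d = "\<lambda>i p. coeff (D p) i" and ?d' = "\<lambda>i p. coeff (D' p) i"
  note b = leading_behaviour_bounds[OF D] and b' = leading_behaviour_bounds[OF D']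
  note d = D[unfolded leading_behaviour_def] and d' = D'[unfolded leading_behaviour_def]
  have mp: "(\<lambda>p. c / real p) \<in> O(\<lambda>p. 1 / real p)" for c :: real
    by (cases "c = 0") (auto, real_asymp)
  have mp1: "(\<lambda>p. 1 + c / real p) \<in> O(\<lambda>_. 1)" for c :: real
    by (cases "c = 0") (auto, real_asymp)
  have mm: "(\<lambda>p. (real m / real p) * (real m' / real p)) \<in> O(?e)"
    by (intro bigo_mult_square' mp)
  have "(\<lambda>p. ?d' 0 p * (?d 0 p - 1 - real m / real p) + (1 + real m / real p) * (?d' 0 p - 1 - real m' / real p)
        + (real m / real p) * (real m' / real p)) \<in> O(?e)"
    by (rule sum_in_bigo(1)[OF sum_in_bigo(1)[OF bigo_mult_square[OF b'(2)] bigo_mult_square[OF mp1]] mm])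
       (use d d' in blast)+
  also have "(\<lambda>p. ?d' 0 p * (?d 0 p - 1 - real m / real p) + (1 + real m / real p) * (?d' 0 p - 1 - real m' / real p)
        + (real m / real p) * (real m' / real p)) = (\<lambda>p. coeff (D p * D' p) 0 - 1 - real (m + m') / real p)"
    by (rule ext) (simp add: mult_poly_0 coeff_mult add_divide_distrib algebra_simps)
  finally have 0: "(\<lambda>p. coeff (D p * D' p) 0 - 1 - real (m + m') / real p) \<in> O(?e)" .
  have "(\<lambda>p. ?d 0 p * (?d' 1 p + real m' / real p) - (?d 0 p - 1) * (real m' / real p)
      + ?d' 0 p * (?d 1 p + real m / real p) - (?d' 0 p - 1) * (real m / real p)) \<in> O(?e)"
    by (rule sum_in_bigo(2)[OF sum_in_bigo(1)[OF sum_in_bigo(2)[OF bigo_mult_square[OF b(2)]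
          bigo_mult_square'[OF b(1) mp]] bigo_mult_square[OF b'(2)]] bigo_mult_square'[OF b'(1) mp]])
       (use d d' in blast)+
  also have "(\<lambda>p. ?d 0 p * (?d' 1 p + real m' / real p) - (?d 0 p - 1) * (real m' / real p)
      + ?d' 0 p * (?d 1 p + real m / real p) - (?d' 0 p - 1) * (real m / real p)) =
      (\<lambda>p. coeff (D p * D' p) 1 + real (m + m') / real p)"
    by (rule ext) (simp add: coeff_mult add_divide_distrib algebra_simps)
  finally have 1: "(\<lambda>p. coeff (D p * D' p) 1 + real (m + m') / real p) \<in> O(?e)" .
  have 2: "(\<lambda>p. coeff (D p * D' p) i) \<in> O(?e)" if i: "i \<ge> 2" for i
    unfolding coeff_mult
  proof (rule big_sum_in_bigo)
    fix a assume a: "a \<in> {..i}"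
    consider "a \<ge> 2" | "i - a \<ge> 2" | "a = 1" "i - a = 1" using a i by fastforce
    thus "(\<lambda>p. ?d a p * ?d' (i - a) p) \<in> O(?e)"
    proof cases
      case 1
      have "(\<lambda>p. ?d' (i - a) p * ?d a p) \<in> O(?e)"
        using d 1 by (intro bigo_mult_square b') auto
      thus ?thesis by (simp add: mult.commute)
    next
      case 2
      thus ?thesis using d' by (intro bigo_mult_square b) auto
    next
      case 3
      show ?thesis unfolding 3(2) unfolding 3(1) by (intro bigo_mult_square' b b')
    qed
  qed
  show ?thesis unfolding leading_behaviour_def using 0 1 2 by simp
qed

lemma leading_behaviour_1: "leading_behaviour 0 (\<lambda>_. 1)"
  by (auto simp: leading_behaviour_def)

text \<open>Only the factor \<open>i = 1\<close> is visible at this precision, which is why the number of parts of the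
partition, and not their sizes, will enter the local factors.\<close>
lemma leading_behaviour_linear_factor:
  assumes "i \<ge> 1" shows "leading_behaviour (if i = 1 then 1 else 0) (linear_factor i)"
proof -
  have z: "coeff (linear_factor i p) j = 0" if "j \<ge> 2" for j p
    using that by (intro coeff_eq_0) (simp add: linear_factor_def)
  show ?thesis
  proof (cases "i = 1")
    case True
    have "(\<lambda>p. real p / (real p - 1) - 1 - 1 / real p) \<in> O(\<lambda>p. 1 / real p ^ 2)" by real_asymp
    moreover have "(\<lambda>p. -1 / (real p - 1) + 1 / real p) \<in> O(\<lambda>p. 1 / real p ^ 2)" by real_asymp
    ultimately show ?thesis using True z by (simp add: leading_behaviour_def) (simp add: linear_factor_def)
  next
    case False
    have bound: "\<bar>1 / (real p ^ i - 1)\<bar> \<le> 2 * \<bar>1 / real p ^ 2\<bar>" "real p ^ i - 1 > 0" if "p \<ge> 2" for p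
    proof -
      have "real p ^ 2 \<le> real p ^ i" using False assms that by (intro power_increasing) auto
      moreover have "real p ^ 2 \<ge> 2 ^ 2" using that by (intro power_mono) auto
      hence "real p ^ 2 \<ge> 4" by simp
      ultimately have "real p ^ i - 1 \<ge> real p ^ 2 / 2" "real p ^ 2 > 0" by linarith+
      thus "real p ^ i - 1 > 0" by linarith
      have "1 / (real p ^ i - 1) \<le> 1 / (real p ^ 2 / 2)"
        using \<open>real p ^ i - 1 \<ge> real p ^ 2 / 2\<close> \<open>real p ^ 2 > 0\<close> \<open>real p ^ i - 1 > 0\<close>
        by (intro divide_left_mono mult_pos_pos) linarith+
      thus "\<bar>1 / (real p ^ i - 1)\<bar> \<le> 2 * \<bar>1 / real p ^ 2\<bar>" using \<open>real p ^ i - 1 > 0\<close> by simp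
    qed
    have O1: "(\<lambda>p. 1 / (real p ^ i - 1)) \<in> O(\<lambda>p. 1 / real p ^ 2)"
    proof (rule bigoI)
      show "\<forall>\<^sub>F p in at_top. norm (1 / (real p ^ i - 1)) \<le> 2 * norm (1 / real p ^ 2)"
        using eventually_ge_at_top[of 2] by eventually_elim (simp only: real_norm_def bound)
    qed
    have "\<forall>\<^sub>F p in at_top. 1 / (real p ^ i - 1) = coeff (linear_factor i p) 0 - 1 - real 0 / real p"
      using eventually_ge_at_top[of 2]
      by eventually_elim (use bound(2) in \<open>fastforce simp: linear_factor_def field_simps\<close>)
    hence "(\<lambda>p. coeff (linear_factor i p) 0 - 1 - real 0 / real p) \<in> O(\<lambda>p. 1 / real p ^ 2)"
      using O1 by (subst landau_o.big.in_cong) (auto elim: eventually_mono)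
    moreover have "(\<lambda>p. coeff (linear_factor i p) 1 + real 0 / real p) \<in> O(\<lambda>p. 1 / real p ^ 2)"
      using O1 landau_o.big.uminus_in_iff by (simp add: linear_factor_def)
    ultimately show ?thesis using False z by (simp add: leading_behaviour_def)
  qed
qed

lemma leading_behaviour_fixed_point_poly:
  assumes "\<forall>r\<in>set lam. r \<ge> 1"
  shows "leading_behaviour (length lam) (fixed_point_poly lam)"
  using assms
proof (induction lam)
  case Nil
  show ?case using leading_behaviour_1 by (simp add: fixed_point_poly_def[abs_def])
next
  case (Cons r lam)
  have "leading_behaviour (if r = 0 then 0 else 1) (\<lambda>p. \<Prod>i=1..r. linear_factor i p)" for r
  proof (induction r)
    case (Suc r)
    show ?case
      using leading_behaviour_mult[OF Suc leading_behaviour_linear_factor[of "Suc r"]]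
      by (cases "r = 0") simp_all
  qed (simp add: leading_behaviour_1)
  from leading_behaviour_mult[OF this[of r] Cons.IH] Cons.prems
  show ?case by (simp add: fixed_point_poly_def[abs_def])
qed

section \<open>Cyclotomic factors\<close>

text \<open>The functions given by polynomials with integer coefficients. Only three things are needed of
them: an integer constant term can be split off, they are bounded on the unit disc, and they form
a ring.\<close>
inductive int_poly_fun :: "(complex \<Rightarrow> complex) \<Rightarrow> bool" where
  const: "int_poly_fun (\<lambda>_. of_int c)"
| ident: "int_poly_fun (\<lambda>X. X)"
| add: "int_poly_fun f \<Longrightarrow> int_poly_fun g \<Longrightarrow> int_poly_fun (\<lambda>X. f X + g X)"
| mult: "int_poly_fun f \<Longrightarrow> int_poly_fun g \<Longrightarrow> int_poly_fun (\<lambda>X. f X * g X)"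

lemma int_poly_fun_0: "int_poly_fun (\<lambda>_. 0)" and int_poly_fun_1: "int_poly_fun (\<lambda>_. 1)"
  using const[of 0] const[of 1] by simp_all

lemma int_poly_fun_uminus: "int_poly_fun f \<Longrightarrow> int_poly_fun (\<lambda>X. - f X)"
  using mult[OF const[of "-1"], of f] by simp

lemma int_poly_fun_diff: "int_poly_fun f \<Longrightarrow> int_poly_fun g \<Longrightarrow> int_poly_fun (\<lambda>X. f X - g X)"
  using add[OF _ int_poly_fun_uminus, of f g] by simp

lemma int_poly_fun_power: "int_poly_fun f \<Longrightarrow> int_poly_fun (\<lambda>X. f X ^ n)"
  by (induction n) (auto intro: int_poly_fun_1 mult)

lemma int_poly_fun_prod: "(\<And>i. i \<in> A \<Longrightarrow> int_poly_fun (f i)) \<Longrightarrow> int_poly_fun (\<lambda>X. \<Prod>i\<in>A. f i X)"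
  by (induction A rule: infinite_finite_induct) (auto intro: int_poly_fun_1 mult)

lemmas int_poly_fun_intros = int_poly_fun_0 int_poly_fun_1 const ident add mult int_poly_fun_diff
  int_poly_fun_power int_poly_fun_prod

lemma int_poly_fun_split:
  assumes "int_poly_fun f"
  shows "\<exists>c g. int_poly_fun g \<and> f = (\<lambda>X. of_int c + X * g X)"
  using assms
proof (induction rule: int_poly_fun.induct)
  case (const c)
  show ?case by (rule exI[of _ c], rule exI[of _ "\<lambda>_. 0"]) (auto intro: int_poly_fun_intros)
next
  case ident
  show ?case by (rule exI[of _ 0], rule exI[of _ "\<lambda>_. 1"]) (auto intro: int_poly_fun_intros)
next
  case (add f g)
  then obtain c f' d g' where "int_poly_fun f'" "f = (\<lambda>X. of_int c + X * f' X)"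
    "int_poly_fun g'" "g = (\<lambda>X. of_int d + X * g' X)" by blast
  thus ?case
    by (intro exI[of _ "c + d"] exI[of _ "\<lambda>X. f' X + g' X"])
       (auto intro: int_poly_fun_intros simp: algebra_simps)
next
  case (mult f g)
  then obtain c f' d g' where *: "int_poly_fun f'" "f = (\<lambda>X. of_int c + X * f' X)"
    "int_poly_fun g'" "g = (\<lambda>X. of_int d + X * g' X)" by blast
  show ?case
    by (intro exI[of _ "c * d"] exI[of _ "\<lambda>X. of_int c * g' X + f' X * (of_int d + X * g' X)"] conjI int_poly_fun_intros *)
       (simp add: * algebra_simps)
qed

lemma int_poly_fun_bounded:
  assumes "int_poly_fun f" shows "\<exists>B\<ge>0. \<forall>X. norm X \<le> 1 \<longrightarrow> norm (f X) \<le> B"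
  using assms
proof (induction rule: int_poly_fun.induct)
  case (const c)
  show ?case by (intro exI[of _ "norm (of_int c :: complex)"]) auto
next
  case ident
  show ?case by (intro exI[of _ 1]) auto
next
  case (add f g)
  then obtain B C where "B \<ge> 0" "C \<ge> 0" "\<And>X. norm X \<le> 1 \<Longrightarrow> norm (f X) \<le> B" "\<And>X. norm X \<le> 1 \<Longrightarrow> norm (g X) \<le> C"
    by blast
  thus ?case
    by (intro exI[of _ "B + C"]) (auto intro: norm_triangle_le add_mono)
next
  case (mult f g)
  then obtain B C where "B \<ge> 0" "C \<ge> 0" "\<And>X. norm X \<le> 1 \<Longrightarrow> norm (f X) \<le> B" "\<And>X. norm X \<le> 1 \<Longrightarrow> norm (g X) \<le> C"
    by blast
  thus ?case
    by (intro exI[of _ "B * C"]) (auto simp: norm_mult intro!: mult_mono)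
qed

lemma one_plus_power_expand:
  fixes \<sigma> :: int
  shows "\<exists>s. int_poly_fun s \<and> (\<forall>X. (1 + of_int \<sigma> * X ^ k) ^ n = 1 + of_int (int n * \<sigma>) * X ^ k + X ^ k * X ^ k * s X)"
proof (induction n)
  case 0
  show ?case by (intro exI[of _ "\<lambda>_. 0"]) (auto intro: int_poly_fun_intros)
next
  case (Suc n)
  then obtain s where s: "int_poly_fun s"
    "\<And>X. (1 + of_int \<sigma> * X ^ k) ^ n = 1 + of_int (int n * \<sigma>) * X ^ k + X ^ k * X ^ k * s X" by blast
  define s' where "s' = (\<lambda>X. of_int (int n * \<sigma> * \<sigma>) + s X + of_int \<sigma> * X ^ k * s X)"
  have "int_poly_fun s'" unfolding s'_def by (intro int_poly_fun_intros s)
  moreover have "(1 + of_int \<sigma> * X ^ k) ^ Suc n = 1 + of_int (int (Suc n) * \<sigma>) * X ^ k + X ^ k * X ^ k * s' X" for X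
    unfolding power_Suc s(2) s'_def by (simp add: algebra_simps)
  ultimately show ?case by blast
qed

text \<open>The factors \<open>1 - X\<^sup>k\<close> and \<open>1 + X\<^sup>k = (1 - X\<^sup>2\<^sup>k) / (1 - X\<^sup>k)\<close> are those whose Euler products are
expressible by values of \<open>\<zeta>\<close>. Allowing both avoids negative exponents.\<close>
definition cyclo_factor :: "(nat \<Rightarrow> nat) \<Rightarrow> (nat \<Rightarrow> nat) \<Rightarrow> nat \<Rightarrow> complex \<Rightarrow> complex" where
  "cyclo_factor b b' K X = (\<Prod>k=1..K. (1 - X ^ k) ^ b k * (1 + X ^ k) ^ b' k)"

lemma int_poly_fun_cyclo_factor: "int_poly_fun (cyclo_factor b b' K)"
  unfolding cyclo_factor_def[abs_def] by (intro int_poly_fun_intros)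

text \<open>Estermann's device. If the product so far is \<open>1 + c X\<^sup>K\<^sup>+\<^sup>1 + \<dots>\<close> with an integer \<open>c\<close>, then
multiplying by \<open>(1 - X\<^sup>K\<^sup>+\<^sup>1)\<^sup>c\<close>, or by \<open>(1 + X\<^sup>K\<^sup>+\<^sup>1)\<^sup>-\<^sup>c\<close> for negative \<open>c\<close>, removes the term
of order \<open>K + 1\<close>.\<close>
lemma cyclo_factor_exists:
  "\<exists>b b' q. int_poly_fun q \<and> (\<forall>X. (1 + of_int a * X) * cyclo_factor b b' K X = 1 + X ^ Suc K * q X)"
proof (induction K)
  case 0
  show ?case
    by (rule exI[of _ "\<lambda>_. 0"], rule exI[of _ "\<lambda>_. 0"], rule exI[of _ "\<lambda>_. of_int a"])
       (auto simp: cyclo_factor_def intro: int_poly_fun_intros)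
next
  case (Suc K)
  then obtain b b' q where q: "int_poly_fun q"
    "\<And>X. (1 + of_int a * X) * cyclo_factor b b' K X = 1 + X ^ Suc K * q X" by blast
  obtain c g where g: "int_poly_fun g" "q = (\<lambda>X. of_int c + X * g X)"
    using int_poly_fun_split[OF q(1)] by blast
  define \<sigma> where "\<sigma> = (if c \<ge> 0 then -1 else 1 :: int)"
  define n where "n = nat \<bar>c\<bar>"
  have n\<sigma>: "int n * \<sigma> = - c" by (simp add: n_def \<sigma>_def)
  obtain s where s: "int_poly_fun s"
    "\<And>X. (1 + of_int \<sigma> * X ^ Suc K) ^ n = 1 + of_int (int n * \<sigma>) * X ^ Suc K + X ^ Suc K * X ^ Suc K * s X"
    using one_plus_power_expand by blast
  define B where "B = b(Suc K := (if c \<ge> 0 then n else 0))"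
  define B' where "B' = b'(Suc K := (if c \<ge> 0 then 0 else n))"
  have "cyclo_factor B B' K X = cyclo_factor b b' K X" for X
    unfolding cyclo_factor_def B_def B'_def by (intro prod.cong) auto
  hence cf: "cyclo_factor B B' (Suc K) X = cyclo_factor b b' K X * (1 + of_int \<sigma> * X ^ Suc K) ^ n" for X
    by (simp add: cyclo_factor_def B_def B'_def \<sigma>_def)
  define q' where "q' = (\<lambda>X. g X + X ^ K * (s X - of_int c * q X + X ^ Suc K * q X * s X))"
  have "int_poly_fun q'" unfolding q'_def by (intro int_poly_fun_intros q g s)
  moreover have "(1 + of_int a * X) * cyclo_factor B B' (Suc K) X = 1 + X ^ Suc (Suc K) * q' X" for X
  proof -
    define Y where "Y = X ^ K"
    have "(1 + of_int a * X) * cyclo_factor B B' (Suc K) X =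
        (1 + X * Y * q X) * (1 + of_int (- c) * (X * Y) + X * Y * (X * Y) * s X)"
      unfolding cf mult.assoc[symmetric] q(2) s(2) n\<sigma> Y_def by simp
    also have "\<dots> = 1 + X * (X * Y) * q' X"
      unfolding q'_def using g(2) by (simp add: Y_def[symmetric] algebra_simps)
    finally show ?thesis by (simp add: Y_def)
  qed
  ultimately show ?case by blast
qed

section \<open>Local factors\<close>

theorem holomorphic_prime_product:
  fixes Q :: "nat \<Rightarrow> complex \<Rightarrow> complex"
  assumes S: "open S" and hol: "\<And>p. prime p \<Longrightarrow> Q p holomorphic_on S"
    and M: "summable M" and M0: "\<And>n. M n \<ge> 0" and bound: "\<forall>\<^sub>F p in sequentially. \<forall>w\<in>S. norm (Q p w - 1) \<le> M p"
  shows "\<exists>H. H holomorphic_on S \<and> (\<forall>w\<in>S. (\<lambda>P. \<Prod>p | prime p \<and> p < P. Q p w) \<longlonglongrightarrow> H w)"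
proof -
  define f where "f = (\<lambda>n w. if prime n then Q n w else 1)"
  have hol': "f n holomorphic_on S" for n
    using hol by (cases "prime n") (simp_all add: f_def)
  have prod_eq: "(\<Prod>p | prime p \<and> p < P. Q p w) = (\<Prod>n<P. f n w)" for P w
  proof -
    have "(\<Prod>n<P. f n w) = (\<Prod>n\<in>{n\<in>{..<P}. prime n}. Q n w)"
      unfolding f_def by (subst prod.inter_filter) auto
    also have "{n\<in>{..<P}. prime n} = {p. prime p \<and> p < P}" by auto
    finally show ?thesis by simp
  qed
  have uc: "uniformly_convergent_on A (\<lambda>P w. \<Prod>n<P. f n w)" if A: "compact A" "A \<subseteq> S" for A
  proof (rule uniformly_convergent_on_prod')
    show "continuous_on A (f n)" for n
      using hol' A by (meson continuous_on_subset holomorphic_on_imp_continuous_on)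
    show "uniformly_convergent_on A (\<lambda>N x. \<Sum>n<N. norm (f n x - 1))"
    proof (rule Weierstrass_m_test'_ev[OF _ M])
      show "\<forall>\<^sub>F n in sequentially. \<forall>x\<in>A. norm (norm (f n x - 1)) \<le> M n"
        using bound
      proof eventually_elim
        case (elim n)
        thus ?case using A(2) M0[of n] by (cases "prime n") (auto simp: f_def)
      qed
    qed
  qed fact
  define H where "H = (\<lambda>w. lim (\<lambda>P. \<Prod>n<P. f n w))"
  have ul: "uniform_limit A (\<lambda>P w. \<Prod>n<P. f n w) H sequentially" if "compact A" "A \<subseteq> S" for A
    using uc[OF that] unfolding H_def by (simp add: uniformly_convergent_uniform_limit_iff)
  have "H holomorphic_on S"
  proof (rule holomorphic_uniform_sequence[OF S])
    show "(\<lambda>w. \<Prod>n<P. f n w) holomorphic_on S" for P using hol' by (intro holomorphic_intros)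
    fix x assume "x \<in> S"
    then obtain d where "d > 0" "cball x d \<subseteq> S" using S open_contains_cball by blast
    thus "\<exists>d>0. cball x d \<subseteq> S \<and> uniform_limit (cball x d) (\<lambda>P w. \<Prod>n<P. f n w) H sequentially"
      using ul[of "cball x d"] by auto
  qed
  moreover have "(\<lambda>P. \<Prod>p | prime p \<and> p < P. Q p w) \<longlonglongrightarrow> H w" if "w \<in> S" for w
    unfolding prod_eq using tendsto_uniform_limitI[OF ul[of "{w}"]] that by simp
  ultimately show ?thesis by blast
qed

text \<open>The local factor multiplied by \<open>(1 - p X) (1 - X)\<close>, with the cancellation carried out term by term.
In this form it is holomorphic also at the zeros of \<open>1 - p X\<close>, which lie on the line \<open>Re w = 1\<close> when
\<open>X = p\<^sup>-\<^sup>w\<close>.\<close>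
definition local_numerator :: "real poly \<Rightarrow> nat \<Rightarrow> nat \<Rightarrow> complex \<Rightarrow> complex" where
  "local_numerator D N p X = of_real (coeff D 0) * (1 - X) + of_real (coeff D 1) * (1 - of_nat p * X) +
     (\<Sum>i=2..N. of_real (coeff D i) * ((1 - of_nat p * X) * (1 - X) / (1 - of_nat p / of_nat p ^ i * X)))"

text \<open>In the range \<open>\<bar>X\<bar> \<le> p\<^sup>-\<^sup>\<delta>\<close> the factor \<open>1 - p X\<close> is as large as \<open>p\<^sup>1\<^sup>-\<^sup>\<delta>\<close>, so coefficients of order
\<open>p\<^sup>-\<^sup>2\<close> contribute \<open>p\<^sup>-\<^sup>1\<^sup>-\<^sup>\<delta>\<close>, which is summable over the primes. The terms of order \<open>1/p\<close> must
therefore be known exactly: \<open>(1 + m/p) (1 - X) - (m/p) (1 - p X) = 1 + (m - 1) X - (m/p) X\<close>.\<close>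
lemma local_numerator_bound:
  assumes D: "leading_behaviour m D" and \<delta>: "0 < \<delta>" "\<delta> \<le> 1"
  shows "\<exists>C\<ge>0. \<forall>\<^sub>F p in sequentially. \<forall>X. norm X \<le> real p powr -\<delta> \<longrightarrow>
     norm (local_numerator (D p) N p X - (1 + (of_nat m - 1) * X)) \<le> C * real p powr -(1 + \<delta>)"
proof -
  have "\<exists>c>0. \<forall>\<^sub>F p in sequentially. \<bar>coeff (D p) 0 - 1 - real m / real p\<bar> \<le> c * (1 / real p ^ 2)"
    using D by (auto simp: leading_behaviour_def elim!: landau_o.bigE)
  then obtain c0 where c0: "c0 > 0" "\<forall>\<^sub>F p in sequentially. \<bar>coeff (D p) 0 - 1 - real m / real p\<bar> \<le> c0 * (1 / real p ^ 2)" by blast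
  have "\<exists>c>0. \<forall>\<^sub>F p in sequentially. \<bar>coeff (D p) 1 + real m / real p\<bar> \<le> c * (1 / real p ^ 2)"
    using D by (auto simp: leading_behaviour_def elim!: landau_o.bigE)
  then obtain c1 where c1: "c1 > 0" "\<forall>\<^sub>F p in sequentially. \<bar>coeff (D p) 1 + real m / real p\<bar> \<le> c1 * (1 / real p ^ 2)" by blast
  have "\<forall>i\<in>{2..N}. \<exists>c. c > 0 \<and> (\<forall>\<^sub>F p in sequentially. \<bar>coeff (D p) i\<bar> \<le> c * (1 / real p ^ 2))"
  proof
    fix i assume "i \<in> {2..N}"
    hence "(\<lambda>p. coeff (D p) i) \<in> O(\<lambda>p. 1 / real p ^ 2)" using D by (simp add: leading_behaviour_def)
    thus "\<exists>c. c > 0 \<and> (\<forall>\<^sub>F p in sequentially. \<bar>coeff (D p) i\<bar> \<le> c * (1 / real p ^ 2))"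
      by (auto elim!: landau_o.bigE)
  qed
  from bchoice[OF this] obtain c where c: "\<And>i. i \<in> {2..N} \<Longrightarrow> c i > 0"
    "\<And>i. i \<in> {2..N} \<Longrightarrow> \<forall>\<^sub>F p in sequentially. \<bar>coeff (D p) i\<bar> \<le> c i * (1 / real p ^ 2)" by blast
  define C where "C = c0 * 2 + c1 * 2 + real m + (\<Sum>i=2..N. c i * 8)"
  have ev: "\<forall>\<^sub>F p in sequentially. \<forall>i\<in>{2..N}. \<bar>coeff (D p) i\<bar> \<le> c i * (1 / real p ^ 2)"
    by (rule eventually_ball_finite) (use c(2) in auto)
  have "\<forall>\<^sub>F p in sequentially. \<forall>X. norm X \<le> real p powr -\<delta> \<longrightarrow>
     norm (local_numerator (D p) N p X - (1 + (of_nat m - 1) * X)) \<le> C * real p powr -(1 + \<delta>)"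
    using c0(2) c1(2) ev eventually_ge_at_top[of 2]
  proof eventually_elim
    case (elim p)
    show ?case
    proof (intro allI impI)
      fix X :: complex assume X: "norm X \<le> real p powr -\<delta>"
      define y where "y = real p powr -(1 + \<delta>)"
      have p: "real p \<ge> 2" using elim by simp
      have y0: "y > 0" using p by (simp add: y_def)
      have pow2: "1 / real p ^ 2 = real p powr -2" using p by (simp add: powr_minus_divide)
      have e2: "1 / real p ^ 2 \<le> y" unfolding pow2 y_def using p \<delta> by (intro powr_mono) auto
      have "real p powr -\<delta> \<le> real p powr 0" using p \<delta> by (intro powr_mono) auto
      hence X1: "norm X \<le> 1" using X p by simp
      have e3: "1 / real p ^ 2 * (real p * real p powr -\<delta>) = y"
      proof -
        have "1 / real p ^ 2 * (real p * real p powr -\<delta>) = real p powr -2 * (real p powr 1 * real p powr -\<delta>)"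
          unfolding pow2 using p by simp
        also have "\<dots> = y" unfolding powr_add[symmetric] y_def by simp
        finally show ?thesis .
      qed
      have pX: "norm (1 - of_nat p * X) \<le> 2 * (real p * real p powr -\<delta>)"
      proof -
        have "norm (1 - of_nat p * X) \<le> 1 + real p * norm X"
          using norm_triangle_ineq4[of 1 "of_nat p * X"] by (simp add: norm_mult)
        also have "\<dots> \<le> 1 + real p * real p powr -\<delta>" using X by (intro add_mono mult_left_mono) auto
        also have "1 = real p powr (1 + -1)" using p by simp
        also have "\<dots> \<le> real p powr (1 + -\<delta>)" using p \<delta> by (intro powr_mono) auto
        also have "\<dots> = real p * real p powr -\<delta>" using p by (subst powr_add) simp
        finally show ?thesis by simp
      qed
      have X2: "norm (1 - X) \<le> 2" using norm_triangle_ineq4[of 1 X] X1 by simp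
      let ?d = "\<lambda>i. coeff (D p) i"
      \<comment> \<open>The deviations of the coefficients of order 0 and 1 from their leading behaviour, the remainder
        of the exact main terms, and the coefficients of higher order.\<close>
      define t0 where "t0 = complex_of_real (?d 0 - 1 - real m / real p) * (1 - X)"
      define t1 where "t1 = complex_of_real (?d 1 + real m / real p) * (1 - of_nat p * X)"
      define t2 where "t2 = - (of_nat m / of_nat p * X)"
      define T where "T = (\<lambda>i. of_real (?d i) * ((1 - of_nat p * X) * (1 - X) / (1 - of_nat p / of_nat p ^ i * X)))"
      have "local_numerator (D p) N p X - (1 + (of_nat m - 1) * X) = t0 + t1 + t2 + (\<Sum>i=2..N. T i)"
        unfolding local_numerator_def t0_def t1_def t2_def T_def using p by (simp add: field_simps)
      also have "norm \<dots> \<le> norm t0 + norm t1 + norm t2 + (\<Sum>i=2..N. norm (T i))"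
        by (intro norm_triangle_le add_mono norm_sum order.refl)
      also have "\<dots> \<le> c0 * 2 * y + c1 * 2 * y + real m * y + (\<Sum>i=2..N. c i * 8 * y)"
      proof (intro add_mono sum_mono)
        have "norm t0 \<le> c0 * (1 / real p ^ 2) * 2"
          unfolding t0_def norm_mult norm_of_real using elim(1) X2 c0(1) by (intro mult_mono) auto
        also have "\<dots> \<le> c0 * y * 2" using e2 c0(1) by (intro mult_right_mono mult_left_mono) auto
        finally show "norm t0 \<le> c0 * 2 * y" by (simp add: mult_ac)
        have "norm t1 \<le> c1 * (1 / real p ^ 2) * (2 * (real p * real p powr -\<delta>))"
          unfolding t1_def norm_mult[of "of_real _"] norm_of_real using elim(2) pX c1(1) by (intro mult_mono) auto
        also have "\<dots> = c1 * 2 * (1 / real p ^ 2 * (real p * real p powr -\<delta>))" by simp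
        finally show "norm t1 \<le> c1 * 2 * y" unfolding e3 .
        have "norm t2 = real m * (1 / real p * norm X)" by (simp add: t2_def norm_mult norm_divide)
        also have "\<dots> \<le> real m * (1 / real p * real p powr -\<delta>)" using X by (intro mult_left_mono) auto
        also have "1 / real p * real p powr -\<delta> = y"
          unfolding y_def using p by (simp add: powr_add powr_diff powr_minus field_simps)
        finally show "norm t2 \<le> real m * y" .
        fix i assume i: "i \<in> {2..N}"
        have "norm (T i) = \<bar>?d i\<bar> * (norm (1 - of_nat p * X) * norm (1 - X) / norm (1 - of_nat p / of_nat p ^ i * X))"
          by (simp add: T_def norm_mult norm_divide)
        also have "\<dots> \<le> (c i * (1 / real p ^ 2)) * ((2 * (real p * real p powr -\<delta>)) * 2 / (1/2))"
        proof (intro mult_mono frac_le)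
          show "\<bar>?d i\<bar> \<le> c i * (1 / real p ^ 2)" using elim(3) i by blast
          show "1 / 2 \<le> norm (1 - of_nat p / of_nat p ^ i * X)"
          proof -
            have "real p ^ 2 \<le> real p ^ i" using i p by (intro power_increasing) auto
            hence "real p / real p ^ i \<le> real p / real p ^ 2" using p by (intro divide_left_mono) auto
            also have "\<dots> = 1 / real p" by (simp add: power2_eq_square)
            also have "\<dots> \<le> 1 / 2" using p by (intro divide_left_mono) auto
            finally have "real p / real p ^ i * norm X \<le> 1 / 2 * 1" using X1 by (intro mult_mono) auto
            hence "norm (of_nat p / of_nat p ^ i * X) \<le> 1 / 2"
              by (simp add: norm_mult norm_divide norm_power)
            thus ?thesis using norm_triangle_ineq2[of 1 "of_nat p / of_nat p ^ i * X"] by simp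
          qed
        qed (use pX X2 c(1)[OF i] in auto)
        also have "\<dots> = c i * 8 * (1 / real p ^ 2 * (real p * real p powr -\<delta>))" by simp
        finally show "norm (T i) \<le> c i * 8 * y" unfolding e3 .
      qed
      also have "\<dots> = C * y" by (simp add: C_def algebra_simps sum_distrib_left sum_distrib_right)
      finally show "norm (local_numerator (D p) N p X - (1 + (of_nat m - 1) * X)) \<le> C * real p powr -(1 + \<delta>)"
        by (simp add: y_def)
    qed
  qed
  moreover have "C \<ge> 0"
    unfolding C_def using c0(1) c1(1) c(1) by (intro add_nonneg_nonneg sum_nonneg) (auto simp: less_imp_le)
  ultimately show ?thesis by blast
qed

lemma has_sum_finite_sum:
  fixes f :: "'i \<Rightarrow> 'a \<Rightarrow> complex"
  assumes "\<And>i. i \<in> A \<Longrightarrow> (f i has_sum s i) B"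
  shows "((\<lambda>x. \<Sum>i\<in>A. f i x) has_sum (\<Sum>i\<in>A. s i)) B"
  using assms by (induction A rule: infinite_finite_induct) (auto intro!: has_sum_add)

text \<open>The normalisation: with \<open>w = u - (N - 1)\<close> and \<open>X = p\<^sup>-\<^sup>w\<close>, the geometric series of the \<open>i\<close>-th
coefficient has ratio \<open>p X / p\<^sup>i\<close>, so the first two give the poles at \<open>p X = 1\<close> and \<open>X = 1\<close>.\<close>
lemma local_factor:
  assumes p: "prime p" and lam: "sum_list lam \<ge> 1" and w: "Re w > 2"
    and X: "X = of_nat p powr (-w)" and N: "N = sum_list lam"
  shows "infsum (\<lambda>k. of_nat (fixed_point_count lam (p ^ k)) * of_nat (p ^ k) powr (-(w + of_nat N - 1))) UNIV =
         local_numerator (fixed_point_poly lam p) N p X / ((1 - of_nat p * X) * (1 - X))"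
proof -
  define D where "D = fixed_point_poly lam p"
  have p2: "real p \<ge> 2" using prime_ge_2_nat[OF p] by simp
  define P where "P = (of_nat p :: complex)"
  have P0: "P \<noteq> 0" using p2 by (auto simp: P_def)
  define x where "x = (\<lambda>i. P / P ^ i * X)"
  have normX: "norm X < 1 / real p"
  proof -
    have "norm X = real p powr (- Re w)" using p2 by (simp add: X norm_of_nat_powr)
    also have "\<dots> < real p powr (-1)" using p2 w by (intro powr_less_mono) auto
    finally show ?thesis using p2 by (simp add: powr_minus_divide)
  qed
  have normx: "norm (x i) < 1" for i
  proof -
    have "norm (x i) = real p / real p ^ i * norm X" by (simp add: x_def P_def norm_mult norm_divide norm_power)
    also have "\<dots> \<le> real p * norm X"
      using p2 by (intro mult_right_mono) (auto simp: divide_le_eq_1 field_simps intro: mult_left_le_one_le)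
    also have "\<dots> < 1" using normX p2 by (simp add: field_simps)
    finally show ?thesis .
  qed
  have pk: "of_nat (p ^ k) powr (-(w + of_nat N - 1)) = (P * X / P ^ N) ^ k" for k
  proof -
    have "of_nat p powr (-(w + of_nat N - 1)) = P * X / P ^ N"
    proof -
      have "-(w + of_nat N - 1) = (-w + 1) - of_nat N" by simp
      moreover have "P powr ((-w + 1) - of_nat N) = P powr (-w + 1) / P powr of_nat N" by (rule powr_diff)
      moreover have "P powr (-w + 1) = P powr (-w) * P powr 1" by (rule powr_add)
      moreover have "P powr of_nat N = P ^ N" using P0 by (intro powr_nat') auto
      moreover have "P powr 1 = P" using P0 by (simp add: powr_def)
      ultimately show ?thesis unfolding X P_def[symmetric] by (simp only: mult.commute)
    qed
    moreover have "of_nat (p ^ k) powr s = (of_nat p powr s) ^ k" for s :: complex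
      by (induction k) (simp_all only: power_0 power_Suc of_nat_mult_powr of_nat_1 powr_one_eq_one)
    ultimately show ?thesis by simp
  qed
  have deg: "degree D \<le> N" unfolding D_def N by (rule degree_fixed_point_poly)
  have poly_eq: "poly D y = (\<Sum>i\<le>N. coeff D i * y ^ i)" for y
    unfolding poly_altdef by (rule sum.mono_neutral_left) (use deg in \<open>auto simp: coeff_eq_0\<close>)
  have term_eq: "of_nat (fixed_point_count lam (p ^ k)) * of_nat (p ^ k) powr (-(w + of_nat N - 1)) =
      (\<Sum>i\<le>N. of_real (coeff D i) * x i ^ k)" for k
  proof -
    have "real (fixed_point_count lam (p ^ k)) = real p ^ (N * k) * (\<Sum>i\<le>N. coeff D i * (1 / real p ^ k) ^ i)"
      unfolding fixed_point_count_prime_power[OF p] N[symmetric] D_def[symmetric] poly_eq by simp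
    hence "complex_of_real (real (fixed_point_count lam (p ^ k))) = P ^ (N * k) * (\<Sum>i\<le>N. of_real (coeff D i) * (1 / P ^ k) ^ i)"
      by (simp add: P_def)
    hence "of_nat (fixed_point_count lam (p ^ k)) * of_nat (p ^ k) powr (-(w + of_nat N - 1)) =
        P ^ (N * k) * (P * X / P ^ N) ^ k * (\<Sum>i\<le>N. of_real (coeff D i) * (1 / P ^ k) ^ i)"
      unfolding pk by (simp add: mult_ac)
    also have "P ^ (N * k) * (P * X / P ^ N) ^ k = (P * X) ^ k"
      using P0 by (simp add: power_divide power_mult)
    also have "(P * X) ^ k * (\<Sum>i\<le>N. of_real (coeff D i) * (1 / P ^ k) ^ i) = (\<Sum>i\<le>N. of_real (coeff D i) * x i ^ k)"
      unfolding sum_distrib_left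
    proof (rule sum.cong[OF refl])
      fix i
      have "(P ^ i) ^ k = (P ^ k) ^ i" by (simp add: power_mult[symmetric] mult.commute)
      thus "(P * X) ^ k * (of_real (coeff D i) * (1 / P ^ k) ^ i) = of_real (coeff D i) * x i ^ k"
        by (simp add: x_def power_mult_distrib power_divide)
    qed
    finally show ?thesis .
  qed
  have "((\<lambda>k. \<Sum>i\<le>N. of_real (coeff D i) * x i ^ k) has_sum (\<Sum>i\<le>N. of_real (coeff D i) * (1 / (1 - x i)))) UNIV"
  proof (intro has_sum_finite_sum has_sum_cmult_right)
    fix i
    show "((\<lambda>k. x i ^ k) has_sum 1 / (1 - x i)) UNIV"
      using normx[of i] by (intro norm_summable_imp_has_sum geometric_sums) (simp_all add: norm_power summable_geometric)
  qed
  hence "infsum (\<lambda>k. of_nat (fixed_point_count lam (p ^ k)) * of_nat (p ^ k) powr (-(w + of_nat N - 1))) UNIV =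
      (\<Sum>i\<le>N. of_real (coeff D i) * (1 / (1 - x i)))"
    unfolding term_eq by (rule infsumI)
  also have "\<dots> = local_numerator D N p X / ((1 - of_nat p * X) * (1 - X))"
  proof -
    have ne: "1 - x i \<noteq> 0" for i using normx[of i] by auto
    have x01: "x 0 = of_nat p * X" "x 1 = X" using P0 by (auto simp: x_def P_def)
    have "{..N} = insert 0 (insert 1 {2..N})" using lam N by auto
    hence "(\<Sum>i\<le>N. of_real (coeff D i) * (1 / (1 - x i))) =
        of_real (coeff D 0) * (1 / (1 - x 0)) + of_real (coeff D 1) * (1 / (1 - x 1)) +
        (\<Sum>i=2..N. of_real (coeff D i) * (1 / (1 - x i)))" by simp
    also have "\<dots> = (of_real (coeff D 0) * (1 - x 1) + of_real (coeff D 1) * (1 - x 0) +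
        (\<Sum>i=2..N. of_real (coeff D i) * ((1 - x 0) * (1 - x 1) / (1 - x i)))) / ((1 - x 0) * (1 - x 1))"
      unfolding add_divide_distrib sum_divide_distrib using ne[of 0] ne[of 1]
      by (intro arg_cong2[where f = "(+)"] sum.cong refl) simp_all
    also have "\<dots> = local_numerator D N p X / ((1 - of_nat p * X) * (1 - X))"
      unfolding local_numerator_def x01 by (simp add: x_def P_def)
    finally show ?thesis .
  qed
  finally show ?thesis by (simp add: D_def)
qed

section \<open>Dirichlet series of fixed points and orbits\<close>

lemma abs_summable_at_of_real_weight:
  assumes "summable_weight H" "\<sigma> > 0" shows "abs_summable_at (\<lambda>n. of_real (H n)) \<sigma>"
  using assms by (simp add: abs_summable_at_def summable_weight_def)

lemma abs_summable_at_cong: "(\<And>n. n > 0 \<Longrightarrow> a n = b n) \<Longrightarrow> abs_summable_at a \<sigma> \<longleftrightarrow> abs_summable_at b \<sigma>"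
  unfolding abs_summable_at_def by (rule summable_on_cong) simp

lemma dirichlet_series_cong: "(\<And>n. n > 0 \<Longrightarrow> a n = b n) \<Longrightarrow> dirichlet_series a s = dirichlet_series b s"
  by (simp add: dirichlet_series_def del: of_nat_Suc)

lemma fixed_point_count_series:
  assumes H: "summable_weight H"
    and F: "\<And>n. n > 0 \<Longrightarrow> real (F n) = real n ^ N * (\<Sum>e | e dvd n. H e)"
    and u: "Re u > real N + 1"
  shows "abs_summable_at (\<lambda>n. of_nat (F n)) (Re u)"
    and "dirichlet_series (\<lambda>n. of_nat (F n)) u =
           zeta (u - of_nat N) * dirichlet_series (\<lambda>n. of_real (H n)) (u - of_nat N)"
proof -
  let ?H = "\<lambda>n. complex_of_real (H n)"
  let ?c = "dirichlet_prod ?H (\<lambda>_. 1)"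
  have Re: "Re (u - of_nat N) = Re u - real N" by simp
  have eq: "of_nat (F n) = of_nat n ^ N * ?c n" if "n > 0" for n
  proof -
    have "(of_nat (F n) :: complex) = of_real (real n ^ N * (\<Sum>e | e dvd n. H e))"
      unfolding F[OF that, symmetric] by simp
    thus ?thesis by (simp add: dirichlet_prod_def)
  qed
  have d: "abs_summable_at ?H (Re (u - of_nat N))" "abs_summable_at (\<lambda>_. 1) (Re (u - of_nat N))"
    using u by (auto intro!: abs_summable_at_of_real_weight[OF H] abs_summable_at_1)
  note * = dirichlet_series_dirichlet_prod[OF d]
  show "abs_summable_at (\<lambda>n. of_nat (F n)) (Re u)"
    using *(1) unfolding Re by (subst abs_summable_at_cong[OF eq]) (simp_all add: abs_summable_at_shift)
  have "dirichlet_series (\<lambda>n. of_nat (F n)) u = dirichlet_series ?c (u - of_nat N)"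
    by (subst dirichlet_series_cong[OF eq]) (simp_all add: dirichlet_series_shift)
  also have "\<dots> = dirichlet_series ?H (u - of_nat N) * zeta (u - of_nat N)"
    unfolding *(2) by (subst zeta_eq) (use u in auto)
  finally show "dirichlet_series (\<lambda>n. of_nat (F n)) u = zeta (u - of_nat N) * dirichlet_series ?H (u - of_nat N)"
    by simp
qed

text \<open>The convolution relation between orbit counts and fixed point counts, read as an identity of
Dirichlet series. Convergence of the orbit series follows from \<open>n O'(n) \<le> F(n)\<close>.\<close>
lemma orbit_series:
  assumes O: "\<And>n. n > 0 \<Longrightarrow> (\<Sum>d | d dvd n. d * O' d) = F n"
    and F: "abs_summable_at (\<lambda>n. of_nat (F n)) (Re s + 1)" and s: "Re s > 0"
  shows "abs_summable_at (\<lambda>n. of_nat (O' n)) (Re s)"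
    and "dirichlet_series (\<lambda>n. of_nat (O' n)) s * zeta (s + 1) = dirichlet_series (\<lambda>n. of_nat (F n)) (s + 1)"
proof -
  let ?O = "\<lambda>n. complex_of_nat (O' n)"
  have le: "n * O' n \<le> F n" if "n > 0" for n
    unfolding O[OF that, symmetric] by (rule member_le_sum) (use that in auto)
  have sm: "abs_summable_at (\<lambda>n. of_nat n ^ 1 * ?O n) (Re s + 1)"
    unfolding abs_summable_at_def
  proof (rule summable_on_comparison_test[OF F[unfolded abs_summable_at_def]])
    fix n :: nat assume "n \<in> {0<..}"
    hence "real (n * O' n) \<le> real (F n)" using le[of n] by (simp only: of_nat_le_iff greaterThan_iff)
    thus "norm (of_nat n ^ 1 * ?O n) * real n powr -(Re s + 1) \<le> norm (of_nat (F n) :: complex) * real n powr -(Re s + 1)"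
      by (intro mult_right_mono) (auto simp: norm_mult)
  qed auto
  thus "abs_summable_at ?O (Re s)" unfolding abs_summable_at_shift by simp
  have Re: "Re (s + 1) = Re s + 1" by simp
  have "dirichlet_series (\<lambda>n. of_nat (F n)) (s + 1) = dirichlet_series (dirichlet_prod (\<lambda>n. of_nat n ^ 1 * ?O n) (\<lambda>_. 1)) (s + 1)"
  proof (rule dirichlet_series_cong)
    fix n :: nat assume n: "n > 0"
    show "of_nat (F n) = dirichlet_prod (\<lambda>n. of_nat n ^ 1 * ?O n) (\<lambda>_. 1) n"
      unfolding O[OF n, symmetric] by (simp add: dirichlet_prod_def)
  qed
  also have "\<dots> = dirichlet_series (\<lambda>n. of_nat n ^ 1 * ?O n) (s + 1) * dirichlet_series (\<lambda>_. 1) (s + 1)"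
    by (rule dirichlet_series_dirichlet_prod(2)) (use sm s in \<open>auto simp: Re intro!: abs_summable_at_1\<close>)
  also have "dirichlet_series (\<lambda>n. of_nat n ^ 1 * ?O n) (s + 1) = dirichlet_series ?O s"
    by (subst dirichlet_series_shift) simp
  finally show "dirichlet_series ?O s * zeta (s + 1) = dirichlet_series (\<lambda>n. of_nat (F n)) (s + 1)"
    using s by (simp add: zeta_eq)
qed

lemma subgroup_number_series:
  assumes "Re u > real r"
  shows "abs_summable_at (\<lambda>n. of_nat (subgroup_number r n)) (Re u) \<and>
         dirichlet_series (\<lambda>n. of_nat (subgroup_number r n)) u = (\<Prod>i<r. zeta (u - of_nat i))"
  using assms
proof (induction r arbitrary: u)
  case 0
  have "abs_summable_at (\<lambda>n. of_nat (subgroup_number 0 n)) (Re u)"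
  proof -
    have "(\<lambda>n. norm (of_nat (subgroup_number 0 n) :: complex) * real n powr - Re u) summable_on {0<..} \<longleftrightarrow>
          (\<lambda>n. norm (of_nat (subgroup_number 0 n) :: complex) * real n powr - Re u) summable_on {1}"
      by (rule summable_on_cong_neutral) auto
    thus ?thesis by (simp add: abs_summable_at_def)
  qed
  moreover have "dirichlet_series (\<lambda>n. of_nat (subgroup_number 0 n)) u = 1"
    unfolding dirichlet_series_def by (subst suminf_finite[of "{0}"]) auto
  ultimately show ?case by simp
next
  case (Suc r)
  let ?a = "\<lambda>n. complex_of_nat (subgroup_number r n)"
  have Re: "Re (u - 1) = Re u - 1" by simp
  have IH: "abs_summable_at ?a (Re (u - 1))" "dirichlet_series ?a (u - 1) = (\<Prod>i<r. zeta (u - 1 - of_nat i))"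
    using Suc.IH[of "u - 1"] Suc.prems by auto
  have d1: "abs_summable_at (\<lambda>n. of_nat n ^ 1 * ?a n) (Re u)" using IH(1) unfolding abs_summable_at_shift Re by simp
  have d2: "abs_summable_at (\<lambda>_. 1) (Re u)" using Suc.prems by (intro abs_summable_at_1) simp
  have eq: "(\<lambda>n. of_nat (subgroup_number (Suc r) n)) = dirichlet_prod (\<lambda>n. of_nat n ^ 1 * ?a n) (\<lambda>_. 1)"
    by (rule ext) (simp add: dirichlet_prod_def)
  have "dirichlet_series (dirichlet_prod (\<lambda>n. of_nat n ^ 1 * ?a n) (\<lambda>_. 1)) u = dirichlet_series ?a (u - 1) * zeta u"
    unfolding dirichlet_series_dirichlet_prod(2)[OF d1 d2] dirichlet_series_shift
    using Suc.prems by (simp add: zeta_eq)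
  also have "\<dots> = (\<Prod>i<Suc r. zeta (u - of_nat i))"
    unfolding IH(2) prod.lessThan_Suc_shift by (simp add: algebra_simps)
  finally show ?case unfolding eq using dirichlet_series_dirichlet_prod(1)[OF d1 d2] by blast
qed

section \<open>Continuation of the fixed point series\<close>

lemma fixed_point_count_euler_product:
  assumes lam: "sum_list lam \<ge> 1" and N: "N = sum_list lam" and w: "Re w > 2"
  shows "(\<lambda>P. \<Prod>p | prime p \<and> p < P. local_numerator (fixed_point_poly lam p) N p (of_nat p powr (-w)) /
            ((1 - of_nat p * of_nat p powr (-w)) * (1 - of_nat p powr (-w))))
         \<longlonglongrightarrow> dirichlet_series (\<lambda>n. of_nat (fixed_point_count lam n)) (w + of_nat N - 1)"
proof -
  define u where "u = w + of_nat N - 1"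
  obtain H where H: "summable_weight H"
    "\<And>n. n > 0 \<Longrightarrow> real (fixed_point_count lam n) = real n ^ N * (\<Sum>e | e dvd n. H e)"
    using fixed_point_count_weight[of lam] N by blast
  have "Re u > real N + 1" using w by (simp add: u_def)
  from fixed_point_count_series(1)[OF H this]
  have d: "abs_summable_at (\<lambda>n. of_nat (fixed_point_count lam n)) (Re u)" .
  let ?f = "\<lambda>n. of_nat (fixed_point_count lam n) * of_nat n powr (-u) :: complex"
  have "multiplicative (\<lambda>n. of_nat (fixed_point_count lam n) :: complex)"
    using multiplicative_fixed_point_count[of lam] by (simp add: multiplicative_def flip: of_nat_mult)
  moreover have "multiplicative (\<lambda>n. of_nat n powr (-u) :: complex)"
    unfolding multiplicative_def of_nat_mult_powr by simp
  ultimately have "multiplicative ?f" by (rule multiplicative_mult)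
  from euler_product_limit[OF this d[unfolded abs_summable_at_iff_norm_summable]]
  have "(\<lambda>P. \<Prod>p | prime p \<and> p < P. infsum (\<lambda>k. ?f (p ^ k)) UNIV) \<longlonglongrightarrow> dirichlet_series (\<lambda>n. of_nat (fixed_point_count lam n)) u"
    unfolding dirichlet_series_infsum[OF d] .
  also have "(\<lambda>P. \<Prod>p | prime p \<and> p < P. infsum (\<lambda>k. ?f (p ^ k)) UNIV) =
    (\<lambda>P. \<Prod>p | prime p \<and> p < P. local_numerator (fixed_point_poly lam p) N p (of_nat p powr (-w)) /
            ((1 - of_nat p * of_nat p powr (-w)) * (1 - of_nat p powr (-w))))"
    unfolding u_def by (intro ext prod.cong refl local_factor[OF _ lam w refl N]) simp
  finally show ?thesis unfolding u_def .
qed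

lemma prime_powr_norm_less_1:
  assumes "prime p" "Re w > 0" shows "norm (of_nat p powr (-w) :: complex) < 1"
proof -
  have p: "real p > 1" using prime_gt_1_nat[OF assms(1)] by simp
  have "norm (of_nat p powr (-w) :: complex) = real p powr (- Re w)" using p by (simp add: norm_of_nat_powr)
  also have "\<dots> < real p powr 0" using p assms by (intro powr_less_mono) auto
  finally show ?thesis using p by simp
qed

lemma prime_powr_power:
  assumes "prime p" shows "(of_nat p powr (-w) :: complex) ^ k = of_nat p powr (-(of_nat k * w))"
  using prime_gt_0_nat[OF assms] by (simp add: powr_def exp_of_nat_mult[symmetric] mult_ac)

lemma prime_times_powr:
  assumes "prime p" shows "(of_nat p * of_nat p powr (-w) :: complex) = of_nat p powr (-(w - 1))"
proof -
  have "(of_nat p :: complex) \<noteq> 0" using prime_gt_0_nat[OF assms] by simp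
  moreover have "z powr 1 = z" if "z \<noteq> 0" for z :: complex using that by (simp add: powr_def)
  ultimately have "(of_nat p :: complex) powr 1 = of_nat p" by blast
  moreover have "of_nat p powr (1 + -w) = (of_nat p powr 1 * of_nat p powr (-w) :: complex)" by (rule powr_add)
  moreover have "-(w - 1) = 1 + -w" by simp
  ultimately show ?thesis by (simp only:)
qed

lemma one_minus_power_nonzero:
  assumes "norm X < 1" "k \<ge> 1" shows "1 - X ^ k \<noteq> (0::complex)" "1 + X ^ k \<noteq> 0"
proof -
  have "norm (X ^ k) < 1" unfolding norm_power using assms by (intro power_less_one_iff[THEN iffD2]) auto
  moreover have "norm (X ^ k) = 1" if "1 - X ^ k = 0" using that by (metis eq_iff_diff_eq_0 norm_one)
  moreover have "norm (X ^ k) = 1" if "1 + X ^ k = 0" using that by (metis add_eq_0_iff norm_minus_cancel norm_one)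
  ultimately show "1 - X ^ k \<noteq> 0" "1 + X ^ k \<noteq> 0" by auto
qed

text \<open>For \<open>Re w \<ge> \<delta>\<close> the local factor is \<open>(1 + (m - 1) X + \<dots>) / ((1 - p X) (1 - X))\<close> up to a summable
error. The denominator contributes \<open>\<zeta>(w - 1) \<zeta>(w)\<close>. For \<open>m \<ge> 3\<close> the polynomial \<open>1 + (m - 1) X\<close> is no
product of cyclotomic factors, but up to the order \<open>X\<^sup>K\<^sup>+\<^sup>1\<close> it can be inverted by such factors,
at the price of finitely many factors \<open>\<zeta>(k w)\<close> and \<open>\<zeta>(2 k w)\<close>. What remains is \<open>1\<close> up to a summable
error, and its product \<open>H\<close> is holomorphic on \<open>Re w > \<delta>\<close>.\<close>
theorem fixed_point_count_continuation:
  assumes lam: "\<forall>r\<in>set lam. r \<ge> 1" "lam \<noteq> []" and N: "N = sum_list lam" and \<delta>: "0 < \<delta>" "\<delta> \<le> 1"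
  shows "\<exists>\<Psi>. \<Psi> meromorphic_on {w. Re w > \<delta>} \<and>
     (\<forall>w. Re w > 2 \<longrightarrow> \<Psi> w = dirichlet_series (\<lambda>n. of_nat (fixed_point_count lam n)) (w + of_nat N - 1))"
proof -
  have N1: "sum_list lam \<ge> 1" using lam by (cases lam) auto
  define m where "m = length lam"
  \<comment> \<open>Large enough for \<open>\<bar>X\<bar>\<^sup>K\<^sup>+\<^sup>1 \<le> p\<^sup>-\<^sup>1\<^sup>-\<^sup>\<delta>\<close>.\<close>
  define K where "K = nat \<lceil>1 / \<delta>\<rceil>"
  have K: "\<delta> * real (Suc K) \<ge> 1 + \<delta>"
  proof -
    have "real K \<ge> 1 / \<delta>" unfolding K_def using \<delta> by linarith
    hence "\<delta> * real K \<ge> 1" using \<delta> by (simp add: field_simps)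
    thus ?thesis by (simp add: algebra_simps)
  qed
  obtain b b' q where q: "int_poly_fun q"
    "\<And>X. (1 + of_int (int m - 1) * X) * cyclo_factor b b' K X = 1 + X ^ Suc K * q X"
    using cyclo_factor_exists by blast
  obtain Bq where Bq: "Bq \<ge> 0" "\<And>X. norm X \<le> 1 \<Longrightarrow> norm (q X) \<le> Bq"
    using int_poly_fun_bounded[OF q(1)] by blast
  define V where "V = cyclo_factor b b' K"
  obtain BV where BV: "BV \<ge> 0" "\<And>X. norm X \<le> 1 \<Longrightarrow> norm (V X) \<le> BV"
    using int_poly_fun_bounded[OF int_poly_fun_cyclo_factor] unfolding V_def by blast
  define D where "D = fixed_point_poly lam"
  have lead: "leading_behaviour m D"
    unfolding m_def D_def by (rule leading_behaviour_fixed_point_poly[OF lam(1)])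
  obtain C where C: "C \<ge> 0" "\<forall>\<^sub>F p in sequentially. \<forall>X. norm X \<le> real p powr -\<delta> \<longrightarrow>
     norm (local_numerator (D p) N p X - (1 + (of_nat m - 1) * X)) \<le> C * real p powr -(1 + \<delta>)"
    using local_numerator_bound[OF lead \<delta>] by blast
  define X where "X = (\<lambda>p w. of_nat p powr (-w) :: complex)"
  define Q where "Q = (\<lambda>p w. local_numerator (D p) N p (X p w) * V (X p w))"
  define S where "S = {w. Re w > \<delta>}"
  have hol: "Q p holomorphic_on S" if p: "prime p" for p
  proof -
    have p2: "real p \<ge> 2" using prime_ge_2_nat[OF p] by simp
    have ne: "1 - of_nat p / of_nat p ^ i * X p w \<noteq> 0" if "w \<in> S" "i \<in> {2..N}" for w i
    proof -
      have "norm (X p w) < 1" unfolding X_def using that \<delta> p by (intro prime_powr_norm_less_1) (auto simp: S_def)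
      moreover have "real p ^ 1 \<le> real p ^ i" using that p2 by (intro power_increasing) auto
      hence "real p / real p ^ i \<le> 1" using p2 by (simp add: divide_le_eq_1)
      ultimately have "real p / real p ^ i * norm (X p w) \<le> 1 * norm (X p w)" by (intro mult_right_mono) auto
      hence "norm (of_nat p / of_nat p ^ i * X p w) < 1"
        using \<open>norm (X p w) < 1\<close> by (simp add: norm_mult norm_divide norm_power)
      from one_minus_power_nonzero(1)[OF this order.refl] show ?thesis unfolding power_one_right .
    qed
    have "X p holomorphic_on S"
      unfolding X_def using p2 by (intro holomorphic_intros) auto
    thus ?thesis
      unfolding Q_def local_numerator_def V_def cyclo_factor_def
      by (intro holomorphic_intros ne) auto
  qed
  define M where "M = (\<lambda>p::nat. (C * BV + Bq) * real p powr -(1 + \<delta>))"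
  have "summable M"
    unfolding M_def using \<delta> by (intro summable_mult) (simp add: summable_real_powr_iff)
  moreover have "M p \<ge> 0" for p using C BV Bq by (simp add: M_def)
  moreover have "\<forall>\<^sub>F p in sequentially. \<forall>w\<in>S. norm (Q p w - 1) \<le> M p"
    using C(2) eventually_ge_at_top[of 2]
  proof eventually_elim
    case (elim p)
    show ?case
    proof
      fix w assume w: "w \<in> S"
      have p: "real p \<ge> 2" using elim by simp
      have nX: "norm (X p w) = real p powr (- Re w)" using elim by (simp add: X_def norm_of_nat_powr)
      also have "\<dots> \<le> real p powr -\<delta>" using p w by (intro powr_mono) (auto simp: S_def)
      finally have X: "norm (X p w) \<le> real p powr -\<delta>" .
      also have "real p powr -\<delta> \<le> real p powr 0" using p \<delta> by (intro powr_mono) auto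
      finally have X1: "norm (X p w) \<le> 1" using p by simp
      have "Q p w - 1 = (local_numerator (D p) N p (X p w) - (1 + (of_nat m - 1) * X p w)) * V (X p w) + X p w ^ Suc K * q (X p w)"
        using q(2)[of "X p w"] unfolding Q_def V_def by (simp add: algebra_simps)
      also have "norm \<dots> \<le> (C * real p powr -(1 + \<delta>)) * BV + real p powr -(1 + \<delta>) * Bq"
      proof (rule norm_triangle_le, unfold norm_mult, intro add_mono mult_mono)
        show "norm (local_numerator (D p) N p (X p w) - (1 + (of_nat m - 1) * X p w)) \<le> C * real p powr -(1 + \<delta>)"
          using elim(1) X by blast
        have "norm (X p w ^ Suc K) \<le> (real p powr -\<delta>) ^ Suc K"
          unfolding norm_power using X by (intro power_mono) auto
        also have "\<dots> = real p powr (-\<delta> * real (Suc K))"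
          using p by (subst powr_realpow[symmetric]) (simp_all only: powr_powr, simp)
        also have "\<dots> \<le> real p powr -(1 + \<delta>)" using p K by (intro powr_mono) auto
        finally show "norm (X p w ^ Suc K) \<le> real p powr -(1 + \<delta>)" .
      qed (use C BV Bq X1 in auto)
      also have "\<dots> = M p" by (simp add: M_def algebra_simps)
      finally show "norm (Q p w - 1) \<le> M p" .
    qed
  qed
  ultimately obtain H where H: "H holomorphic_on S" "\<And>w. w \<in> S \<Longrightarrow> (\<lambda>P. \<Prod>p | prime p \<and> p < P. Q p w) \<longlonglongrightarrow> H w"
    using holomorphic_prime_product[of S Q M] hol open_halfplane[of \<delta>] unfolding S_def by blast
  define \<Psi> where "\<Psi> = (\<lambda>w. H w * zeta (1 * w + (-1)) * zeta (1 * w + 0) *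
     (\<Prod>k=1..K. zeta (of_nat k * w + 0) ^ b k * (zeta (of_nat (2 * k) * w + 0) / zeta (of_nat k * w + 0)) ^ b' k))"
  have "H meromorphic_on S"
    using H(1) by (intro analytic_on_imp_meromorphic_on) (simp add: analytic_on_open open_halfplane S_def)
  hence "\<Psi> meromorphic_on S"
    unfolding \<Psi>_def by (intro meromorphic_intros)
  moreover have "\<Psi> w = dirichlet_series (\<lambda>n. of_nat (fixed_point_count lam n)) (w + of_nat N - 1)" if w: "Re w > 2" for w
  proof -
    define z where "z = (\<lambda>p s. 1 / (1 - of_nat p powr (-s)) :: complex)"
    have zlim: "(\<lambda>P. \<Prod>p | prime p \<and> p < P. z p s) \<longlonglongrightarrow> zeta s" if "Re s > 1" for s
      unfolding z_def by (rule euler_product_zeta[OF that])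
    have wS: "w \<in> S" using w \<delta> by (simp add: S_def)
    have Rek: "Re (of_nat k * w) \<ge> 2" if "k \<ge> 1" for k
    proof -
      have "1 * 2 \<le> real k * Re w" using w that by (intro mult_mono) auto
      thus ?thesis by simp
    qed
    have "(\<lambda>P. (\<Prod>p | prime p \<and> p < P. Q p w) * (\<Prod>p | prime p \<and> p < P. z p (w - 1)) * (\<Prod>p | prime p \<and> p < P. z p w) *
        (\<Prod>k=1..K. (\<Prod>p | prime p \<and> p < P. z p (of_nat k * w)) ^ b k *
          ((\<Prod>p | prime p \<and> p < P. z p (of_nat (2 * k) * w)) / (\<Prod>p | prime p \<and> p < P. z p (of_nat k * w))) ^ b' k))
       \<longlonglongrightarrow> H w * zeta (w - 1) * zeta w * (\<Prod>k=1..K. zeta (of_nat k * w) ^ b k * (zeta (of_nat (2 * k) * w) / zeta (of_nat k * w)) ^ b' k)"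
    proof (intro tendsto_mult tendsto_prod tendsto_power tendsto_divide zlim H(2) wS)
      show "Re (w - 1) > 1" "Re w > 1" using w by auto
      fix k assume k: "k \<in> {1..K}"
      show "Re (of_nat k * w) > 1" "Re (of_nat k * w) > 1" "Re (of_nat (2 * k) * w) > 1"
        using Rek[of k] Rek[of "2 * k"] k by auto
      show "zeta (of_nat k * w) \<noteq> 0" using Rek[of k] k by (intro zeta_nonzero) auto
    qed
    also have "(\<lambda>P. (\<Prod>p | prime p \<and> p < P. Q p w) * (\<Prod>p | prime p \<and> p < P. z p (w - 1)) * (\<Prod>p | prime p \<and> p < P. z p w) *
        (\<Prod>k=1..K. (\<Prod>p | prime p \<and> p < P. z p (of_nat k * w)) ^ b k *
          ((\<Prod>p | prime p \<and> p < P. z p (of_nat (2 * k) * w)) / (\<Prod>p | prime p \<and> p < P. z p (of_nat k * w))) ^ b' k)) =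
       (\<lambda>P. \<Prod>p | prime p \<and> p < P. local_numerator (fixed_point_poly lam p) N p (of_nat p powr (-w)) /
            ((1 - of_nat p * of_nat p powr (-w)) * (1 - of_nat p powr (-w))))"
    proof
      fix P :: nat
      let ?A = "{p. prime p \<and> p < P}"
      have "(\<Prod>p\<in>?A. Q p w) * (\<Prod>p\<in>?A. z p (w - 1)) * (\<Prod>p\<in>?A. z p w) *
        (\<Prod>k=1..K. (\<Prod>p\<in>?A. z p (of_nat k * w)) ^ b k *
          ((\<Prod>p\<in>?A. z p (of_nat (2 * k) * w)) / (\<Prod>p\<in>?A. z p (of_nat k * w))) ^ b' k) =
        (\<Prod>p\<in>?A. Q p w * z p (w - 1) * z p w * (\<Prod>k=1..K. z p (of_nat k * w) ^ b k * (z p (of_nat (2 * k) * w) / z p (of_nat k * w)) ^ b' k))"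
        unfolding prod_power_distrib prod_dividef[symmetric] prod.distrib[symmetric]
        by (subst prod.swap) (simp only: prod.distrib)
      also have "\<dots> = (\<Prod>p\<in>?A. local_numerator (fixed_point_poly lam p) N p (of_nat p powr (-w)) /
            ((1 - of_nat p * of_nat p powr (-w)) * (1 - of_nat p powr (-w))))"
      proof (rule prod.cong[OF refl])
        fix p assume "p \<in> ?A"
        hence p: "prime p" by simp
        let ?X = "X p w"
        have X1: "norm ?X < 1" unfolding X_def using p w by (intro prime_powr_norm_less_1) auto
        have zk: "z p (of_nat k * w) = 1 / (1 - ?X ^ k)" for k
          unfolding z_def X_def prime_powr_power[OF p] ..
        have z1: "z p (w - 1) = 1 / (1 - of_nat p * ?X)" "z p w = 1 / (1 - ?X)"
          unfolding z_def X_def prime_times_powr[OF p] by auto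
        have "z p (of_nat k * w) ^ b k * (z p (of_nat (2 * k) * w) / z p (of_nat k * w)) ^ b' k =
              1 / ((1 - ?X ^ k) ^ b k * (1 + ?X ^ k) ^ b' k)" if "k \<in> {1..K}" for k
        proof -
          have ne: "1 - ?X ^ k \<noteq> 0" "1 + ?X ^ k \<noteq> 0"
            using one_minus_power_nonzero[OF X1, of k] that by auto
          have "?X ^ (2 * k) = ?X ^ k * ?X ^ k" by (simp add: mult_2 power_add)
          hence "1 - ?X ^ (2 * k) = (1 - ?X ^ k) * (1 + ?X ^ k)" by (simp add: algebra_simps)
          hence "z p (of_nat (2 * k) * w) / z p (of_nat k * w) = 1 / (1 + ?X ^ k)"
            unfolding zk using ne by simp
          thus ?thesis unfolding zk by (simp add: power_one_over)
        qed
        hence "(\<Prod>k=1..K. z p (of_nat k * w) ^ b k * (z p (of_nat (2 * k) * w) / z p (of_nat k * w)) ^ b' k) =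
              (\<Prod>k=1..K. 1 / ((1 - ?X ^ k) ^ b k * (1 + ?X ^ k) ^ b' k))" by (intro prod.cong) auto
        also have "\<dots> = 1 / V ?X" unfolding V_def cyclo_factor_def prod_dividef by simp
        finally have 1: "(\<Prod>k=1..K. z p (of_nat k * w) ^ b k * (z p (of_nat (2 * k) * w) / z p (of_nat k * w)) ^ b' k) = 1 / V ?X" .
        have "V ?X \<noteq> 0"
          unfolding V_def cyclo_factor_def using one_minus_power_nonzero[OF X1] by (simp add: prod_zero_iff)
        thus "Q p w * z p (w - 1) * z p w * (\<Prod>k=1..K. z p (of_nat k * w) ^ b k * (z p (of_nat (2 * k) * w) / z p (of_nat k * w)) ^ b' k) =
            local_numerator (fixed_point_poly lam p) N p (of_nat p powr (-w)) /
            ((1 - of_nat p * of_nat p powr (-w)) * (1 - of_nat p powr (-w)))"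
          unfolding 1 z1 Q_def D_def by (simp add: X_def)
      qed
      finally show "(\<Prod>p\<in>?A. Q p w) * (\<Prod>p\<in>?A. z p (w - 1)) * (\<Prod>p\<in>?A. z p w) *
        (\<Prod>k=1..K. (\<Prod>p\<in>?A. z p (of_nat k * w)) ^ b k *
          ((\<Prod>p\<in>?A. z p (of_nat (2 * k) * w)) / (\<Prod>p\<in>?A. z p (of_nat k * w))) ^ b' k) =
        (\<Prod>p\<in>?A. local_numerator (fixed_point_poly lam p) N p (of_nat p powr (-w)) /
            ((1 - of_nat p * of_nat p powr (-w)) * (1 - of_nat p powr (-w))))" .
    qed
    finally have "H w * zeta (w - 1) * zeta w * (\<Prod>k=1..K. zeta (of_nat k * w) ^ b k * (zeta (of_nat (2 * k) * w) / zeta (of_nat k * w)) ^ b' k)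
       = dirichlet_series (\<lambda>n. of_nat (fixed_point_count lam n)) (w + of_nat N - 1)"
      using fixed_point_count_euler_product[OF N1 N w] by (rule LIMSEQ_unique)
    thus ?thesis by (simp add: \<Psi>_def)
  qed
  ultimately show ?thesis unfolding S_def by blast
qed

section \<open>Continuation of the orbit series\<close>

text \<open>For a single part, the fixed point series is itself a product of translates of \<open>\<zeta>\<close>.\<close>
lemma fixed_point_series_single:
  assumes s: "Re s > real r" and r: "r \<ge> 1"
  shows "dirichlet_series (\<lambda>n. of_nat (fixed_point_count [r] n)) (s + 1) = (\<Prod>i<r. zeta (s - of_nat i)) * zeta (s + 1)"
proof -
  have "fixed_point_count [r] = subgroup_number (Suc r)"
    by (rule ext) (simp add: fixed_point_count_def del: subgroup_number.simps)
  hence "dirichlet_series (\<lambda>n. of_nat (fixed_point_count [r] n)) (s + 1) = (\<Prod>i<Suc r. zeta (s + 1 - of_nat i))"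
    using subgroup_number_series[of "Suc r" "s + 1"] s by simp
  also have "\<dots> = zeta (s + 1) * (\<Prod>i<r. zeta (s - of_nat i))"
    unfolding prod.lessThan_Suc_shift by simp
  finally show ?thesis by simp
qed

text \<open>For the partition \<open>(1, 1)\<close> no error term is left: the local factor at \<open>X = p\<^sup>-\<^sup>w\<close> is exactly
\<open>(1 - X\<^sup>2) / ((1 - X/p) (1 - X)\<^sup>2 (1 - p X))\<close>.\<close>
lemma local_numerator_1_1:
  assumes p: "p \<ge> 2" and X: "norm X < 1"
  shows "local_numerator (fixed_point_poly [1, 1] p) 2 p X = (1 + X) / (1 - X / of_nat p)"
proof -
  define P where "P = (of_nat p :: complex)"
  have P: "P \<noteq> 0" "P - 1 \<noteq> 0"
    using p by (auto simp: P_def)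
  have PX: "P - X \<noteq> 0"
  proof
    assume "P - X = 0"
    hence "X = of_nat p" by (simp add: P_def)
    hence "norm X = real p" by simp
    thus False using X p by simp
  qed
  have D: "fixed_point_poly [1, 1] p = linear_factor 1 p * linear_factor 1 p"
    by (simp add: fixed_point_poly_def)
  define c where "c = real p / (real p - 1)" 
  define d where "d = -1 / (real p - 1)"
  have lf: "linear_factor 1 p = [:c, d:]" by (simp add: linear_factor_def c_def d_def)
  have D': "fixed_point_poly [1, 1] p = [:c * c, c * d + d * c, d * d:]"
    unfolding D lf by (simp add: algebra_simps)
  have cd: "complex_of_real c = P / (P - 1)" "complex_of_real d = -1 / (P - 1)"
    using p by (simp_all add: c_def d_def P_def of_real_diff)
  have "local_numerator (fixed_point_poly [1, 1] p) 2 p X =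
     P / (P - 1) * (P / (P - 1)) * (1 - X) + 2 * (P / (P - 1)) * (-1 / (P - 1)) * (1 - P * X) +
     (1 / (P - 1)) * (1 / (P - 1)) * ((1 - P * X) * (1 - X) / (1 - X / P))"
    unfolding local_numerator_def D' using P
    by (simp add: cd numeral_2_eq_2 P_def[symmetric])
  also have "1 - X / P = (P - X) / P" using P by (simp add: field_simps)
  also have "P / (P - 1) * (P / (P - 1)) * (1 - X) + 2 * (P / (P - 1)) * (-1 / (P - 1)) * (1 - P * X) +
     (1 / (P - 1)) * (1 / (P - 1)) * ((1 - P * X) * (1 - X) / ((P - X) / P)) =
     (P * P * (1 - X) * (P - X) - 2 * P * (1 - P * X) * (P - X) + P * (1 - P * X) * (1 - X)) / ((P - 1) * (P - 1) * (P - X))"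
    using P PX by (simp add: divide_simps) (simp add: algebra_simps)
  also have "P * P * (1 - X) * (P - X) - 2 * P * (1 - P * X) * (P - X) + P * (1 - P * X) * (1 - X) =
      (P - 1) * (P - 1) * (P * (1 + X))"
    by (simp add: algebra_simps)
  also have "(P - 1) * (P - 1) * (P * (1 + X)) / ((P - 1) * (P - 1) * (P - X)) = (1 + X) / ((P - X) / P)"
    using P PX by (simp add: divide_simps)
  also have "(P - X) / P = 1 - X / of_nat p" using P by (simp add: field_simps P_def)
  finally show ?thesis .
qed

text \<open>Ramanujan's formula for \<open>\<Sum> \<sigma>(n)\<^sup>2 n\<^sup>-\<^sup>u\<close> at \<open>u = s + 1\<close>, since \<open>\<sigma>(n)\<close> is the number of subgroups of
index \<open>n\<close> in \<open>\<int>\<^sup>2\<close>.\<close>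
lemma ramanujan_identity:
  assumes s: "Re s > 2"
  shows "dirichlet_series (\<lambda>n. of_nat (fixed_point_count [1, 1] n)) (s + 1) =
     zeta s * zeta s * zeta (s - 1) / zeta (2 * s) * zeta (s + 1)"
proof -
  define z where "z = (\<lambda>p s. 1 / (1 - of_nat p powr (-s)) :: complex)"
  have zlim: "(\<lambda>P. \<Prod>p | prime p \<and> p < P. z p t) \<longlonglongrightarrow> zeta t" if "Re t > 1" for t
    unfolding z_def by (rule euler_product_zeta[OF that])
  have "(\<lambda>P. (\<Prod>p | prime p \<and> p < P. z p s) * (\<Prod>p | prime p \<and> p < P. z p s) * (\<Prod>p | prime p \<and> p < P. z p (s - 1))
        / (\<Prod>p | prime p \<and> p < P. z p (of_nat 2 * s)) * (\<Prod>p | prime p \<and> p < P. z p (s + 1)))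
      \<longlonglongrightarrow> zeta s * zeta s * zeta (s - 1) / zeta (of_nat 2 * s) * zeta (s + 1)"
    using s by (intro tendsto_mult tendsto_divide zlim zeta_nonzero) auto
  also have "(\<lambda>P. (\<Prod>p | prime p \<and> p < P. z p s) * (\<Prod>p | prime p \<and> p < P. z p s) * (\<Prod>p | prime p \<and> p < P. z p (s - 1))
        / (\<Prod>p | prime p \<and> p < P. z p (of_nat 2 * s)) * (\<Prod>p | prime p \<and> p < P. z p (s + 1))) =
      (\<lambda>P. \<Prod>p | prime p \<and> p < P. local_numerator (fixed_point_poly [1, 1] p) 2 p (of_nat p powr (-s)) /
            ((1 - of_nat p * of_nat p powr (-s)) * (1 - of_nat p powr (-s))))"
    unfolding prod_dividef[symmetric] prod.distrib[symmetric]
  proof (intro ext prod.cong refl)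
    fix P p :: nat assume "p \<in> {p. prime p \<and> p < P}"
    hence p: "prime p" by simp
    have p0: "(of_nat p :: complex) \<noteq> 0" using prime_gt_0_nat[OF p] by simp
    define X where "X = (of_nat p powr (-s) :: complex)"
    have X: "norm X < 1" unfolding X_def using p s by (intro prime_powr_norm_less_1) auto
    have ne: "1 - X \<noteq> 0" "1 + X \<noteq> 0"
      using one_minus_power_nonzero[OF X order.refl] by simp_all
    have z2: "z p (of_nat 2 * s) = 1 / ((1 - X) * (1 + X))"
      unfolding z_def prime_powr_power[OF p, symmetric] X_def[symmetric]
      by (simp add: power2_eq_square algebra_simps)
    have z1: "z p s = 1 / (1 - X)" "z p (s - 1) = 1 / (1 - of_nat p * X)"
      unfolding z_def X_def prime_times_powr[OF p] by auto
    have "of_nat p powr (-(s + 1)) = X / of_nat p"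
    proof -
      have "z powr 1 = z" if "z \<noteq> 0" for z :: complex using that by (simp add: powr_def)
      hence "(of_nat p :: complex) powr 1 = of_nat p" using p0 by blast
      moreover have "of_nat p powr (-s - 1) = (of_nat p powr (-s) / of_nat p powr 1 :: complex)" by (rule powr_diff)
      moreover have "-(s + 1) = -s - 1" by simp
      ultimately show ?thesis by (simp only: X_def)
    qed
    hence z3: "z p (s + 1) = 1 / (1 - X / of_nat p)" by (simp add: z_def)
    show "z p s * z p s * z p (s - 1) / z p (of_nat 2 * s) * z p (s + 1) =
        local_numerator (fixed_point_poly [1, 1] p) 2 p (of_nat p powr (-s)) /
            ((1 - of_nat p * of_nat p powr (-s)) * (1 - of_nat p powr (-s)))"
      unfolding X_def[symmetric] local_numerator_1_1[OF prime_ge_2_nat[OF p] X] z1 z2 z3 using ne by simp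
  qed
  finally have "zeta s * zeta s * zeta (s - 1) / zeta (of_nat 2 * s) * zeta (s + 1) =
      dirichlet_series (\<lambda>n. of_nat (fixed_point_count [1, 1] n)) (s + of_nat 2 - 1)"
    using fixed_point_count_euler_product[of "[1, 1]" 2 s] s by (intro LIMSEQ_unique) auto
  thus ?thesis by (simp add: algebra_simps)
qed

text \<open>To the right of \<open>N - 1\<close> the function is \<open>base s = \<zeta>(s - N + 1) B(s - N + 1) / \<zeta>(s + 1)\<close>, where \<open>B\<close> is
the Dirichlet series of the weight \<open>H\<close>. On the line \<open>Re s = N\<close> the argument of \<open>B\<close> has real part
\<open>1\<close> and that of the denominator at least \<open>2\<close>, so the only singularity is the one of \<open>\<zeta>\<close> at \<open>1\<close>;
it does not cancel because \<open>B(1)\<close> is a sum of nonnegative terms with first term \<open>1\<close>. The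
continuations further to the left are glued to \<open>base\<close>, so that the analysis on the line does not
depend on them.\<close>
theorem orbit_series_continuation:
  fixes O' :: "nat \<Rightarrow> nat"
  assumes lam: "lam \<noteq> []" "\<forall>r\<in>set lam. r \<ge> 1" and N: "N = sum_list lam"
    and O: "\<And>n. n > 0 \<Longrightarrow> (\<Sum>d | d dvd n. d * O' d) = fixed_point_count lam n"
  shows "\<exists>f. f meromorphic_on (if length lam = 1 \<or> lam = [1, 1] then UNIV else {s. Re s > real N - 2}) \<and>
          (\<forall>s. Re s > real N \<longrightarrow> f s = dirichlet_series (\<lambda>n. of_nat (O' n)) s) \<and>
          f analytic_on ({s. Re s = real N} - {of_nat N}) \<and>
          is_pole f (of_nat N) \<and> zorder f (of_nat N) = -1"
    (is "\<exists>f. f meromorphic_on ?A \<and> _")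
    and "\<And>\<sigma>. \<sigma> > real N \<Longrightarrow> abs_summable_at (\<lambda>n. of_nat (O' n)) \<sigma>"
proof -
  have N1: "N \<ge> 1" using lam N by (cases lam) auto
  obtain H where H: "summable_weight H"
    "\<And>n. n > 0 \<Longrightarrow> real (fixed_point_count lam n) = real n ^ N * (\<Sum>e | e dvd n. H e)"
    using fixed_point_count_weight[of lam] N by blast
  let ?O = "dirichlet_series (\<lambda>n. of_nat (O' n))"
  let ?F = "dirichlet_series (\<lambda>n. of_nat (fixed_point_count lam n))"
  define B where "B = dirichlet_series (\<lambda>n. of_real (H n))"
  have F: "abs_summable_at (\<lambda>n. of_nat (fixed_point_count lam n)) (Re s + 1)" "?F (s + 1) = zeta (s + 1 - of_nat N) * B (s + 1 - of_nat N)"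
    if "Re s > real N" for s
    using fixed_point_count_series[OF H, of "s + 1"] that by (auto simp: B_def)
  have OF: "abs_summable_at (\<lambda>n. of_nat (O' n)) (Re s)" "?O s * zeta (s + 1) = ?F (s + 1)" if "Re s > real N" for s
    using orbit_series[OF O F(1)[OF that]] that by auto
  have z_ne: "zeta (s + 1) \<noteq> 0" if "Re s \<ge> real N" for s
    using that N1 by (intro zeta_nonzero) simp
  have OF': "?O s = ?F (s + 1) / zeta (s + 1)" if "Re s > real N" for s
    using OF(2)[OF that] z_ne[of s] that by (simp add: field_simps)
  show "abs_summable_at (\<lambda>n. of_nat (O' n)) \<sigma>" if "\<sigma> > real N" for \<sigma>
    using OF(1)[of "of_real \<sigma>"] that by simp

  have B_hol: "B holomorphic_on {v. Re v > 0}"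
    unfolding B_def by (rule holomorphic_dirichlet_series) (rule abs_summable_at_of_real_weight[OF H(1)])
  hence B_an: "B analytic_on {v. Re v > 0}" by (simp add: analytic_on_open open_halfplane)
  have shift_an: "(\<lambda>s. B (s - of_nat N + 1)) analytic_on {s. Re s > real N - 1}"
    by (rule analytic_on_compose_gen[OF _ B_an, unfolded o_def]) (auto intro!: analytic_intros)
  define base where "base = (\<lambda>s. zeta (1 * s + (1 - of_nat N)) * B (s - of_nat N + 1) / zeta (1 * s + 1))"
  have base_mero: "base meromorphic_on {s. Re s > real N - 1}"
    unfolding base_def by (intro meromorphic_intros analytic_on_imp_meromorphic_on shift_an)
  have base_eq: "base s = ?O s" if "Re s > real N" for s
    unfolding OF'[OF that] F(2)[OF that] base_def by (simp add: algebra_simps)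
  have base_an: "base analytic_on {s. Re s \<ge> real N} - {of_nat N}"
  proof -
    have "(\<lambda>s. zeta (1 * s + (1 - of_nat N))) analytic_on {s. Re s \<ge> real N} - {of_nat N}"
      by (rule analytic_on_compose_gen[OF _ zeta_analytic, unfolded o_def]) (auto intro!: analytic_intros)
    moreover have "(\<lambda>s. zeta (1 * s + 1)) analytic_on {s. Re s \<ge> real N} - {of_nat N}"
      using N1 by (intro analytic_on_compose_gen[OF _ zeta_analytic, unfolded o_def]) (auto intro!: analytic_intros simp: complex_eq_iff)
    moreover have "(\<lambda>s. B (s - of_nat N + 1)) analytic_on {s. Re s \<ge> real N} - {of_nat N}"
      by (rule analytic_on_subset[OF shift_an]) auto
    ultimately show ?thesis
      unfolding base_def using z_ne by (intro analytic_intros) auto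
  qed

  obtain G where G: "G holomorphic_on {s. Re s > 0}" "G 1 = 1" "\<And>s. Re s > 0 \<Longrightarrow> s \<noteq> 1 \<Longrightarrow> zeta s = G s / (s - 1)"
    using zeta_pole by blast
  \<comment> \<open>The regular part of base at N: the pole of zeta contributes the factor G / (s - N).\<close>
  define \<phi> where "\<phi> = (\<lambda>s. G (s - of_nat N + 1) * B (s - of_nat N + 1) / zeta (s + 1))"
  have \<phi>_an: "\<phi> analytic_on {of_nat N}"
  proof -
    have "G analytic_on {s. Re s > 0}" using G(1) by (simp add: analytic_on_open open_halfplane)
    hence "(\<lambda>s. G (s - of_nat N + 1)) analytic_on {of_nat N}"
      by (rule analytic_on_compose_gen[rotated, unfolded o_def]) (auto intro!: analytic_intros)
    moreover have "(\<lambda>s. B (s - of_nat N + 1)) analytic_on {of_nat N}"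
      by (rule analytic_on_subset[OF shift_an]) auto
    moreover have "(\<lambda>s. zeta (s + 1)) analytic_on {of_nat N}"
      using N1 by (intro analytic_on_compose_gen[OF _ zeta_analytic, unfolded o_def]) (auto intro!: analytic_intros simp: complex_eq_iff)
    ultimately show ?thesis
      unfolding \<phi>_def using z_ne by (intro analytic_intros) auto
  qed
  have B1: "B 1 \<noteq> 0"
  proof -
    have hs: "(\<lambda>n. H n * real n powr -1) summable_on {0<..}"
      using H(1) zero_less_one unfolding summable_weight_def by blast
    have "B 1 = infsum (\<lambda>n. complex_of_real (H n) * of_nat n powr (-1)) {0<..}"
      unfolding B_def by (rule dirichlet_series_infsum) (use abs_summable_at_of_real_weight[OF H(1), of 1] in simp)
    also have "\<dots> = infsum (\<lambda>n. complex_of_real (H n * real n powr -1)) {0<..}"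
    proof (rule infsum_cong)
      fix n :: nat assume "n \<in> {0<..}"
      thus "complex_of_real (H n) * of_nat n powr (-1) = complex_of_real (H n * real n powr -1)"
        using powr_of_real[of "real n" "-1"] by simp
    qed
    also have "\<dots> = of_real (infsum (\<lambda>n. H n * real n powr -1) {0<..})"
      using hs by (intro infsumI has_sum_of_real) (simp add: has_sum_infsum)
    finally have B1: "B 1 = of_real (infsum (\<lambda>n. H n * real n powr -1) {0<..})" .
    have "(\<Sum>n\<in>{1}. H n * real n powr -1) \<le> infsum (\<lambda>n. H n * real n powr -1) {0<..}"
      using H(1) by (intro finite_sum_le_infsum[OF hs]) (auto simp: summable_weight_def)
    moreover have "(\<Sum>n\<in>{1}. H n * real n powr -1) = 1" using H(1) by (simp add: summable_weight_def)
    ultimately have "infsum (\<lambda>n. H n * real n powr -1) {0<..} \<noteq> 0" by linarith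
    thus ?thesis unfolding B1 of_real_eq_0_iff .
  qed
  have \<phi>N: "\<phi> (of_nat N) \<noteq> 0" using G(2) B1 z_ne[of "of_nat N"] by (simp add: \<phi>_def)
  obtain U where U: "open U" "of_nat N \<in> U" "\<phi> holomorphic_on U"
    using \<phi>_an unfolding analytic_at by blast
  define U' where "U' = U \<inter> {s. Re s > real N - 1}"
  have U': "open U'" "of_nat N \<in> U'" "\<phi> holomorphic_on U'"
    unfolding U'_def using U open_halfplane by (auto intro: holomorphic_on_subset)
  have base_\<phi>: "base s = \<phi> s / (s - of_nat N)" if "s \<in> U'" "s \<noteq> of_nat N" for s
  proof -
    have "zeta (s - of_nat N + 1) = G (s - of_nat N + 1) / (s - of_nat N)"
      using G(3)[of "s - of_nat N + 1"] that by (simp add: U'_def)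
    moreover have "1 * s + (1 - of_nat N) = s - of_nat N + 1" "1 * s + 1 = s + 1" by simp_all
    ultimately have "base s = G (s - of_nat N + 1) / (s - of_nat N) * B (s - of_nat N + 1) / zeta (s + 1)"
      unfolding base_def by (simp only:)
    thus ?thesis unfolding \<phi>_def by (simp add: mult_ac)
  qed

  have "\<exists>(g :: nat \<Rightarrow> complex \<Rightarrow> complex) (r :: nat \<Rightarrow> real). (\<forall>n. g n meromorphic_on {s. Re s > r n}) \<and> (\<forall>n s. Re s > real N + 1 \<longrightarrow> g n s = ?O s) \<and>
            ?A = (\<Union>n. {s. Re s > r n}) \<and> g 0 = base \<and> r 0 = real N - 1"
  proof (cases "length lam = 1 \<or> lam = [1, 1]")
    case True
    have "\<exists>h. h meromorphic_on UNIV \<and> (\<forall>s. Re s > real N \<longrightarrow> h s = ?O s)"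
      using True
    proof
      assume "length lam = 1"
      then obtain r where r: "lam = [r]" by (cases lam) auto
      hence rN: "r = N" "r \<ge> 1" using N lam by auto
      have "(\<lambda>s. \<Prod>i<r. zeta (1 * s + (- of_nat i))) meromorphic_on UNIV"
        by (intro meromorphic_intros)
      moreover have "(\<Prod>i<r. zeta (1 * s + (- of_nat i))) = ?O s" if "Re s > real N" for s
        using OF'[OF that] fixed_point_series_single[of r s] z_ne[of s] that rN by (simp add: r)
      ultimately show ?thesis by blast
    next
      assume l: "lam = [1, 1]"
      have "(\<lambda>s. zeta (1 * s + 0) * zeta (1 * s + 0) * zeta (1 * s + (- 1)) / zeta (2 * s + 0)) meromorphic_on UNIV"
        by (intro meromorphic_intros)
      moreover have "zeta (1 * s + 0) * zeta (1 * s + 0) * zeta (1 * s + (- 1)) / zeta (2 * s + 0) = ?O s"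
        if "Re s > real N" for s
        using OF'[OF that] ramanujan_identity[of s] z_ne[of s] that N by (simp add: l)
      ultimately show ?thesis by blast
    qed
    then obtain h where h: "h meromorphic_on UNIV" "\<And>s. Re s > real N \<Longrightarrow> h s = ?O s" by blast
    \<comment> \<open>From index 1 on, the entire plane is already covered by h; the decreasing half-planes only
      serve to fit the gluing theorem.\<close>
    define r where "r = (\<lambda>n::nat. real N - 1 - real n)"
    define g where "g = (\<lambda>n::nat. if n = 0 then base else h)"
    have "(\<Union>n. {s. Re s > r n}) = UNIV"
    proof (intro equalityI subsetI)
      fix s :: complex
      obtain n :: nat where "real n > real N - 1 - Re s" using reals_Archimedean2 by blast
      thus "s \<in> (\<Union>n. {s. Re s > r n})" by (auto simp: r_def intro!: exI[of _ n])
    qed auto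
    moreover have "g n meromorphic_on {s. Re s > r n}" for n
      using base_mero meromorphic_on_subset[OF h(1)] by (simp add: g_def r_def)
    moreover have "g n s = ?O s" if "Re s > real N + 1" for n s
      using base_eq[of s] h(2)[of s] that by (simp add: g_def)
    ultimately show ?thesis using True by (intro exI[of _ g] exI[of _ r]) (simp add: g_def r_def)
  next
    case False
    have "\<exists>\<Psi>. \<Psi> meromorphic_on {w. Re w > 1 / real (Suc n)} \<and> (\<forall>w. Re w > 2 \<longrightarrow> \<Psi> w = ?F (w + of_nat N - 1))" for n
      by (rule fixed_point_count_continuation[OF lam(2,1) N]) auto
    hence "\<forall>n. \<exists>\<Psi>. \<Psi> meromorphic_on {w. Re w > 1 / real (Suc n)} \<and> (\<forall>w. Re w > 2 \<longrightarrow> \<Psi> w = ?F (w + of_nat N - 1))"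
      by blast
    from choice[OF this] obtain \<Psi> where \<Psi>: "\<And>n. \<Psi> n meromorphic_on {w. Re w > 1 / real (Suc n)}"
      "\<And>n w. Re w > 2 \<Longrightarrow> \<Psi> n w = ?F (w + of_nat N - 1)" by blast
    \<comment> \<open>The continuation for \<delta> = 1 / n reaches down to real part N - 2 + \<delta>, since w = s - N + 2.\<close>
    define r where "r = (\<lambda>n. if n = 0 then real N - 1 else real N - 2 + 1 / real n)"
    define g where "g = (\<lambda>n. if n = 0 then base else (\<lambda>s. \<Psi> (n - 1) (s - of_nat N + 2) / zeta (1 * s + 1)))"
    have "(\<Union>n. {s. Re s > r n}) = {s. Re s > real N - 2}"
    proof (intro equalityI subsetI)
      fix s :: complex assume "s \<in> {s. Re s > real N - 2}"
      hence "Re s - (real N - 2) > 0" by simp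
      then obtain n where n: "n > 0" "1 / real n < Re s - (real N - 2)"
        using real_arch_invD[of "Re s - (real N - 2)"] by (auto simp: divide_inverse)
      thus "s \<in> (\<Union>n. {s. Re s > r n})" by (auto simp: r_def intro!: exI[of _ n])
    next
      fix s :: complex assume "s \<in> (\<Union>n. {s. Re s > r n})"
      then obtain n where n: "Re s > r n" by blast
      have "1 / real n \<ge> 0" by simp
      hence "r n \<ge> real N - 2" by (auto simp: r_def)
      thus "s \<in> {s. Re s > real N - 2}" using n by simp
    qed
    moreover have "g n meromorphic_on {s. Re s > r n}" for n
    proof (cases "n = 0")
      case True thus ?thesis using base_mero by (simp add: g_def r_def)
    next
      case False
      hence "Suc (n - 1) = n" by simp
      hence "\<Psi> (n - 1) meromorphic_on {w. Re w > 1 / real n}" using \<Psi>(1)[of "n - 1"] by metis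
      hence "(\<lambda>s. \<Psi> (n - 1) (s - of_nat N + 2)) meromorphic_on {s. Re s > r n}"
        by (rule meromorphic_on_compose) (use False in \<open>auto intro!: analytic_intros simp: r_def\<close>)
      hence "(\<lambda>s. \<Psi> (n - 1) (s - of_nat N + 2) / zeta (1 * s + 1)) meromorphic_on {s. Re s > r n}"
        by (intro meromorphic_intros)
      thus ?thesis using False unfolding g_def by (simp only: if_False)
    qed
    moreover have "g n s = ?O s" if "Re s > real N + 1" for n s
    proof (cases "n = 0")
      case True thus ?thesis using base_eq[of s] that by (simp add: g_def)
    next
      case False
      have "\<Psi> (n - 1) (s - of_nat N + 2) = ?F (s - of_nat N + 2 + of_nat N - 1)"
        by (rule \<Psi>(2)) (use that in simp)
      also have "s - of_nat N + 2 + of_nat N - 1 = s + 1" by simp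
      finally show ?thesis using False OF'[of s] that by (simp add: g_def)
    qed
    ultimately show ?thesis using False by (intro exI[of _ g] exI[of _ r]) (simp add: g_def r_def)
  qed
  then obtain g :: "nat \<Rightarrow> complex \<Rightarrow> complex" and r :: "nat \<Rightarrow> real"
    where gr: "\<forall>n. g n meromorphic_on {s. Re s > r n}" "\<forall>n s. Re s > real N + 1 \<longrightarrow> g n s = ?O s"
      and A: "?A = (\<Union>n. {s. Re s > r n})" and g0: "g 0 = base" "r 0 = real N - 1"
    by (elim exE conjE) (rule that)
  have g: "g n meromorphic_on {s. Re s > r n}" "Re s > real N + 1 \<Longrightarrow> g n s = ?O s" for n s
    using gr by simp_all
  from meromorphic_glue[of g r "real N + 1" ?O, OF g] obtain f where f: "f meromorphic_on ?A"
    "\<And>n s. Re s > r n \<Longrightarrow> f s = remove_sings (g n) s" unfolding A by blast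
  have f0: "f s = remove_sings base s" if "Re s > real N - 1" for s
    using f(2)[of 0 s] that g0 by simp
  have f_base: "f s = base s" if "Re s \<ge> real N" "s \<noteq> of_nat N" for s
  proof -
    have "base analytic_on {s}" by (rule analytic_on_subset[OF base_an]) (use that in auto)
    thus ?thesis using f0[of s] that by simp
  qed
  have "f analytic_on {s. Re s = real N} - {of_nat N}"
  proof -
    have rs: "remove_sings base analytic_on {s. Re s = real N} - {of_nat N}"
      by (intro remove_sings_analytic_on analytic_on_subset[OF base_an]) auto
    show ?thesis
    proof (rule analytic_on_analytic_at[THEN iffD2], rule ballI)
      fix s assume s: "s \<in> {s. Re s = real N} - {of_nat N}"
      hence "remove_sings base analytic_on {s}" by (intro analytic_on_subset[OF rs]) simp
      moreover have "eventually (\<lambda>w. w \<in> {s. Re s > real N - 1}) (nhds s)"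
        using s by (intro eventually_nhds_in_open open_halfplane) simp
      hence "eventually (\<lambda>w. remove_sings base w = f w) (nhds s)"
        by eventually_elim (use f0 in simp)
      ultimately show "f analytic_on {s}" using analytic_at_cong by blast
    qed
  qed
  moreover have near: "eventually (\<lambda>s. f s = \<phi> s / (s - of_nat N)) (at (of_nat N))"
  proof -
    have "base meromorphic_on {of_nat N}" by (rule meromorphic_on_subset[OF base_mero]) auto
    hence "isolated_singularity_at base (of_nat N)" by (simp add: meromorphic_at_iff)
    hence "eventually (\<lambda>s. remove_sings base s = base s) (at (of_nat N))"
      by (rule eventually_remove_sings_eq_at)
    moreover have "eventually (\<lambda>s. s \<in> U' - {of_nat N}) (at (of_nat N))"
      using U' by (intro eventually_at_in_open)
    ultimately show ?thesis
      by eventually_elim (use f0 base_\<phi> in \<open>auto simp: U'_def\<close>)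
  qed
  moreover have "is_pole f (of_nat N)"
  proof -
    have "is_pole (\<lambda>s. \<phi> s / (s - of_nat N) ^ 1) (of_nat N)"
      by (rule is_pole_basic[OF U'(3,1,2) \<phi>N]) simp
    thus ?thesis using is_pole_cong[OF near refl] by simp
  qed
  moreover have "zorder f (of_nat N) = -1"
  proof -
    have "zorder (\<lambda>s. \<phi> s / (s - of_nat N)) (of_nat N) = -1"
      by (rule zorder_eqI[OF U'(1,2,3) \<phi>N]) (simp add: power_int_minus divide_inverse)
    thus ?thesis using zorder_cong[OF near refl] by simp
  qed
  moreover have "\<forall>s. Re s > real N \<longrightarrow> f s = ?O s"
  proof (intro allI impI)
    fix s assume s: "Re s > real N"
    hence "s \<noteq> of_nat N" by auto
    thus "f s = ?O s" using f_base[of s] base_eq[OF s] s by simp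
  qed
  ultimately show "\<exists>f. f meromorphic_on ?A \<and> (\<forall>s. Re s > real N \<longrightarrow> f s = ?O s) \<and>
          f analytic_on ({s. Re s = real N} - {of_nat N}) \<and>
          is_pole f (of_nat N) \<and> zorder f (of_nat N) = -1"
    using f(1) by blast
qed

section \<open>The product systems of a partition\<close>

theorem theorem4p1:
  fixes X :: "nat \<Rightarrow> 'a set" and T :: "nat \<Rightarrow> 'a \<Rightarrow> 'a"
    and lam :: "nat list" and N :: nat
  assumes maps: "\<And>r. r \<ge> 1 \<Longrightarrow> T r \<in> X r \<rightarrow> X r"
    and finite_orbits: "\<And>r n. r \<ge> 1 \<Longrightarrow> n \<ge> 1 \<Longrightarrow> finite (closed_orbits (X r) (T r) n)"
    and orbits: "\<And>r n. r \<ge> 1 \<Longrightarrow> n \<ge> 1 \<Longrightarrow>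
                   orbit_count (X r) (T r) n = index_subgroup_count (Z_power r) n"
    and partition: "lam \<noteq> []" "sorted_wrt (\<ge>) lam" "\<forall>k\<in>set lam. k \<ge> 1" "N = sum_list lam"
  shows
    "abscissa_of_convergence
       (\<lambda>n. of_nat (orbit_count (partition_space X lam) (partition_map T lam) n))
         = ereal (real N) \<and>
     (\<exists>f. f meromorphic_on
            (if length lam = 1 \<or> lam = [1, 1] then UNIV else {s. Re s > real N - 2}) \<and>
          (\<forall>s. Re s > real N \<longrightarrow>
             f s = orbit_dirichlet_series (partition_space X lam) (partition_map T lam) s) \<and>
          f analytic_on ({s. Re s = real N} - {of_nat N}) \<and>
          is_pole f (of_nat N) \<and> zorder f (of_nat N) = -1) \<and>
     (\<exists>K::real. K > 0 \<and>
        (\<lambda>n. \<Sum>\<nu>=1..n. real (orbit_count (partition_space X lam) (partition_map T lam) \<nu>))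
          \<sim>[sequentially] (\<lambda>n. K * real n ^ N))"
proof -
  define O' where "O' = orbit_count (partition_space X lam) (partition_map T lam)"
  have lam: "\<forall>r\<in>set lam. r \<ge> 1" using partition(3) .
  have N1: "N \<ge> 1" using partition by (cases lam) auto
  have rec: "(\<Sum>d | d dvd n. d * O' d) = fixed_point_count lam n" if n: "n > 0" for n
  proof -
    have "(\<Sum>d | d dvd n. d * O' d) = (\<Prod>r\<leftarrow>lam. \<Sum>d | d dvd n. d * orbit_count (X r) (T r) d)"
      unfolding O'_def
      by (rule orbit_count_partition_convolution[OF _ _ n]) (use maps finite_orbits lam in auto)
    also have "map (\<lambda>r. \<Sum>d | d dvd n. d * orbit_count (X r) (T r) d) lam = map (\<lambda>r. subgroup_number (Suc r) n) lam"
    proof (rule map_cong[OF refl])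
      fix r assume "r \<in> set lam"
      hence r: "r \<ge> 1" using lam by blast
      have "orbit_count (X r) (T r) d = subgroup_number r d" if "d dvd n" for d
      proof -
        have "d > 0" using that n by (auto intro: Nat.gr0I)
        thus ?thesis using orbits[OF r, of d] index_subgroup_count_Z_power[of d r] by simp
      qed
      thus "(\<Sum>d | d dvd n. d * orbit_count (X r) (T r) d) = subgroup_number (Suc r) n"
        unfolding subgroup_number.simps(2) by (intro sum.cong refl) simp
    qed
    finally show ?thesis by (simp only: fixed_point_count_def)
  qed
  obtain H where H: "summable_weight H"
    "\<And>n. n > 0 \<Longrightarrow> real (fixed_point_count lam n) = real n ^ N * (\<Sum>e | e dvd n. H e)"
    using fixed_point_count_weight[of lam] partition(4) by blast
  have "real (\<Sum>d | d dvd n. d * O' d) = real n ^ N * (\<Sum>e | e dvd n. H e)" if "n > 0" for n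
    unfolding rec[OF that] by (rule H(2)[OF that])
  from orbit_weights[OF N1 H(1) this] obtain b where b: "(\<lambda>n. \<bar>b n\<bar>) summable_on {0<..}" "infsum b {0<..} > 0"
    "\<And>n. n > 0 \<Longrightarrow> real (O' n) = real n ^ N * dirichlet_prod b (\<lambda>n. 1 / real n) n" by blast
  define K where "K = infsum b {0<..} / real N"
  have K: "K > 0" using b(2) N1 by (simp add: K_def)
  have lim: "(\<lambda>x. (\<Sum>n=1..x. real (O' n)) / real x ^ N) \<longlonglongrightarrow> K"
    unfolding K_def by (rule summatory_asymptotics[OF N1 b(1,3)])
  note cont = orbit_series_continuation[where O' = O', OF partition(1) lam partition(4)]
  have "abscissa_of_convergence (\<lambda>n. of_nat (O' n)) = ereal (real N)"
  proof (rule abscissa_eq[OF lim K N1])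
    fix \<sigma> :: real assume "\<sigma> > real N"
    from cont(2)[OF rec this] have "abs_summable_at (\<lambda>n. of_nat (O' n)) (Re (of_real \<sigma>))" by simp
    from abs_summable_at_summable[OF this] show "summable (\<lambda>n. real (O' (Suc n)) * real (Suc n) powr -\<sigma>)"
      unfolding norm_mult norm_of_nat_powr[OF zero_less_Suc] by (simp del: of_nat_Suc)
  qed
  moreover have "(\<lambda>n. \<Sum>\<nu>=1..n. real (O' \<nu>)) \<sim>[sequentially] (\<lambda>n. K * real n ^ N)"
  proof (rule asymp_equivI')
    have "(\<lambda>x. (\<Sum>n=1..x. real (O' n)) / real x ^ N / K) \<longlonglongrightarrow> K / K"
      using K by (intro tendsto_divide lim tendsto_const) auto
    thus "(\<lambda>n. (\<Sum>\<nu>=1..n. real (O' \<nu>)) / (K * real n ^ N)) \<longlonglongrightarrow> 1"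
      using K by (simp add: mult.commute)
  qed
  ultimately show ?thesis
    using cont(1)[OF rec] K unfolding orbit_dirichlet_series_def O'_def by blast
qed

end
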